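(* Assume that $f$ is semiconcave. Let $c(\lambda)=c_{(1+\lambda)\Omega}$ for $\lambda\in(-\varepsilon_0,\varepsilon_0)$. Then $\lambda\mapsto c(\lambda)$ is semiconvex in its domain $(-\varepsilon_0,\varepsilon_0)$. As a consequence, it is twice differentiable almost everywhere.
   Context: Standing assumptions. $\varepsilon>0$ is fixed, $p>2$, $U\subset\mathbb{R}^n$ is open and bounded with smooth boundary, $f\in C^1(\overline U)$, and $H(x,\xi)=|\xi|^p-f(x)$. $\Omega\subset\mathbb{R}^n$ is open, bounded, connected, with $C^2$ boundary, $\overline\Omega\subset U$, star-shaped with respect to the origin, and there is $\kappa>0$ such that $\overline{B(0,\kappa)}\subset\Omega$ and $\mathrm{dist}(x,\overline\Omega)\ge\kappa s$ for all $x\in(1+s)\partial\Omega$ and all $s>0$. The number $\varepsilon_0\in(0,1)$ is such that $(1+\lambda)\Omega\subset U$ for $|\lambda|<\varepsilon_0$. Viscosity subsolutions. For an open set $\mathcal{O}$ and $c\in\mathbb{R}$, $w$ satisfies $H(x,Dw)-\varepsilon\Delta w\le c$ in $\mathcal{O}$ if for every $x\in\mathcal{O}$ and $\varphi\in C^2(\mathcal{O})$ such that $w-\varphi$ has a local maximum at $x$, $H(x,D\varphi(x))-\varepsilon\Delta\varphi(x)\le c$. Additive eigenvalue. $c_{\mathcal{O}}=\min\{c\in\mathbb{R}: H(x,Du)-\varepsilon\Delta u\le c\text{ in }\mathcal{O}\text{ has a (continuous viscosity) solution}\}$. Semiconvexity. A function $u:I\to\mathbb{R}$ on an interval $I\subset\mathbb{R}$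 is semiconvex if $x\mapsto u(x)+(2\tau)^{-1}|x|^2$ is convex for some $\tau>0$; equivalently, there is $\tau>0$ with $u(sx+(1-s)y)\le su(x)+(1-s)u(y)+s(1-s)\frac{|x-y|^2}{2\tau}$ for all $x,y\in I$, $s\in[0,1]$. The function $f$ is semiconcave if there is $\tau>0$ with $f(sx+(1-s)y)\ge sf(x)+(1-s)f(y)-s(1-s)\frac{|x-y|^2}{2\tau}$ for all $s\in[0,1]$ and all $x,y$ such that the segment from $x$ to $y$ lies in $\overline U$. *)

theory Defs
  imports "HOL-Analysis.Analysis" "HOL-Library.Extended_Nat"
begin

text \<open>Classical differentiability classes. The predicate below is meant for open \<open>S\<close>, where
  differentiability within \<open>S\<close> and at a point of \<open>S\<close> agree.\<close>

primrec Ck_on :: "nat \<Rightarrow> ('a::euclidean_space \<Rightarrow> real) \<Rightarrow> 'a set \<Rightarrow> bool" where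
  "Ck_on 0 \<phi> S \<longleftrightarrow> continuous_on S \<phi>"
| "Ck_on (Suc k) \<phi> S \<longleftrightarrow>
     \<phi> differentiable_on S \<and> (\<forall>b\<in>Basis. Ck_on k (\<lambda>x. frechet_derivative \<phi> (at x) b) S)"

definition gradient :: "('a::euclidean_space \<Rightarrow> real) \<Rightarrow> 'a \<Rightarrow> 'a" where
  "gradient \<phi> x = (\<Sum>b\<in>Basis. frechet_derivative \<phi> (at x) b *\<^sub>R b)"

definition laplacian :: "('a::euclidean_space \<Rightarrow> real) \<Rightarrow> 'a \<Rightarrow> real" where
  "laplacian \<phi> x =
     (\<Sum>b\<in>Basis. frechet_derivative (\<lambda>y. frechet_derivative \<phi> (at y) b) (at x) b)"

text \<open>The class \<open>C\<^sup>1\<close> of the closure of the open set \<open>U\<close>: the function and its gradient on \<open>U\<close>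
  extend continuously to the closure.\<close>

definition C1_closure :: "('a::euclidean_space \<Rightarrow> real) \<Rightarrow> 'a set \<Rightarrow> bool" where
  "C1_closure f U \<longleftrightarrow>
     continuous_on (closure U) f \<and>
     (\<exists>g. continuous_on (closure U) g \<and> (\<forall>x\<in>U. (f has_derivative (\<lambda>h. g x \<bullet> h)) (at x)))"

text \<open>Near each boundary point, \<open>U\<close> is the region strictly above the graph of a \<open>C\<^sup>k\<close> function over
  a coordinate hyperplane, up to relabelling and reversing the axes. A function on the hyperplane
  orthogonal to \<open>b\<close> is represented by a function \<open>\<gamma>\<close> on the whole space that is evaluated only at
  points of that hyperplane. The value \<open>k = \<infinity>\<close> describes a smooth boundary.\<close>

definition Ck_boundary :: "enat \<Rightarrow> 'a::euclidean_space set \<Rightarrow> bool" where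
  "Ck_boundary k U \<longleftrightarrow>
     (\<forall>z\<in>frontier U. \<exists>r>0. \<exists>b\<in>Basis. \<exists>\<sigma>\<in>{-1, 1}. \<exists>\<gamma>.
        (\<forall>m. enat m \<le> k \<longrightarrow> Ck_on m \<gamma> UNIV) \<and>
        U \<inter> ball z r = {x \<in> ball z r. \<sigma> * (x \<bullet> b) > \<gamma> (x - (x \<bullet> b) *\<^sub>R b)})"

definition Hamiltonian :: "real \<Rightarrow> ('a::euclidean_space \<Rightarrow> real) \<Rightarrow> 'a \<Rightarrow> 'a \<Rightarrow> real" where
  "Hamiltonian p f x \<xi> = norm \<xi> powr p - f x"

definition local_max_at :: "('a::metric_space \<Rightarrow> real) \<Rightarrow> 'a set \<Rightarrow> 'a \<Rightarrow> bool" where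
  "local_max_at g S x \<longleftrightarrow> (\<exists>\<delta>>0. \<forall>y\<in>S \<inter> ball x \<delta>. g y \<le> g x)"

definition viscosity_subsolution ::
  "real \<Rightarrow> ('a::euclidean_space \<Rightarrow> 'a \<Rightarrow> real) \<Rightarrow> 'a set \<Rightarrow> real \<Rightarrow> ('a \<Rightarrow> real) \<Rightarrow> bool" where
  "viscosity_subsolution \<epsilon> H S c w \<longleftrightarrow>
     (\<forall>x\<in>S. \<forall>\<phi>. Ck_on 2 \<phi> S \<longrightarrow> local_max_at (\<lambda>y. w y - \<phi> y) S x \<longrightarrow>
        H x (gradient \<phi> x) - \<epsilon> * laplacian \<phi> x \<le> c)"

text \<open>On the reals, \<open>Least\<close> is the minimum of the set of admissible constants, and is unspecified
  if the infimum is not attained.\<close>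

definition additive_eigenvalue ::
  "real \<Rightarrow> ('a::euclidean_space \<Rightarrow> 'a \<Rightarrow> real) \<Rightarrow> 'a set \<Rightarrow> real" where
  "additive_eigenvalue \<epsilon> H S =
     (LEAST c. \<exists>u. continuous_on S u \<and> viscosity_subsolution \<epsilon> H S c u)"

definition semiconvex_on :: "real set \<Rightarrow> (real \<Rightarrow> real) \<Rightarrow> bool" where
  "semiconvex_on I u \<longleftrightarrow> (\<exists>\<tau>>0. convex_on I (\<lambda>x. u x + \<bar>x\<bar>\<^sup>2 / (2 * \<tau>)))"

definition semiconcave_on :: "'a::euclidean_space set \<Rightarrow> ('a \<Rightarrow> real) \<Rightarrow> bool" where
  "semiconcave_on S f \<longleftrightarrow>
     (\<exists>\<tau>>0. \<forall>x y. closed_segment x y \<subseteq> S \<longrightarrow>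
        (\<forall>s\<in>{0..1}. f (s *\<^sub>R x + (1 - s) *\<^sub>R y)
           \<ge> s * f x + (1 - s) * f y - s * (1 - s) * ((norm (x - y))\<^sup>2 / (2 * \<tau>))))"

text \<open>Twice differentiability at a point in the sense in which it holds almost everywhere for convex
  functions, whose derivative may fail to exist on a dense countable set: the derivative exists at
  \<open>x\<close>, it is differentiable at \<open>x\<close> relative to the set on which it exists, and the resulting second
  order Taylor expansion at \<open>x\<close> is valid.\<close>

definition twice_differentiable_at :: "(real \<Rightarrow> real) \<Rightarrow> real \<Rightarrow> bool" where
  "twice_differentiable_at u x \<longleftrightarrow>
     (\<exists>d A. (u has_real_derivative d) (at x) \<and>
        (deriv u has_real_derivative A) (at x within {y. u differentiable (at y)}) \<and>
        ((\<lambda>h. (u (x + h) - u x - d * h - A * h\<^sup>2 / 2) / h\<^sup>2) \<longlongrightarrow> 0) (at 0))"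

end

theory Submission
  imports Defs "HOL-Library.Function_Algebras"
begin

text \<open>Let \<open>\<mu>\<^sub>i = 1 + \<lambda>\<^sub>i\<close> and let \<open>u\<^sub>i\<close> be a subsolution in \<open>\<mu>\<^sub>i \<Omega>\<close> for the constant \<open>c(\<lambda>\<^sub>i)\<close>. For
  \<open>\<mu> = s \<mu>\<^sub>1 + t \<mu>\<^sub>2\<close> with \<open>s + t = 1\<close>, the function
  \<open>s (\<mu> / \<mu>\<^sub>1)\<^sup>2 u\<^sub>1(\<mu>\<^sub>1 x / \<mu>) + t (\<mu> / \<mu>\<^sub>2)\<^sup>2 u\<^sub>2(\<mu>\<^sub>2 x / \<mu>)\<close>, divided by
  \<open>B = s (\<mu> / \<mu>\<^sub>1)\<^sup>q + t (\<mu> / \<mu>\<^sub>2)\<^sup>q\<close> where \<open>q = p / (p - 1)\<close>, is a subsolution in \<open>\<mu> \<Omega>\<close> for a constant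
  that exceeds \<open>s c(\<lambda>\<^sub>1) + t c(\<lambda>\<^sub>2)\<close> by \<open>O(s t (\<lambda>\<^sub>1 - \<lambda>\<^sub>2)\<^sup>2)\<close>, because \<open>B = 1 + O(s t (\<lambda>\<^sub>1 - \<lambda>\<^sub>2)\<^sup>2)\<close> and
  \<open>f\<close> is semiconcave.

  Since \<open>|\<xi>|\<^sup>p\<close> is a supremum of affine functions, a subsolution is a common subsolution of the linear
  equations \<open>- \<epsilon> \<Delta>u + Q \<bullet> Du = g\<close>, and it suffices to add subsolutions of these. An exponential factor
  removes the drift. For the Poisson equation, subsolutions can be added because every polynomial on
  a sphere extends to a polynomial solution in the ball, which reduces the comparison of two
  viscosity subsolutions to comparisons with smooth functions.

  The minimum in the definition of \<open>c(\<lambda>)\<close> is attained: for \<open>p > 2\<close>, barriers give an interior modulus of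
  continuity that depends only on the constant. The second claim is the theorem of Alexandrov in
  dimension one, derived from Lebesgue's theorem on monotone functions.\<close>

section \<open>Second order jets\<close>

text \<open>A test function that touches a sum from above yields none for the summands, and the
  gradient term is nonlinear. Freezing \<open>Q\<close> in the Legendre representation of
  \<open>|\<xi>|^p\<close> leaves a linear equation with constant drift for each \<open>Q\<close>.
  All of these hold for one and the same combination, so \<open>Q\<close> can be fitted to the
  gradient at the very end, once a superjet of the combination is given.

  The weights come from scaling. With \<open>b = \<mu> / \<mu>\<^sub>i\<close>, the function
  \<open>b^2 u(x / b)\<close> has at \<open>x\<close> the Laplacian of \<open>u\<close> at
  \<open>x / b\<close>, which keeps \<epsilon> fixed, but \<open>b\<close> times its gradient.
  Moving this \<open>b\<close> onto \<open>Q\<close> multiplies the conjugate function by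
  \<open>b^q\<close>, so the sum carries \<open>B\<close> copies of it and has to be divided by
  \<open>B\<close>.

  The ratios \<open>\<mu>\<^sub>i / \<mu>\<close> have weighted mean one, so the first order terms
  of \<open>B - 1\<close> cancel. Division by \<open>B\<close> also changes the right-hand side, and
  this effect is of second order only because \<open>c\<close> is bounded uniformly in \<lambda>.
  The lower bound for \<open>c\<close> comes from the barriers as well; their exponent is positive
  because \<open>p > 2\<close>.\<close>

definition op_trace :: "('a::euclidean_space \<Rightarrow> 'a) \<Rightarrow> real" where
  "op_trace X = (\<Sum>b\<in>Basis. b \<bullet> X b)"

text \<open>\<open>X\<close> is any linear map, not necessarily symmetric: only its quadratic form
  and its trace enter, and both see just the symmetric part.\<close>

definition jet :: "('a::euclidean_space \<Rightarrow> real) \<Rightarrow> 'a \<Rightarrow> 'a \<Rightarrow> ('a \<Rightarrow> 'a) \<Rightarrow> bool" where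
  "jet \<phi> x q X \<longleftrightarrow> linear X \<and> (\<forall>\<delta>>0. \<forall>\<^sub>F y in nhds x.
     \<bar>\<phi> y - \<phi> x - q \<bullet> (y - x) - (y - x) \<bullet> X (y - x) / 2\<bar> \<le> \<delta> * (norm (y - x))\<^sup>2)"

definition superjet :: "('a::euclidean_space \<Rightarrow> real) \<Rightarrow> 'a \<Rightarrow> 'a \<Rightarrow> ('a \<Rightarrow> 'a) \<Rightarrow> bool" where
  "superjet u x q X \<longleftrightarrow> linear X \<and> (\<forall>\<delta>>0. \<forall>\<^sub>F y in nhds x.
     u y \<le> u x + q \<bullet> (y - x) + (y - x) \<bullet> X (y - x) / 2 + \<delta> * (norm (y - x))\<^sup>2)"

lemma op_trace_simps:
  "op_trace (\<lambda>h. X h + Y h) = op_trace X + op_trace Y"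
  "op_trace (\<lambda>h. X h - Y h) = op_trace X - op_trace Y"
  "op_trace (\<lambda>h. - X h) = - op_trace X"
  "op_trace (\<lambda>h. r *\<^sub>R X h) = r * op_trace X"
  "op_trace (\<lambda>h. 0) = 0"
  "op_trace (\<lambda>h::'a::euclidean_space. h) = DIM('a)"
  by (simp_all add: op_trace_def inner_add_right inner_diff_right sum.distrib sum_subtractf
      sum_distrib_left sum_negf)

lemma op_trace_rank_one: "op_trace (\<lambda>h. (k \<bullet> h) *\<^sub>R l) = k \<bullet> l"
  unfolding op_trace_def by (subst euclidean_inner[of k l]) (simp add: inner_commute)

lemma op_trace_adjoint: "linear X \<Longrightarrow> op_trace (adjoint X) = op_trace X"
  unfolding op_trace_def using adjoint_works[of X] by (intro sum.cong) (auto simp: inner_commute)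

text \<open>Along the segment from \<open>x\<close> to \<open>y\<close>, subtract the quadratic
  Taylor terms and apply the mean value theorem once: the first order expansion of \<open>D\<close>
  at \<open>x\<close> then gives the second order expansion of \<phi>. The gradient has to be
  differentiable at \<open>x\<close> only, not near it.\<close>

lemma jetI:
  fixes \<phi> :: "'a::euclidean_space \<Rightarrow> real"
  assumes D: "\<forall>\<^sub>F y in nhds x. (\<phi> has_derivative (\<lambda>h. D y \<bullet> h)) (at y)"
    and X: "(D has_derivative X) (at x)"
  shows "jet \<phi> x (D x) X"
  unfolding jet_def
proof (intro conjI allI impI)
  show lin: "linear X" using X has_derivative_linear by blast
  fix \<delta> :: real assume "\<delta> > 0"
  obtain d1 where d1: "d1 > 0" "\<And>y. dist y x < d1 \<Longrightarrow> (\<phi> has_derivative (\<lambda>h. D y \<bullet> h)) (at y)"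
    using D unfolding eventually_nhds_metric by blast
  obtain d2 where d2: "d2 > 0"
    "\<And>y. norm (y - x) < d2 \<Longrightarrow> norm (D y - D x - X (y - x)) \<le> \<delta> * norm (y - x)"
    using X[unfolded has_derivative_at_alt] \<open>\<delta> > 0\<close> by blast
  show "\<forall>\<^sub>F y in nhds x. \<bar>\<phi> y - \<phi> x - D x \<bullet> (y - x) - (y - x) \<bullet> X (y - x) / 2\<bar> \<le> \<delta> * (norm (y - x))\<^sup>2"
    unfolding eventually_nhds_metric
  proof (intro exI[of _ "min d1 d2"] conjI allI impI)
    show "0 < min d1 d2" using d1 d2 by simp
    fix y assume y: "dist y x < min d1 d2"
    define h where "h = y - x"
    have hn: "norm h < d1" "norm h < d2" using y by (auto simp: h_def dist_norm)
    let ?\<psi> = "\<lambda>s. \<phi> (x + s *\<^sub>R h) - s * (D x \<bullet> h) - s\<^sup>2 / 2 * (h \<bullet> X h)"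
    have der: "(?\<psi> has_derivative (\<lambda>t. (D (x + s *\<^sub>R h) \<bullet> h - D x \<bullet> h - s * (h \<bullet> X h)) * t)) (at s)"
      if "0 \<le> s" "s \<le> 1" for s
    proof -
      have "norm (s *\<^sub>R h) \<le> norm h" using that by (simp add: mult_left_le_one_le)
      then have *: "(\<phi> has_derivative (\<lambda>k. D (x + s *\<^sub>R h) \<bullet> k)) (at (x + s *\<^sub>R h))"
        using hn by (intro d1(2)) (auto simp: dist_norm)
      have "((\<lambda>s. \<phi> (x + s *\<^sub>R h)) has_derivative (\<lambda>t. D (x + s *\<^sub>R h) \<bullet> (t *\<^sub>R h))) (at s)"
        by (rule has_derivative_compose[of "\<lambda>s. x + s *\<^sub>R h" "\<lambda>t. t *\<^sub>R h" s UNIV \<phi>, OF _ *])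
          (auto intro!: derivative_eq_intros)
      then show ?thesis
        by (auto intro!: derivative_eq_intros simp: algebra_simps)
    qed
    have "\<exists>\<xi>\<in>{0<..<1}. ?\<psi> 1 - ?\<psi> 0 = (D (x + \<xi> *\<^sub>R h) \<bullet> h - D x \<bullet> h - \<xi> * (h \<bullet> X h)) * (1 - 0)"
      by (rule mvt_simple[OF zero_less_one], rule has_derivative_at_withinI, rule der) auto
    then obtain \<xi> where \<xi>: "\<xi> \<in> {0<..<1}" "?\<psi> 1 - ?\<psi> 0 = (D (x + \<xi> *\<^sub>R h) \<bullet> h - D x \<bullet> h - \<xi> * (h \<bullet> X h)) * (1 - 0)"
      by blast
    have "norm (\<xi> *\<^sub>R h) \<le> norm h" using \<xi> by (simp add: mult_left_le_one_le)
    then have "norm (D (x + \<xi> *\<^sub>R h) - D x - X (\<xi> *\<^sub>R h)) \<le> \<delta> * norm (\<xi> *\<^sub>R h)"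
      using d2(2)[of "x + \<xi> *\<^sub>R h"] hn by auto
    also have "\<dots> \<le> \<delta> * norm h" using \<open>\<delta> > 0\<close> \<open>norm (\<xi> *\<^sub>R h) \<le> norm h\<close> by simp
    finally have b: "norm (D (x + \<xi> *\<^sub>R h) - D x - X (\<xi> *\<^sub>R h)) \<le> \<delta> * norm h" .
    have "X (\<xi> *\<^sub>R h) = \<xi> *\<^sub>R X h" using lin by (rule linear_scale)
    moreover have yh: "y = x + h" by (simp add: h_def)
    ultimately have "\<phi> y - \<phi> x - D x \<bullet> h - h \<bullet> X h / 2 = (D (x + \<xi> *\<^sub>R h) - D x - X (\<xi> *\<^sub>R h)) \<bullet> h"
      using \<xi>(2) by (simp add: inner_diff_left inner_commute[of "X h" h])
    also have "\<bar>\<dots>\<bar> \<le> (\<delta> * norm h) * norm h"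
      using Cauchy_Schwarz_ineq2 b by (meson mult_right_mono norm_ge_zero order_trans)
    finally show "\<bar>\<phi> y - \<phi> x - D x \<bullet> (y - x) - (y - x) \<bullet> X (y - x) / 2\<bar> \<le> \<delta> * (norm (y - x))\<^sup>2"
      by (simp add: yh power2_eq_square)
  qed
qed

text \<open>The bridge from explicitly computed derivatives to the iterated
  \<open>frechet_derivative\<close> of the definitions. Openness of \<open>S\<close> makes the
  formula for the first derivative valid in a neighbourhood, so that it can be differentiated
  again.\<close>

lemma gradient_laplacian_eqI:
  fixes \<phi> :: "'a::euclidean_space \<Rightarrow> real"
  assumes S: "open S"
    and D: "\<And>y. y \<in> S \<Longrightarrow> (\<phi> has_derivative (\<lambda>h. D y \<bullet> h)) (at y)"
    and X: "\<And>y. y \<in> S \<Longrightarrow> (D has_derivative X y) (at y)"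
  shows "y \<in> S \<Longrightarrow> gradient \<phi> y = D y"
    and "y \<in> S \<Longrightarrow> laplacian \<phi> y = op_trace (X y)"
    and "(\<And>b b'. b \<in> Basis \<Longrightarrow> b' \<in> Basis \<Longrightarrow> continuous_on S (\<lambda>y. b \<bullet> X y b')) \<Longrightarrow> Ck_on 2 \<phi> S"
proof -
  have fd: "frechet_derivative \<phi> (at y) = (\<lambda>h. D y \<bullet> h)" if "y \<in> S" for y
    using D[OF that] by (metis frechet_derivative_at)
  have hd2: "((\<lambda>y. frechet_derivative \<phi> (at y) b) has_derivative (\<lambda>h. X y h \<bullet> b)) (at y)" if "y \<in> S" for y b
    by (rule has_derivative_transform_within_open[OF has_derivative_inner_left[OF X[OF that]] S that])
      (simp add: fd)
  have fd2: "frechet_derivative (\<lambda>y. frechet_derivative \<phi> (at y) b) (at y) = (\<lambda>h. X y h \<bullet> b)" if "y \<in> S" for y b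
    using hd2[OF that] by (metis frechet_derivative_at)
  show "gradient \<phi> y = D y" if "y \<in> S"
    unfolding gradient_def fd[OF that] by (rule euclidean_representation)
  show "laplacian \<phi> y = op_trace (X y)" if "y \<in> S"
    unfolding laplacian_def op_trace_def fd2[OF that] by (simp add: inner_commute)
  assume c: "\<And>b b'. b \<in> Basis \<Longrightarrow> b' \<in> Basis \<Longrightarrow> continuous_on S (\<lambda>y. b \<bullet> X y b')"
  have "\<phi> differentiable_on S"
    using D by (meson differentiable_at_imp_differentiable_on differentiable_def)
  moreover have "(\<lambda>y. frechet_derivative \<phi> (at y) b) differentiable_on S" for b
    using hd2 by (meson differentiable_at_imp_differentiable_on differentiable_def)
  moreover have "continuous_on S (\<lambda>y. frechet_derivative (\<lambda>y. frechet_derivative \<phi> (at y) b) (at y) b')"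
    if "b \<in> Basis" "b' \<in> Basis" for b b'
    using c[OF that] by (rule continuous_on_eq) (simp add: fd2 inner_commute)
  ultimately show "Ck_on 2 \<phi> S" by (simp add: numeral_2_eq_2)
qed

lemma Ck_on_2_jet:
  fixes \<phi> :: "'a::euclidean_space \<Rightarrow> real"
  assumes S: "open S" "x \<in> S" and C: "Ck_on 2 \<phi> S"
  obtains X where "jet \<phi> x (gradient \<phi> x) X" "op_trace X = laplacian \<phi> x"
proof -
  have d1: "\<phi> differentiable_on S"
    and d2: "\<And>b. b \<in> Basis \<Longrightarrow> (\<lambda>y. frechet_derivative \<phi> (at y) b) differentiable_on S"
    using C by (auto simp: numeral_2_eq_2)
  define X where "X h = (\<Sum>b\<in>Basis. frechet_derivative (\<lambda>y. frechet_derivative \<phi> (at y) b) (at x) h *\<^sub>R b)" for h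
  have gr: "(\<phi> has_derivative (\<lambda>h. gradient \<phi> y \<bullet> h)) (at y)" if "y \<in> S" for y
  proof -
    have *: "(\<phi> has_derivative frechet_derivative \<phi> (at y)) (at y)"
      using d1 that S by (metis at_within_open differentiable_on_def frechet_derivative_works)
    have "frechet_derivative \<phi> (at y) = (\<lambda>h. gradient \<phi> y \<bullet> h)"
    proof
      fix h
      interpret linear "frechet_derivative \<phi> (at y)" using * has_derivative_linear by blast
      have "frechet_derivative \<phi> (at y) h = frechet_derivative \<phi> (at y) (\<Sum>b\<in>Basis. (h \<bullet> b) *\<^sub>R b)"
        by (simp add: euclidean_representation)
      also have "\<dots> = gradient \<phi> y \<bullet> h"
        unfolding sum scale gradient_def inner_sum_left
        by (intro sum.cong refl) (simp add: inner_commute[of h])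
      finally show "frechet_derivative \<phi> (at y) h = gradient \<phi> y \<bullet> h" .
    qed
    with * show ?thesis by simp
  qed
  have "(gradient \<phi> has_derivative X) (at x)"
    unfolding gradient_def[abs_def] X_def[abs_def]
  proof (rule has_derivative_sum)
    fix b :: 'a assume "b \<in> Basis"
    then show "((\<lambda>y. frechet_derivative \<phi> (at y) b *\<^sub>R b) has_derivative
       (\<lambda>h. frechet_derivative (\<lambda>y. frechet_derivative \<phi> (at y) b) (at x) h *\<^sub>R b)) (at x)"
      using d2[of b] S by (intro has_derivative_scaleR_left)
        (metis at_within_open differentiable_on_def frechet_derivative_works)
  qed
  then have "jet \<phi> x (gradient \<phi> x) X"
    using gr S by (intro jetI) (auto simp: eventually_nhds)
  moreover have "op_trace X = laplacian \<phi> x"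
    by (simp add: op_trace_def X_def laplacian_def inner_sum_right inner_Basis if_distrib
        sum.delta cong: if_cong)
  ultimately show ?thesis using that by blast
qed

text \<open>Since \<open>X\<close> may fail to be symmetric, differentiation produces its symmetric
  part.\<close>

lemma inner_operator_derivative:
  fixes X :: "'a::euclidean_space \<Rightarrow> 'a"
  assumes "linear X"
  shows "((\<lambda>y. q + (1/2) *\<^sub>R (X (y - x) + adjoint X (y - x))) has_derivative
      (\<lambda>h. (1/2) *\<^sub>R (X h + adjoint X h))) (at z)"
    and "((\<lambda>y. q \<bullet> (y - x) + (y - x) \<bullet> X (y - x) / 2) has_derivative
      (\<lambda>h. (q + (1/2) *\<^sub>R (X (z - x) + adjoint X (z - x))) \<bullet> h)) (at z)"
proof -
  have lX: "(X has_derivative X) F" for F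
    using assms by (simp add: bounded_linear_imp_has_derivative linear_conv_bounded_linear)
  have lA: "(adjoint X has_derivative adjoint X) F" for F
    using assms by (simp add: bounded_linear_imp_has_derivative linear_conv_bounded_linear[symmetric] adjoint_linear)
  have "((\<lambda>y. y - x) has_derivative (\<lambda>h. h)) (at z)" for z
    by (auto intro!: derivative_eq_intros)
  from has_derivative_compose[OF this lX] has_derivative_compose[OF this lA]
  have 1: "((\<lambda>y. X (y - x)) has_derivative X) (at z)"
    and 2: "((\<lambda>y. adjoint X (y - x)) has_derivative adjoint X) (at z)" for z
    by simp_all
  show "((\<lambda>y. q + (1/2) *\<^sub>R (X (y - x) + adjoint X (y - x))) has_derivative
      (\<lambda>h. (1/2) *\<^sub>R (X h + adjoint X h))) (at z)"
    using 1 2 by (auto intro!: derivative_eq_intros)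
  have "adjoint X a \<bullet> h = a \<bullet> X h" for a h
    using adjoint_works[OF assms, of h a] by (simp add: inner_commute)
  then show "((\<lambda>y. q \<bullet> (y - x) + (y - x) \<bullet> X (y - x) / 2) has_derivative
      (\<lambda>h. (q + (1/2) *\<^sub>R (X (z - x) + adjoint X (z - x))) \<bullet> h)) (at z)"
    by (auto intro!: derivative_eq_intros 1
        simp: inner_add_left inner_commute[of "X (z - x)"] add_divide_distrib)
qed

lemma quadratic_test_function:
  fixes X :: "'a::euclidean_space \<Rightarrow> 'a" and S :: "'a set" and q x :: 'a
  assumes X: "linear X"
  defines "\<phi> \<equiv> \<lambda>y. q \<bullet> (y - x) + (y - x) \<bullet> X (y - x) / 2"
  shows "Ck_on 2 \<phi> (S::'a set)" "gradient \<phi> y = q + (1/2) *\<^sub>R (X (y - x) + adjoint X (y - x))" "laplacian \<phi> y = op_trace X"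
proof -
  note d = inner_operator_derivative[OF X]
  have ad: "b \<bullet> adjoint X b = b \<bullet> X b" for b
    using adjoint_works[OF X, of b b] by (simp add: inner_commute)
  have "Ck_on 2 \<phi> UNIV"
    unfolding \<phi>_def by (rule gradient_laplacian_eqI(3)[OF open_UNIV d(2) d(1)]) auto
  then show "Ck_on 2 \<phi> S"
    unfolding numeral_2_eq_2 Ck_on.simps differentiable_on_def
    by (auto intro: differentiable_within_subset[of _ _ UNIV, OF _ subset_UNIV] continuous_on_subset[of UNIV, OF _ subset_UNIV])
  show "gradient \<phi> y = q + (1/2) *\<^sub>R (X (y - x) + adjoint X (y - x))"
    unfolding \<phi>_def by (rule gradient_laplacian_eqI(1)[OF open_UNIV d(2) d(1)]) auto
  show "laplacian \<phi> y = op_trace X"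
    unfolding \<phi>_def by (subst gradient_laplacian_eqI(2)[OF open_UNIV d(2) d(1)])
      (auto simp: op_trace_def inner_add_right ad)
qed

text \<open>The remainder of order two is absorbed into the Hessian at the price of
  \<open>2 * \<delta>\<close> times the identity. The quadratic polynomial then touches
  \<open>u\<close> from above and can serve as a test function.\<close>

lemma superjet_shift:
  assumes "superjet u x q X" "\<delta> > 0"
  shows "\<forall>\<^sub>F y in nhds x. u y \<le> u x + q \<bullet> (y - x) + (y - x) \<bullet> (X (y - x) + (2 * \<delta>) *\<^sub>R (y - x)) / 2"
proof (rule eventually_mono)
  show "\<forall>\<^sub>F y in nhds x. u y \<le> u x + q \<bullet> (y - x) + (y - x) \<bullet> X (y - x) / 2 + \<delta> * (norm (y - x))\<^sup>2"
    using assms by (auto simp: superjet_def)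
qed (simp add: inner_add_right power2_norm_eq_inner add_divide_distrib)

lemma jet_imp_superjet:
  assumes j: "jet \<phi> x q X" and m: "\<forall>\<^sub>F y in nhds x. u y - \<phi> y \<le> u x - \<phi> x"
  shows "superjet u x q X"
  unfolding superjet_def
proof (intro conjI allI impI)
  show "linear X" using j by (simp add: jet_def)
  fix \<delta> :: real assume "\<delta> > 0"
  then have "\<forall>\<^sub>F y in nhds x.
     \<bar>\<phi> y - \<phi> x - q \<bullet> (y - x) - (y - x) \<bullet> X (y - x) / 2\<bar> \<le> \<delta> * (norm (y - x))\<^sup>2"
    using j by (simp add: jet_def)
  then show "\<forall>\<^sub>F y in nhds x. u y \<le> u x + q \<bullet> (y - x) + (y - x) \<bullet> X (y - x) / 2 + \<delta> * (norm (y - x))\<^sup>2"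
    using m by eventually_elim (simp add: abs_le_iff)
qed

lemma local_max_at_iff:
  assumes "open S" "x \<in> S"
  shows "local_max_at g S x \<longleftrightarrow> (\<forall>\<^sub>F y in nhds x. g y \<le> g x)"
proof
  assume "local_max_at g S x"
  then obtain d where d: "d > 0" "\<forall>y\<in>S \<inter> ball x d. g y \<le> g x" by (auto simp: local_max_at_def)
  then show "\<forall>\<^sub>F y in nhds x. g y \<le> g x"
    using assms by (auto simp: eventually_nhds intro!: exI[of _ "S \<inter> ball x d"])
next
  assume "\<forall>\<^sub>F y in nhds x. g y \<le> g x"
  then show "local_max_at g S x"
    by (auto simp: local_max_at_def eventually_nhds_metric dist_commute)
qed

text \<open>Superjets are local and do not refer to \<open>S\<close>, which makes them easier to
  transform than test functions. A superjet becomes a test function after a small enlargement of the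
  Hessian; a test function gives a superjet by its second order expansion.\<close>

lemma viscosity_subsolution_iff_superjet:
  fixes S :: "'a::euclidean_space set"
  assumes S: "open S" and \<epsilon>: "\<epsilon> > 0"
  shows "viscosity_subsolution \<epsilon> H S c u \<longleftrightarrow>
    (\<forall>x\<in>S. \<forall>q X. superjet u x q X \<longrightarrow> H x q - \<epsilon> * op_trace X \<le> c)"
proof (intro iffI ballI allI impI)
  fix x q X assume v: "viscosity_subsolution \<epsilon> H S c u" and x: "x \<in> S" and j: "superjet u x q X"
  have lin: "linear X" using j by (simp add: superjet_def)
  show "H x q - \<epsilon> * op_trace X \<le> c"
  proof (rule field_le_epsilon)
    fix e :: real assume "e > 0"
    \<comment> \<open>The Hessian grows by \<open>2 * \<delta>\<close> times the identity, whose
      trace is the dimension, so the left-hand side changes by exactly \<open>e\<close>.\<close>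
    define \<delta> where "\<delta> = e / (2 * \<epsilon> * DIM('a))"
    have \<delta>: "\<delta> > 0" using \<open>e > 0\<close> \<epsilon> by (simp add: \<delta>_def)
    define Y where "Y h = X h + (2 * \<delta>) *\<^sub>R h" for h
    have Y: "linear Y" unfolding Y_def using lin
      by (auto simp: linear_iff algebra_simps)
    let ?\<phi> = "\<lambda>y. q \<bullet> (y - x) + (y - x) \<bullet> Y (y - x) / 2"
    have "\<forall>\<^sub>F y in nhds x. u y - ?\<phi> y \<le> u x - ?\<phi> x"
      using superjet_shift[OF j \<delta>] by eventually_elim (auto simp: Y_def)
    then have "H x (gradient ?\<phi> x) - \<epsilon> * laplacian ?\<phi> x \<le> c"
      using v x quadratic_test_function(1)[OF Y, of q x S] local_max_at_iff[OF S x]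
      unfolding viscosity_subsolution_def by blast
    then have "H x q - \<epsilon> * op_trace Y \<le> c"
      using quadratic_test_function(2,3)[OF Y, of q x x] linear_0[OF Y] linear_0[OF adjoint_linear[OF Y]] by simp
    then show "H x q - \<epsilon> * op_trace X \<le> c + e"
      using \<epsilon> unfolding Y_def[abs_def] op_trace_simps by (simp add: \<delta>_def algebra_simps)
  qed
next
  assume j: "\<forall>x\<in>S. \<forall>q X. superjet u x q X \<longrightarrow> H x q - \<epsilon> * op_trace X \<le> c"
  show "viscosity_subsolution \<epsilon> H S c u"
    unfolding viscosity_subsolution_def
  proof (intro ballI allI impI)
    fix x \<phi> assume x: "x \<in> S" and C: "Ck_on 2 \<phi> S" and m: "local_max_at (\<lambda>y. u y - \<phi> y) S x"
    obtain X where X: "jet \<phi> x (gradient \<phi> x) X" "op_trace X = laplacian \<phi> x"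
      using Ck_on_2_jet[OF S x C] .
    have "superjet u x (gradient \<phi> x) X"
      using X m local_max_at_iff[OF S x] by (intro jet_imp_superjet) auto
    then show "H x (gradient \<phi> x) - \<epsilon> * laplacian \<phi> x \<le> c" using j x X by metis
  qed
qed

text \<open>On each line through \<open>x\<close> the quadratic polynomial is nonnegative up to a
  small error, which gives the first order condition in both directions and then the second order
  one. The zero function enters in this way, both in the maximum principle and as a
  subsolution.\<close>

lemma superjet_const:
  fixes X :: "'a::euclidean_space \<Rightarrow> 'a"
  assumes j: "superjet (\<lambda>_. k) x q X"
  shows "q = 0" "op_trace X \<ge> 0"
proof -
  have lin: "linear X" using j by (simp add: superjet_def)
  have key: "\<forall>\<^sub>F t in nhds (0::real). 0 \<le> t * (q \<bullet> h) + t\<^sup>2 * (h \<bullet> X h / 2 + \<delta> * (norm h)\<^sup>2)" if "\<delta> > 0" for h \<delta>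
  proof -
    have "((\<lambda>t::real. x + t *\<^sub>R h) \<longlongrightarrow> x + 0 *\<^sub>R h) (nhds 0)"
      by (intro tendsto_add tendsto_const tendsto_scaleR filterlim_ident)
    then have "filterlim (\<lambda>t::real. x + t *\<^sub>R h) (nhds x) (nhds 0)" by simp
    moreover have "\<forall>\<^sub>F y in nhds x. k \<le> k + q \<bullet> (y - x) + (y - x) \<bullet> X (y - x) / 2 + \<delta> * (norm (y - x))\<^sup>2"
      using j that by (auto simp: superjet_def)
    ultimately have "\<forall>\<^sub>F t in nhds 0. k \<le> k + q \<bullet> (t *\<^sub>R h) + (t *\<^sub>R h) \<bullet> X (t *\<^sub>R h) / 2 + \<delta> * (norm (t *\<^sub>R h))\<^sup>2"
      by (auto simp: filterlim_iff dest!: spec[of _ "\<lambda>y. k \<le> k + q \<bullet> (y - x) + (y - x) \<bullet> X (y - x) / 2 + \<delta> * (norm (y - x))\<^sup>2"])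
    then show ?thesis
      by eventually_elim (simp add: linear_scale[OF lin] power_mult_distrib,
          simp add: power2_eq_square algebra_simps)
  qed
  have pos: "h \<bullet> X h \<ge> 0 \<and> q \<bullet> h = 0" for h
  proof -
    have q: "0 \<le> q \<bullet> h" for h
    proof -
      obtain d where d: "d > 0" "\<And>t. \<bar>t\<bar> < d \<Longrightarrow> 0 \<le> t * (q \<bullet> h) + t\<^sup>2 * (h \<bullet> X h / 2 + 1 * (norm h)\<^sup>2)"
        using key[of 1 h] by (auto simp: eventually_nhds_metric)
      let ?m = "h \<bullet> X h / 2 + 1 * (norm h)\<^sup>2"
      have "\<forall>\<^sub>F t in at_right (0::real). 0 \<le> q \<bullet> h + t * ?m"
        unfolding eventually_at_right_field
      proof (intro exI[of _ d] conjI allI impI)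
        fix t :: real assume t: "0 < t" "t < d"
        then have "0 \<le> t * (q \<bullet> h + t * ?m)" using d(2)[of t] by (simp add: power2_eq_square algebra_simps)
        then show "0 \<le> q \<bullet> h + t * ?m" using t by (simp add: zero_le_mult_iff)
      qed (use d in auto)
      moreover have "((\<lambda>t. q \<bullet> h + t * ?m) \<longlongrightarrow> q \<bullet> h + 0 * ?m) (at_right 0)"
        by (intro tendsto_intros)
      ultimately show ?thesis
        using tendsto_lowerbound[of "\<lambda>t. q \<bullet> h + t * ?m" "q \<bullet> h + 0 * ?m" "at_right 0" 0] by auto
    qed
    from q[of h] q[of "-h"] have q0: "q \<bullet> h = 0" by simp
    have "0 \<le> h \<bullet> X h / 2 + \<delta> * (norm h)\<^sup>2" if \<delta>: "\<delta> > 0" for \<delta>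
    proof -
      obtain d where d: "d > 0" "\<And>t. \<bar>t\<bar> < d \<Longrightarrow> 0 \<le> t\<^sup>2 * (h \<bullet> X h / 2 + \<delta> * (norm h)\<^sup>2)"
        using key[OF \<delta>, of h] q0 by (auto simp: eventually_nhds_metric)
      then show ?thesis using d(2)[of "d/2"] by (simp add: zero_le_mult_iff)
    qed
    then have "((\<lambda>\<delta>. h \<bullet> X h / 2 + \<delta> * (norm h)\<^sup>2) \<longlongrightarrow> h \<bullet> X h / 2 + 0 * (norm h)\<^sup>2) (at_right 0)
      \<Longrightarrow> 0 \<le> h \<bullet> X h / 2 + 0 * (norm h)\<^sup>2"
      by (intro tendsto_lowerbound[of "\<lambda>\<delta>. h \<bullet> X h / 2 + \<delta> * (norm h)\<^sup>2" _ "at_right 0" 0])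
        (auto simp: eventually_at_right_field intro: exI[of _ 1])
    moreover have "((\<lambda>\<delta>. h \<bullet> X h / 2 + \<delta> * (norm h)\<^sup>2) \<longlongrightarrow> h \<bullet> X h / 2 + 0 * (norm h)\<^sup>2) (at_right 0)"
      by (intro tendsto_intros)
    ultimately show ?thesis using q0 by simp
  qed
  show "q = 0" using pos[of q] by simp
  show "op_trace X \<ge> 0" unfolding op_trace_def by (intro sum_nonneg) (use pos in auto)
qed

section \<open>Polynomials of bounded degree\<close>

interpretation fun_vs: vector_space "\<lambda>(r::real) (f::'a \<Rightarrow> real) x. r * f x"
  by standard (auto simp: fun_eq_iff algebra_simps)

text \<open>The image of a basis of the span is independent and has as many elements as the basis,
  so a vector outside its span would give too large an independent set. The ambient space may have
  infinite dimension; only the subspace is counted.\<close>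

lemma (in vector_space) linear_finite_span_inj_imp_surj:
  assumes B: "finite B" and T: "Vector_Spaces.linear scale scale T"
    and sub: "T ` span B \<subseteq> span B" and inj: "\<And>v. v \<in> span B \<Longrightarrow> T v = 0 \<Longrightarrow> v = 0"
  shows "T ` span B = span B"
proof
  interpret T: Vector_Spaces.linear scale scale T by (rule T)
  obtain C where C: "C \<subseteq> B" "independent C" "B \<subseteq> span C"
    using maximal_independent_subset[of B] by blast
  have finC: "finite C" using B C finite_subset by blast
  have sp: "span C = span B" using C by (metis span_minimal span_mono subset_antisym subspace_span)
  have inj': "inj_on T (span C)"
    unfolding sp by (subst T.inj_on_iff_eq_0[OF subspace_span]) (use inj in auto)
  have ind: "independent (T ` C)"
    by (rule T.independent_inj_on_image[OF C(2) inj'])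
  have card: "card (T ` C) = card C"
    by (rule card_image) (use inj' span_superset inj_on_subset in blast)
  have subC: "T ` C \<subseteq> span C" using sub sp span_superset by blast
  show "span B \<subseteq> T ` span B"
  proof
    fix v assume v: "v \<in> span B"
    have "v \<in> span (T ` C)"
    proof (rule ccontr)
      assume n: "v \<notin> span (T ` C)"
      then have "independent (insert v (T ` C))" using ind independent_insertI by blast
      moreover have "insert v (T ` C) \<subseteq> span C" using v sp subC by auto
      ultimately have "card (insert v (T ` C)) \<le> card C" using independent_span_bound[OF finC] by blast
      moreover have "v \<notin> T ` C" using n span_base by blast
      ultimately show False using finC card by simp
    qed
    then show "v \<in> T ` span B" using T.span_image sp by blast
  qed
qed (rule sub)

text \<open>\<open>T\<close> is linear only on the span: the Laplacian respects sums of smooth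
  functions but not of arbitrary ones. A linear map that agrees with \<open>T\<close> on a basis
  replaces it.\<close>

lemma (in vector_space) finite_span_inj_imp_surj:
  assumes B: "finite B"
    and add: "\<And>u v. u \<in> span B \<Longrightarrow> v \<in> span B \<Longrightarrow> T (u + v) = T u + T v"
    and hom: "\<And>r v. v \<in> span B \<Longrightarrow> T (scale r v) = scale r (T v)"
    and sub: "T ` span B \<subseteq> span B" and inj: "\<And>v. v \<in> span B \<Longrightarrow> T v = 0 \<Longrightarrow> v = 0"
  shows "T ` span B = span B"
proof -
  interpret P: vector_space_pair scale scale ..
  obtain C where C: "C \<subseteq> B" "independent C" "B \<subseteq> span C"
    using maximal_independent_subset[of B] by blast
  have sp: "span C = span B" using C by (metis span_minimal span_mono subset_antisym subspace_span)
  obtain g where g: "Vector_Spaces.linear scale scale g" "\<And>x. x \<in> C \<Longrightarrow> g x = T x"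
    using P.linear_independent_extend[OF C(2), of T] by blast
  interpret g: Vector_Spaces.linear scale scale g by (rule g)
  have eq: "g v = T v" if "v \<in> span B" for v
  proof -
    have "v \<in> span C" using that sp by simp
    then have "v \<in> span C \<and> g v = T v"
    proof (induction rule: span_induct_alt)
      case base
      show ?case using hom[of 0 0] span_zero g.zero by auto
    next
      case (step c x y)
      then have x: "x \<in> span B" "y \<in> span B" using span_base sp by auto
      then have "T (scale c x + y) = scale c (T x) + T y"
        using add[OF span_scale[OF x(1)] x(2)] hom[OF x(1)] by simp
      then show ?case using step x g(2) by (auto simp: g.add g.scale sp intro: span_add span_scale)
    qed
    then show ?thesis by simp
  qed
  have "g ` span B = span B"
    using sub inj by (intro linear_finite_span_inj_imp_surj[OF B g(1)]) (auto simp: eq)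
  then show ?thesis using eq by (simp cong: image_cong)
qed

text \<open>The index exceeds the degree by one, and index \<open>0\<close> belongs to the zero
  space. With this convention truncated subtraction is right for derivatives: they lie in
  \<open>poly_space (k - 1)\<close> and \<open>poly_space (k - 2)\<close> for every
  \<open>k\<close>.\<close>

fun poly_basis :: "nat \<Rightarrow> ('a::euclidean_space \<Rightarrow> real) set" where
  "poly_basis 0 = {}"
| "poly_basis (Suc k) =
     insert (\<lambda>x. 1) (poly_basis k \<union> (\<lambda>(b, m) x. (x \<bullet> b) * m x) ` (Basis \<times> poly_basis k))"

text \<open>The polynomials of degree less than \<open>k\<close>.\<close>

definition poly_space :: "nat \<Rightarrow> ('a::euclidean_space \<Rightarrow> real) set" where
  "poly_space k = fun_vs.span (poly_basis k)"

lemma mem_poly_basis_Suc: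
  "f \<in> poly_basis (Suc k) \<longleftrightarrow> f = (\<lambda>x. 1) \<or> f \<in> poly_basis k \<or>
    (\<exists>b\<in>Basis. \<exists>m\<in>poly_basis k. f = (\<lambda>x. (x \<bullet> b) * m x))"
  by auto

lemma finite_poly_basis: "finite (poly_basis k)"
  by (induction k) auto

lemma poly_space_add: "f \<in> poly_space k \<Longrightarrow> g \<in> poly_space k \<Longrightarrow> (\<lambda>x. f x + g x) \<in> poly_space k"
  unfolding poly_space_def using fun_vs.span_add by (fastforce simp: plus_fun_def)

lemma poly_space_cmult: "f \<in> poly_space k \<Longrightarrow> (\<lambda>x. r * f x) \<in> poly_space k"
  unfolding poly_space_def using fun_vs.span_scale by blast

lemma poly_space_0: "(\<lambda>x. 0) \<in> poly_space k"
  using fun_vs.span_zero[of "poly_basis k"] by (simp add: poly_space_def zero_fun_def)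

lemma poly_space_diff: "f \<in> poly_space k \<Longrightarrow> g \<in> poly_space k \<Longrightarrow> (\<lambda>x. f x - g x) \<in> poly_space k"
  using poly_space_add[of f k "\<lambda>x. (-1) * g x"] poly_space_cmult[of g k "-1"] by simp

lemma poly_space_sum: "(\<And>i. i \<in> I \<Longrightarrow> f i \<in> poly_space k) \<Longrightarrow> (\<lambda>x. \<Sum>i\<in>I. f i x) \<in> poly_space k"
  by (induction I rule: infinite_finite_induct) (auto intro: poly_space_0 poly_space_add)

lemma poly_space_induct [consumes 1, case_names zero add basis]:
  assumes f: "f \<in> poly_space k"
    and 0: "P (\<lambda>x. 0)"
    and add: "\<And>r f g. P f \<Longrightarrow> P g \<Longrightarrow> P (\<lambda>x. r * f x + g x)"
    and b: "\<And>f. f \<in> poly_basis k \<Longrightarrow> P f"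
  shows "P f"
  using f unfolding poly_space_def
proof (induction rule: fun_vs.span_induct_alt)
  case base then show ?case using 0 by (simp add: zero_fun_def)
next
  case (step c x y) then show ?case using add b by (simp add: plus_fun_def)
qed

lemma poly_space_mono: "j \<le> k \<Longrightarrow> poly_space j \<subseteq> poly_space k"
proof -
  have "poly_basis j \<subseteq> poly_basis (Suc j)" for j :: nat by auto
  then show "poly_space j \<subseteq> poly_space k" if "j \<le> k"
    unfolding poly_space_def by (intro fun_vs.span_mono) (rule lift_Suc_mono_le[OF _ that])
qed

lemma poly_space_const: "(\<lambda>x. r) \<in> poly_space (Suc k)"
proof -
  have "(\<lambda>x. 1) \<in> poly_space (Suc k)" unfolding poly_space_def by (intro fun_vs.span_base) simp
  from poly_space_cmult[OF this, of r] show ?thesis by simp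
qed

lemma poly_space_coord_mult:
  assumes "f \<in> poly_space k" "b \<in> Basis"
  shows "(\<lambda>x. (x \<bullet> b) * f x) \<in> poly_space (Suc k)"
  using assms(1)
proof (induction rule: poly_space_induct)
  case zero then show ?case using poly_space_0 by simp
next
  case (add r f g)
  from poly_space_add[OF poly_space_cmult[OF add(1), of r] add(2)]
  show ?case by (simp add: algebra_simps)
next
  case (basis f)
  then show ?case unfolding poly_space_def using assms(2)
    by (intro fun_vs.span_base) (auto intro!: image_eqI[of _ _ "(b, f)"])
qed

lemma poly_space_affine_mult:
  assumes "f \<in> poly_space k"
  shows "(\<lambda>x. ((x - a) \<bullet> c) * f x) \<in> poly_space (Suc k)"
proof -
  have "(\<lambda>x. (\<Sum>b\<in>Basis. (c \<bullet> b) * ((x \<bullet> b) * f x)) - (a \<bullet> c) * f x) \<in> poly_space (Suc k)"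
    by (intro poly_space_diff poly_space_sum poly_space_cmult poly_space_coord_mult assms)
      (use assms poly_space_mono[of k "Suc k"] in auto)
  moreover have "(\<Sum>b\<in>Basis. (c \<bullet> b) * ((x \<bullet> b) * f x)) = (x \<bullet> c) * f x" for x
    by (subst (2) euclidean_inner) (simp add: sum_distrib_left sum_distrib_right mult_ac)
  ultimately show ?thesis by (simp add: inner_diff_left left_diff_distrib)
qed

lemma poly_space_mult:
  assumes "f \<in> poly_space j" "g \<in> poly_space k"
  shows "(\<lambda>x. f x * g x) \<in> poly_space (j + k)"
proof -
  have basis: "(\<lambda>x. f x * g x) \<in> poly_space (j + k)" if "f \<in> poly_basis j" for f
    using that
  proof (induction j arbitrary: f)
    case (Suc j)
    consider "f = (\<lambda>x. 1)" | "f \<in> poly_basis j" | b m where "b \<in> Basis" "m \<in> poly_basis j" "f = (\<lambda>x. (x \<bullet> b) * m x)"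
      using Suc.prems by auto
    then show ?case
    proof cases
      case 1 then show ?thesis using assms(2) poly_space_mono[of k "Suc j + k"] by auto
    next
      case 2 then show ?thesis using Suc.IH poly_space_mono[of "j + k" "Suc j + k"] by auto
    next
      case 3
      from poly_space_coord_mult[OF Suc.IH[OF 3(2)] 3(1)] show ?thesis by (simp add: 3(3) mult.assoc)
    qed
  qed simp
  show ?thesis using assms(1)
  proof (induction rule: poly_space_induct)
    case zero then show ?case using poly_space_0 by simp
  next
    case (add r f g')
    from poly_space_add[OF poly_space_cmult[OF add(1), of r] add(2)]
    show ?case by (simp add: algebra_simps)
  qed (rule basis)
qed

text \<open>Stone-Weierstrass produces a \<open>real_polynomial_function\<close>, which carries no
  degree; the Dirichlet problem is solved in spaces of bounded degree.\<close>

lemma real_polynomial_function_imp_poly_space: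
  assumes "real_polynomial_function f"
  shows "\<exists>k. f \<in> poly_space k"
  using assms
proof (induction rule: real_polynomial_function.induct)
  case (linear f)
  have "(\<lambda>x. \<Sum>b\<in>Basis. f b * ((x \<bullet> b) * 1)) \<in> poly_space (Suc (Suc 0))"
    by (intro poly_space_sum poly_space_cmult poly_space_coord_mult poly_space_const)
  moreover have "f = (\<lambda>x. \<Sum>b\<in>Basis. f b * ((x \<bullet> b) * 1))"
  proof
    fix x
    interpret bounded_linear f by (rule linear)
    have "f x = f (\<Sum>b\<in>Basis. (x \<bullet> b) *\<^sub>R b)" by (simp add: euclidean_representation)
    then show "f x = (\<Sum>b\<in>Basis. f b * ((x \<bullet> b) * 1))" by (simp add: sum scale mult.commute)
  qed
  ultimately show ?case by metis
next
  case (const c) then show ?case using poly_space_const by blast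
next
  case (add f g)
  then obtain j k where "f \<in> poly_space j" "g \<in> poly_space k" by blast
  then have "f \<in> poly_space (max j k)" "g \<in> poly_space (max j k)"
    using poly_space_mono[of j "max j k"] poly_space_mono[of k "max j k"] by auto
  then show ?case using poly_space_add by blast
next
  case (mult f g) then show ?case using poly_space_mult by blast
qed

lemma poly_space_imp_real_polynomial_function:
  assumes "f \<in> poly_space k"
  shows "real_polynomial_function f"
proof -
  have basis: "real_polynomial_function f" if "f \<in> poly_basis k" for f :: "'a \<Rightarrow> real"
    using that
    by (induction k arbitrary: f)
      (auto intro!: real_polynomial_function.intros(4) real_polynomial_function.intros(1)[OF bounded_linear_inner_left]
        intro: real_polynomial_function.intros)
  show ?thesis using assms
  proof (induction rule: poly_space_induct)
    case (add r f g)
    from real_polynomial_function.intros(3)[OF real_polynomial_function.intros(4)[OF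
        real_polynomial_function.intros(2)[of r] add(1)] add(2)]
    show ?case .
  qed (auto intro: basis real_polynomial_function.intros(2))
qed

lemma poly_space_derivative:
  assumes "f \<in> poly_space (Suc k)"
  shows "\<exists>D. (\<forall>y. (f has_derivative (\<lambda>h. D y \<bullet> h)) (at y)) \<and> (\<forall>c. (\<lambda>y. D y \<bullet> c) \<in> poly_space k)"
proof -
  have basis: "\<exists>D. (\<forall>y. (f has_derivative (\<lambda>h. D y \<bullet> h)) (at y)) \<and> (\<forall>c. (\<lambda>y. D y \<bullet> c) \<in> poly_space k)"
    if "f \<in> poly_basis (Suc k)" for f :: "'a \<Rightarrow> real"
    using that
  proof (induction k arbitrary: f)
    case 0
    then have "f = (\<lambda>x. 1)" by simp
    then show ?case by (intro exI[of _ "\<lambda>_. 0"]) (auto intro: poly_space_0)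
  next
    case (Suc k)
    consider "f = (\<lambda>x. 1)" | "f \<in> poly_basis (Suc k)"
      | b m where "b \<in> Basis" "m \<in> poly_basis (Suc k)" "f = (\<lambda>x. (x \<bullet> b) * m x)"
      using Suc.prems unfolding mem_poly_basis_Suc[of _ "Suc k"] by blast
    then show ?case
    proof cases
      case 1 then show ?thesis by (intro exI[of _ "\<lambda>_. 0"]) (auto intro: poly_space_0)
    next
      case 2
      from Suc.IH[OF 2] obtain D where D: "(\<forall>y. (f has_derivative (\<lambda>h. D y \<bullet> h)) (at y)) \<and>
        (\<forall>c. (\<lambda>y. D y \<bullet> c) \<in> poly_space k)" by (rule exE)
      have "(\<lambda>y. D y \<bullet> c) \<in> poly_space (Suc k)" for c
        using D poly_space_mono[of k "Suc k"] by auto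
      then show ?thesis using D by (intro exI[of _ D]) simp
    next
      case 3
      from Suc.IH[OF 3(2)] obtain D where D': "(\<forall>y. (m has_derivative (\<lambda>h. D y \<bullet> h)) (at y)) \<and>
        (\<forall>c. (\<lambda>y. D y \<bullet> c) \<in> poly_space k)" by (rule exE)
      then have D: "\<And>y. (m has_derivative (\<lambda>h. D y \<bullet> h)) (at y)"
        "\<And>c. (\<lambda>y. D y \<bullet> c) \<in> poly_space k" by simp_all
      have "m \<in> poly_space (Suc k)" using 3(2) unfolding poly_space_def by (rule fun_vs.span_base)
      then have "(\<lambda>y. (b \<bullet> c) * m y + (y \<bullet> b) * (D y \<bullet> c)) \<in> poly_space (Suc k)" for c
        by (intro poly_space_add poly_space_cmult poly_space_coord_mult 3(1) D(2))
      then have "(\<lambda>y. (m y *\<^sub>R b + (y \<bullet> b) *\<^sub>R D y) \<bullet> c) \<in> poly_space (Suc k)" for c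
        by (simp add: inner_add_left mult.commute)
      moreover have "(f has_derivative (\<lambda>h. (m y *\<^sub>R b + (y \<bullet> b) *\<^sub>R D y) \<bullet> h)) (at y)" for y
        unfolding 3(3) by (auto intro!: derivative_eq_intros D(1) simp: inner_add_left inner_commute[of b] mult.commute)
      ultimately show ?thesis by (intro exI[of _ "\<lambda>y. m y *\<^sub>R b + (y \<bullet> b) *\<^sub>R D y"]) blast
    qed
  qed
  show ?thesis using assms
  proof (induction rule: poly_space_induct)
    case zero then show ?case by (intro exI[of _ "\<lambda>_. 0"]) (auto intro: poly_space_0)
  next
    case (add r f g)
    then obtain D E where D: "\<And>y. (f has_derivative (\<lambda>h. D y \<bullet> h)) (at y)" "\<And>c. (\<lambda>y. D y \<bullet> c) \<in> poly_space k"
      and E: "\<And>y. (g has_derivative (\<lambda>h. E y \<bullet> h)) (at y)" "\<And>c. (\<lambda>y. E y \<bullet> c) \<in> poly_space k" by blast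
    have "((\<lambda>x. r * f x + g x) has_derivative (\<lambda>h. (r *\<^sub>R D y + E y) \<bullet> h)) (at y)" for y
      by (auto intro!: derivative_eq_intros D(1) E(1) simp: inner_add_left)
    moreover have "(\<lambda>y. (r *\<^sub>R D y + E y) \<bullet> c) \<in> poly_space k" for c
      using poly_space_add[OF poly_space_cmult[OF D(2)] E(2), of r c c] by (simp add: inner_add_left)
    ultimately show ?case by (intro exI[of _ "\<lambda>y. r *\<^sub>R D y + E y"]) blast
  qed (rule basis)
qed

lemma poly_space_Ck: "f \<in> poly_space k \<Longrightarrow> Ck_on n f UNIV"
proof (induction n arbitrary: f k)
  case 0
  obtain D where "\<And>y. (f has_derivative (\<lambda>h. D y \<bullet> h)) (at y)"
    using poly_space_derivative[of f k] 0 poly_space_mono[of k "Suc k"] by auto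
  then show ?case
    using has_derivative_continuous continuous_at_imp_continuous_on by (simp, blast)
next
  case (Suc n)
  obtain D where D: "\<And>y. (f has_derivative (\<lambda>h. D y \<bullet> h)) (at y)" "\<And>c. (\<lambda>y. D y \<bullet> c) \<in> poly_space k"
    using poly_space_derivative[of f k] Suc.prems poly_space_mono[of k "Suc k"] by auto
  have "f differentiable_on UNIV" using D(1) by (meson differentiable_at_imp_differentiable_on differentiable_def)
  moreover have "(\<lambda>x. frechet_derivative f (at x) b) = (\<lambda>y. D y \<bullet> b)" for b
    using D(1) by (metis frechet_derivative_at)
  ultimately show ?case using Suc.IH[OF D(2)] by simp
qed

lemma poly_space_derivative2:
  assumes "f \<in> poly_space k"
  obtains D X where "\<And>y. (f has_derivative (\<lambda>h. D y \<bullet> h)) (at y)" "\<And>c. (\<lambda>y. D y \<bullet> c) \<in> poly_space (k - 1)"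
    "\<And>y. (D has_derivative X y) (at y)" "\<And>b c. (\<lambda>y. b \<bullet> X y c) \<in> poly_space (k - 2)"
proof -
  have dc: "\<exists>E. (\<forall>y. (f has_derivative (\<lambda>h. E y \<bullet> h)) (at y)) \<and> (\<forall>c. (\<lambda>y. E y \<bullet> c) \<in> poly_space (j - 1))"
    if "f \<in> poly_space j" for f :: "'a \<Rightarrow> real" and j
  proof (cases j)
    case 0
    then have "f = (\<lambda>x. 0)" using that by (auto simp: poly_space_def zero_fun_def)
    then show ?thesis by (intro exI[of _ "\<lambda>_. 0"]) (auto intro: poly_space_0)
  next
    case (Suc i) then show ?thesis using poly_space_derivative that by auto
  qed
  obtain D where D: "\<And>y. (f has_derivative (\<lambda>h. D y \<bullet> h)) (at y)" "\<And>c. (\<lambda>y. D y \<bullet> c) \<in> poly_space (k - 1)"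
    using dc[OF assms] by blast
  have "\<forall>b. \<exists>E. (\<forall>y. ((\<lambda>y. D y \<bullet> b) has_derivative (\<lambda>h. E y \<bullet> h)) (at y)) \<and> (\<forall>c. (\<lambda>y. E y \<bullet> c) \<in> poly_space (k - 1 - 1))"
    using dc[OF D(2)] by blast
  from choice[OF this] obtain E where E': "\<forall>b. (\<forall>y. ((\<lambda>y. D y \<bullet> b) has_derivative (\<lambda>h. E b y \<bullet> h)) (at y)) \<and>
    (\<forall>c. (\<lambda>y. E b y \<bullet> c) \<in> poly_space (k - 1 - 1))" by (rule exE)
  then have E: "\<And>b y. ((\<lambda>y. D y \<bullet> b) has_derivative (\<lambda>h. E b y \<bullet> h)) (at y)"
    "\<And>b c. (\<lambda>y. E b y \<bullet> c) \<in> poly_space (k - 2)"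
    by (simp_all add: numeral_2_eq_2)
  define X where "X y h = (\<Sum>b\<in>Basis. (E b y \<bullet> h) *\<^sub>R b)" for y h
  have "(D has_derivative X y) (at y)" for y
  proof -
    have "((\<lambda>y. \<Sum>b\<in>Basis. (D y \<bullet> b) *\<^sub>R b) has_derivative X y) (at y)"
      unfolding X_def[abs_def] by (intro has_derivative_sum has_derivative_scaleR_left E)
    then show ?thesis by (simp add: euclidean_representation)
  qed
  moreover have "(\<lambda>y. c \<bullet> X y h) \<in> poly_space (k - 2)" for c h
  proof -
    have "(\<lambda>y. \<Sum>b\<in>Basis. (c \<bullet> b) * (E b y \<bullet> h)) \<in> poly_space (k - 2)"
      by (intro poly_space_sum poly_space_cmult E)
    then show ?thesis by (simp add: X_def inner_sum_right mult.commute)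
  qed
  ultimately show ?thesis using that D by blast
qed

lemma poly_space_jet:
  fixes f :: "'a::euclidean_space \<Rightarrow> real"
  assumes "f \<in> poly_space k"
  obtains q X where "jet f x q X" "op_trace X = laplacian f x"
proof -
  obtain D X where *: "\<And>y. (f has_derivative (\<lambda>h. D y \<bullet> h)) (at y)" "\<And>y. (D has_derivative X y) (at y)"
    using poly_space_derivative2[OF assms] by metis
  show ?thesis
  proof (rule that)
    show "jet f x (D x) (X x)" by (rule jetI) (auto simp: *)
    show "op_trace (X x) = laplacian f x"
      by (rule gradient_laplacian_eqI(2)[symmetric, OF open_UNIV *]) auto
  qed
qed

text \<open>On the line through \<open>a\<close> and \<open>x\<close> the polynomial has infinitely
  many zeros near \<open>a\<close>, so the coefficients of its restriction vanish and it is zero at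
  \<open>x\<close> too.\<close>

lemma poly_space_eq_0:
  assumes f: "f \<in> poly_space k" and "r > 0" and z: "\<And>x. x \<in> ball a r \<Longrightarrow> f x = 0"
  shows "f = (\<lambda>x. 0)"
proof
  fix x
  have "real_polynomial_function (f \<circ> (\<lambda>t::real. a + t *\<^sub>R (x - a)))"
    by (intro real_polynomial_function_compose poly_space_imp_real_polynomial_function[OF f]
        polynomial_function_add polynomial_function_const polynomial_function_bounded_linear
        bounded_linear_scaleR_left)
  then obtain c n where c: "\<And>t. f (a + t *\<^sub>R (x - a)) = (\<Sum>i\<le>n. c i * t ^ i)"
    unfolding real_polynomial_function_iff_sum by (auto simp: fun_eq_iff)
  have inf: "infinite {t. (\<Sum>i\<le>n. c i * t ^ i) = 0}"
  proof -
    define d where "d = r / (norm (x - a) + 1)"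
    have d: "d > 0" using \<open>r > 0\<close> by (simp add: d_def add_nonneg_pos)
    have "(\<Sum>i\<le>n. c i * t ^ i) = 0" if "t \<in> {0<..<d}" for t
    proof -
      have "t * norm (x - a) \<le> t * (norm (x - a) + 1)" using that by simp
      also have "\<dots> < r" using that by (simp add: d_def pos_less_divide_eq add_nonneg_pos)
      finally show ?thesis unfolding c[symmetric] using that by (intro z) (simp add: dist_norm)
    qed
    then have "{0<..<d} \<subseteq> {t. (\<Sum>i\<le>n. c i * t ^ i) = 0}" by blast
    then show ?thesis using d infinite_Ioo finite_subset by blast
  qed
  have "c i = 0" if "i \<le> n" for i
    using inf that polyfun_finite_roots[of c n] by blast
  then show "f x = 0" using c[of 1] by simp
qed

section \<open>The Poisson equation\<close>

lemma poly_space_0_iff: "f \<in> poly_space 0 \<longleftrightarrow> f = (\<lambda>x. 0)"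
  by (auto simp: poly_space_def zero_fun_def)

lemma poly_space_affine_mult':
  assumes "f \<in> poly_space (k - 1)"
  shows "(\<lambda>x. ((x - a) \<bullet> c) * f x) \<in> poly_space k"
  using assms poly_space_affine_mult[of f "k - 1" a c]
  by (cases k) (auto simp: poly_space_0_iff)

lemma laplacian_poly_add:
  assumes "f \<in> poly_space j" "g \<in> poly_space k"
  shows "laplacian (\<lambda>x. r * f x + s * g x) y = r * laplacian f y + s * laplacian g y"
proof -
  obtain D X where f: "\<And>y. (f has_derivative (\<lambda>h. D y \<bullet> h)) (at y)" "\<And>y. (D has_derivative X y) (at y)"
    using poly_space_derivative2[OF assms(1)] by metis
  obtain E Y where g: "\<And>y. (g has_derivative (\<lambda>h. E y \<bullet> h)) (at y)" "\<And>y. (E has_derivative Y y) (at y)"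
    using poly_space_derivative2[OF assms(2)] by metis
  have "((\<lambda>x. r * f x + s * g x) has_derivative (\<lambda>h. (r *\<^sub>R D y + s *\<^sub>R E y) \<bullet> h)) (at y)" for y
    by (auto intro!: derivative_eq_intros f g simp: inner_add_left)
  moreover have "((\<lambda>y. r *\<^sub>R D y + s *\<^sub>R E y) has_derivative (\<lambda>h. r *\<^sub>R X y h + s *\<^sub>R Y y h)) (at y)" for y
    by (auto intro!: derivative_eq_intros f g)
  ultimately have "laplacian (\<lambda>x. r * f x + s * g x) y = op_trace (\<lambda>h. r *\<^sub>R X y h + s *\<^sub>R Y y h)"
    by (intro gradient_laplacian_eqI(2)[OF open_UNIV]) auto
  also have "\<dots> = r * op_trace (X y) + s * op_trace (Y y)" by (simp only: op_trace_simps)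
  also have "op_trace (X y) = laplacian f y" by (rule gradient_laplacian_eqI(2)[symmetric, OF open_UNIV f]) auto
  also have "op_trace (Y y) = laplacian g y" by (rule gradient_laplacian_eqI(2)[symmetric, OF open_UNIV g]) auto
  finally show ?thesis .
qed

lemma poly_space_ball_weight:
  assumes "q \<in> poly_space k"
  shows "(\<lambda>x. (r\<^sup>2 - (norm (x - a))\<^sup>2) * q x) \<in> poly_space (Suc (Suc k))"
proof -
  have "(\<lambda>x. r\<^sup>2 * q x - (\<Sum>b\<in>Basis. ((x - a) \<bullet> b) * (((x - a) \<bullet> b) * q x))) \<in> poly_space (Suc (Suc k))"
    using assms poly_space_mono[of k "Suc (Suc k)"]
    by (intro poly_space_diff poly_space_cmult poly_space_sum poly_space_affine_mult) auto
  moreover have "(\<Sum>b\<in>Basis. ((x - a) \<bullet> b) * (((x - a) \<bullet> b) * q x)) = (norm (x - a))\<^sup>2 * q x" for x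
    unfolding power2_norm_eq_inner euclidean_inner[of "x - a" "x - a"]
    by (simp add: sum_distrib_right mult.assoc)
  ultimately show ?thesis by (simp add: left_diff_distrib)
qed

text \<open>With \<open>\<rho> = r^2 - |x - a|^2\<close>, the Laplacian of \<open>\<rho> q\<close>
  is \<rho> times that of \<open>q\<close>, minus \<open>4 Dq \<bullet> (x - a)\<close>, minus
  \<open>2 n q\<close> with \<open>n\<close> the dimension. Each factor \<open>x - a\<close> is paid
  for by a derivative, so the degree does not rise. The second claim is the case
  \<open>q = 1\<close>.\<close>

lemma laplacian_ball_weight:
  fixes q :: "'a::euclidean_space \<Rightarrow> real"
  assumes q: "q \<in> poly_space k"
  shows "(\<lambda>y. laplacian (\<lambda>x. (r\<^sup>2 - (norm (x - a))\<^sup>2) * q x) y) \<in> poly_space k"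
    and "laplacian (\<lambda>x. r\<^sup>2 - (norm (x - a))\<^sup>2) y = - 2 * DIM('a)"
proof -
  have *: "(\<forall>y. laplacian (\<lambda>x. (r\<^sup>2 - (norm (x - a))\<^sup>2) * q x) y =
       (r\<^sup>2 - (norm (y - a))\<^sup>2) * op_trace (X y) - 4 * (D y \<bullet> (y - a)) - 2 * DIM('a) * q y)"
    if d: "\<And>y. (q has_derivative (\<lambda>h. D y \<bullet> h)) (at y)" "\<And>y. (D has_derivative X y) (at y)"
    for q :: "'a \<Rightarrow> real" and D X
  proof
    fix y
    let ?\<rho> = "\<lambda>x. r\<^sup>2 - (norm (x - a))\<^sup>2"
    let ?E = "\<lambda>y. ?\<rho> y *\<^sub>R D y - (2 * q y) *\<^sub>R (y - a)"
    let ?Y = "\<lambda>y h. ?\<rho> y *\<^sub>R X y h - 2 *\<^sub>R (((y - a) \<bullet> h) *\<^sub>R D y) - 2 *\<^sub>R ((D y \<bullet> h) *\<^sub>R (y - a)) - (2 * q y) *\<^sub>R h"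
    have \<rho>: "(?\<rho> has_derivative (\<lambda>h. - 2 * ((y - a) \<bullet> h))) (at y)" for y
      unfolding power2_norm_eq_inner by (auto intro!: derivative_eq_intros simp: inner_commute)
    have "((\<lambda>x. ?\<rho> x * q x) has_derivative (\<lambda>h. ?E y \<bullet> h)) (at y)" for y
      by (rule has_derivative_eq_rhs[OF has_derivative_mult[OF \<rho> d(1)]])
        (simp add: fun_eq_iff inner_diff_left algebra_simps)
    moreover have "(?E has_derivative ?Y y) (at y)" for y
      by (rule has_derivative_eq_rhs[OF has_derivative_diff[OF has_derivative_scaleR[OF \<rho> d(2)]
            has_derivative_scaleR[OF has_derivative_mult[OF has_derivative_const d(1)]
              has_derivative_diff[OF has_derivative_ident has_derivative_const]]]])
        (simp add: fun_eq_iff algebra_simps)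
    ultimately have "laplacian (\<lambda>x. ?\<rho> x * q x) y = op_trace (?Y y)"
      by (intro gradient_laplacian_eqI(2)[OF open_UNIV]) auto
    also have "\<dots> = ?\<rho> y * op_trace (X y) - 4 * (D y \<bullet> (y - a)) - 2 * DIM('a) * q y"
      unfolding op_trace_simps op_trace_rank_one by (simp add: inner_commute)
    finally show "laplacian (\<lambda>x. ?\<rho> x * q x) y =
      ?\<rho> y * op_trace (X y) - 4 * (D y \<bullet> (y - a)) - 2 * DIM('a) * q y" .
  qed
  obtain D X where d: "\<And>y. (q has_derivative (\<lambda>h. D y \<bullet> h)) (at y)" "\<And>c. (\<lambda>y. D y \<bullet> c) \<in> poly_space (k - 1)"
    "\<And>y. (D has_derivative X y) (at y)" "\<And>b c. (\<lambda>y. b \<bullet> X y c) \<in> poly_space (k - 2)"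
    using poly_space_derivative2[OF q] by metis
  have tr: "(\<lambda>y. op_trace (X y)) \<in> poly_space (k - 1 - 1)"
    unfolding op_trace_def using d(4) by (intro poly_space_sum) (simp add: numeral_2_eq_2)
  have "(\<lambda>y. r\<^sup>2 * op_trace (X y) - (\<Sum>b\<in>Basis. ((y - a) \<bullet> b) * (((y - a) \<bullet> b) * op_trace (X y)))
      - 4 * (\<Sum>b\<in>Basis. ((y - a) \<bullet> b) * (D y \<bullet> b)) - 2 * DIM('a) * q y) \<in> poly_space k"
    using tr q poly_space_mono[of "k - 1 - 1" k]
    by (intro poly_space_diff poly_space_cmult poly_space_sum poly_space_affine_mult' d(2) q) auto
  moreover have "(\<Sum>b\<in>Basis. ((x - a) \<bullet> b) * (((x - a) \<bullet> b) * m)) = (norm (x - a))\<^sup>2 * m" for x m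
    unfolding power2_norm_eq_inner euclidean_inner[of "x - a" "x - a"]
    by (simp add: sum_distrib_right mult.assoc)
  moreover have "(\<Sum>b\<in>Basis. ((y - a) \<bullet> b) * (D y \<bullet> b)) = D y \<bullet> (y - a)" for y
    by (subst euclidean_inner) (simp add: mult.commute)
  ultimately show "(\<lambda>y. laplacian (\<lambda>x. (r\<^sup>2 - (norm (x - a))\<^sup>2) * q x) y) \<in> poly_space k"
    using *[OF d(1,3)] by (simp add: left_diff_distrib)
  show "laplacian (\<lambda>x. r\<^sup>2 - (norm (x - a))\<^sup>2) y = - 2 * DIM('a)"
    using *[of "\<lambda>_. 1" "\<lambda>_. 0" "\<lambda>_ _. 0"] by (simp add: op_trace_simps)
qed

text \<open>\<open>h\<close> is smooth and a strict supersolution. At an interior maximum of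
  \<open>v - h\<close> the jet of \<open>h\<close> would be a superjet of \<open>v\<close>, against
  strictness, so the maximum lies on the sphere. Comparing with a smooth function is what spares the
  doubling of variables.\<close>

lemma laplacian_comparison:
  fixes v h :: "'a::euclidean_space \<Rightarrow> real"
  assumes r: "r \<ge> 0" and v: "continuous_on (cball a r) v" and h: "h \<in> poly_space k"
    and sub: "\<And>x q X. x \<in> ball a r \<Longrightarrow> superjet v x q X \<Longrightarrow> - op_trace X \<le> G x"
    and super: "\<And>x. x \<in> ball a r \<Longrightarrow> - laplacian h x > G x"
    and bd: "\<And>x. x \<in> sphere a r \<Longrightarrow> v x \<le> h x + m"
    and x: "x \<in> cball a r"
  shows "v x \<le> h x + m"
proof -
  have "continuous_on (cball a r) h"
    using poly_space_Ck[OF h, of 0] by (auto intro: continuous_on_subset)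
  then have "continuous_on (cball a r) (\<lambda>x. v x - h x)" using v by (intro continuous_intros)
  then obtain z where z: "z \<in> cball a r" "\<And>y. y \<in> cball a r \<Longrightarrow> v y - h y \<le> v z - h z"
    using continuous_attains_sup[of "cball a r" "\<lambda>x. v x - h x"] r by auto
  have "z \<in> sphere a r"
  proof (rule ccontr)
    assume "z \<notin> sphere a r"
    then have zb: "z \<in> ball a r" using z(1) by auto
    obtain q X where j: "jet h z q X" "op_trace X = laplacian h z" using poly_space_jet[OF h] .
    have "\<forall>\<^sub>F y in nhds z. v y - h y \<le> v z - h z"
      using zb z(2) eventually_nhds_in_open[OF open_ball zb] by (auto elim: eventually_mono)
    then have "superjet v z q X" using j(1) jet_imp_superjet by blast
    then show False using sub[OF zb] super[OF zb] j(2) by force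
  qed
  then show ?thesis using bd[of z] z(2)[OF x] by linarith
qed

text \<open>The zero function is compared with \<open>h\<close> and \<open>- h\<close>. A small
  multiple of \<open>r^2 - |x - a|^2\<close>, which vanishes on the sphere and has negative
  Laplacian, makes both strict supersolutions.\<close>

lemma laplacian_dirichlet_unique:
  fixes h :: "'a::euclidean_space \<Rightarrow> real"
  assumes r: "r > 0" and h: "h \<in> poly_space k"
    and lap: "\<And>x. laplacian h x = 0" and bd: "\<And>x. x \<in> sphere a r \<Longrightarrow> h x = 0"
    and x: "x \<in> cball a r"
  shows "h x = 0"
proof -
  let ?\<rho> = "\<lambda>x. r\<^sup>2 - (norm (x - a))\<^sup>2"
  have one: "(\<lambda>x::'a. 1) \<in> poly_space (Suc 0)" by (rule poly_space_const)
  have \<rho>: "?\<rho> \<in> poly_space 3" using poly_space_ball_weight[OF one, of r a] by (simp add: numeral_3_eq_3)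
  have key: "0 \<le> s * h x" for s
  proof (rule field_le_epsilon)
    fix e :: real assume "e > 0"
    \<comment> \<open>The added term is then at most \<open>\<eta> * r\<^sup>2 = e\<close> in the
      ball.\<close>
    define \<eta> where "\<eta> = e / r\<^sup>2"
    have \<eta>: "\<eta> > 0" using \<open>e > 0\<close> r by (simp add: \<eta>_def)
    let ?g = "\<lambda>x. s * h x + \<eta> * ?\<rho> x"
    have g: "?g \<in> poly_space (max k 3)"
      using h \<rho> poly_space_mono[of k "max k 3"] poly_space_mono[of 3 "max k 3"]
      by (intro poly_space_add poly_space_cmult) auto
    have lg: "laplacian ?g y = - 2 * \<eta> * DIM('a)" for y
      using laplacian_poly_add[OF h \<rho>, of s \<eta> y] laplacian_ball_weight(2)[OF one, of r a y] lap by simp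
    have "0 \<le> ?g x + 0"
    proof (rule laplacian_comparison[where v="\<lambda>_. 0" and G="\<lambda>_. 0", OF _ _ g _ _ _ x])
      show "- op_trace X \<le> 0" if "superjet (\<lambda>_. 0) y q X" for y q and X :: "'a \<Rightarrow> 'a"
        using superjet_const(2)[OF that] by simp
      show "0 < - laplacian ?g y" for y unfolding lg using \<eta> by simp
      show "0 \<le> ?g y + 0" if "y \<in> sphere a r" for y
        using bd[OF that] that by (simp add: dist_norm norm_minus_commute)
    qed (use r in auto)
    moreover have "\<eta> * r\<^sup>2 = e" using r by (simp add: \<eta>_def)
    then have "\<eta> * ?\<rho> x = e - \<eta> * (norm (x - a))\<^sup>2" by (simp only: right_diff_distrib)
    then have "\<eta> * ?\<rho> x \<le> e" using \<eta> by simp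
    ultimately show "0 \<le> s * h x + e" by linarith
  qed
  from key[of 1] key[of "-1"] show ?thesis by simp
qed

text \<open>The map that multiplies by \<open>r\<^sup>2 - |x - a|\<^sup>2\<close> and then applies the Laplacian does not raise the
  degree, and it is injective by the maximum principle, hence surjective on polynomials of bounded
  degree.\<close>

lemma poly_dirichlet_surj:
  fixes f :: "'a::euclidean_space \<Rightarrow> real"
  assumes r: "r > 0" and f: "f \<in> poly_space k"
  obtains q where "q \<in> poly_space k" "\<And>x. laplacian (\<lambda>x. (r\<^sup>2 - (norm (x - a))\<^sup>2) * q x) x = f x"
proof -
  define T :: "('a \<Rightarrow> real) \<Rightarrow> 'a \<Rightarrow> real"
    where "T q = laplacian (\<lambda>x. (r\<^sup>2 - (norm (x - a))\<^sup>2) * q x)" for q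
  note w = poly_space_ball_weight[of _ k r a]
  have "T ` fun_vs.span (poly_basis k) = fun_vs.span (poly_basis k)"
    unfolding poly_space_def[symmetric]
  proof (rule fun_vs.finite_span_inj_imp_surj[where T=T, OF finite_poly_basis[of k], folded poly_space_def])
    fix u v :: "'a \<Rightarrow> real" assume u: "u \<in> poly_space k" "v \<in> poly_space k"
    show "T (u + v) = T u + T v"
      using laplacian_poly_add[OF w[OF u(1)] w[OF u(2)], of 1 1]
      by (simp add: T_def fun_eq_iff distrib_left)
  next
    fix c and v :: "'a \<Rightarrow> real" assume v: "v \<in> poly_space k"
    show "T (\<lambda>x. c * v x) = (\<lambda>x. c * T v x)"
      using laplacian_poly_add[OF w[OF v] w[OF v], of c 0]
      by (simp add: T_def fun_eq_iff mult.left_commute)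
  next
    show "T ` poly_space k \<subseteq> poly_space k"
      using laplacian_ball_weight(1)[of _ k r a] by (auto simp: T_def)
  next
    fix v :: "'a \<Rightarrow> real" assume v: "v \<in> poly_space k" "T v = 0"
    have "(r\<^sup>2 - (norm (x - a))\<^sup>2) * v x = 0" if "x \<in> cball a r" for x
    proof (rule laplacian_dirichlet_unique[OF r w[OF v(1)] _ _ that])
      show "laplacian (\<lambda>x. (r\<^sup>2 - (norm (x - a))\<^sup>2) * v x) y = 0" for y
        using fun_cong[OF v(2), of y] by (simp add: T_def)
      show "(r\<^sup>2 - (norm (y - a))\<^sup>2) * v y = 0" if "y \<in> sphere a r" for y
        using that by (simp add: dist_norm norm_minus_commute)
    qed
    moreover have "r\<^sup>2 - (norm (x - a))\<^sup>2 > 0" if "x \<in> ball a r" for x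
      using that r by (auto simp: dist_norm norm_minus_commute intro!: power_strict_mono)
    ultimately have "v x = 0" if "x \<in> ball a r" for x
      using that by (metis ball_subset_cball less_irrefl mult_eq_0_iff subsetD)
    then show "v = 0" using poly_space_eq_0[OF v(1) r] by (auto simp: zero_fun_def)
  qed
  then have "f \<in> T ` poly_space k" using f by (simp add: poly_space_def)
  then obtain q where "q \<in> poly_space k" "T q = f" by blast
  then show ?thesis using that by (auto simp: T_def)
qed

text \<open>Stone-Weierstrass takes care of the boundary values. The Laplacian is then corrected by
  a polynomial multiple of \<open>r^2 - |x - a|^2\<close>, which does not change them.\<close>

lemma poly_approx_dirichlet:
  fixes v :: "'a::euclidean_space \<Rightarrow> real"
  assumes r: "r > 0" and e: "e > 0" and v: "continuous_on (sphere a r) v"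
  obtains h k where "h \<in> poly_space k" "\<And>x. laplacian h x = m" "\<And>x. x \<in> sphere a r \<Longrightarrow> \<bar>v x - h x\<bar> < e"
proof -
  obtain g where g: "real_polynomial_function g" "\<And>x. x \<in> sphere a r \<Longrightarrow> \<bar>v x - g x\<bar> < e"
    by (rule Stone_Weierstrass_real_polynomial_function[OF compact_sphere v e]) blast
  obtain j where j: "g \<in> poly_space j" using real_polynomial_function_imp_poly_space[OF g(1)] by blast
  obtain D X where d: "\<And>y. (g has_derivative (\<lambda>h. D y \<bullet> h)) (at y)"
    "\<And>y. (D has_derivative X y) (at y)" "\<And>b c. (\<lambda>y. b \<bullet> X y c) \<in> poly_space (j - 2)"
    using poly_space_derivative2[OF j] by metis
  have "laplacian g = (\<lambda>y. op_trace (X y))"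
    by (intro ext, rule gradient_laplacian_eqI(2)[OF open_UNIV d(1,2)]) auto
  moreover have "(\<lambda>y. op_trace (X y)) \<in> poly_space (j - 2)"
    unfolding op_trace_def by (intro poly_space_sum d)
  \<comment> \<open>A positive index leaves room for the constant \<open>m\<close>.\<close>
  moreover have "j - 2 \<le> Suc j" by linarith
  ultimately have "laplacian g \<in> poly_space (Suc j)"
    using poly_space_mono[of "j - 2" "Suc j"] by (metis subsetD)
  then have "(\<lambda>x. m - laplacian g x) \<in> poly_space (Suc j)"
    by (intro poly_space_diff poly_space_const) simp
  then obtain q where q: "q \<in> poly_space (Suc j)"
    "\<And>x. laplacian (\<lambda>x. (r\<^sup>2 - (norm (x - a))\<^sup>2) * q x) x = m - laplacian g x"
    using poly_dirichlet_surj[OF r, of "\<lambda>x. m - laplacian g x" "Suc j" a] by blast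
  let ?w = "\<lambda>x. (r\<^sup>2 - (norm (x - a))\<^sup>2) * q x"
  have w: "?w \<in> poly_space (Suc (Suc (Suc j)))" by (rule poly_space_ball_weight[OF q(1)])
  show ?thesis
  proof (rule that)
    show "(\<lambda>x. g x + ?w x) \<in> poly_space (Suc (Suc (Suc j)))"
      using j poly_space_mono[of j "Suc (Suc (Suc j))"] by (intro poly_space_add w) auto
    show "laplacian (\<lambda>x. g x + ?w x) x = m" for x
      using laplacian_poly_add[OF j w, of 1 1 x] q(2)[of x] by simp
    show "\<bar>v x - (g x + ?w x)\<bar> < e" if "x \<in> sphere a r" for x
      using g(2)[OF that] that by (simp add: dist_norm norm_minus_commute)
  qed
qed

section \<open>Sums of subsolutions of the Poisson equation\<close>

definition poisson_subsolution :: "'a::euclidean_space set \<Rightarrow> ('a \<Rightarrow> real) \<Rightarrow> ('a \<Rightarrow> real) \<Rightarrow> bool" where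
  "poisson_subsolution S G v \<longleftrightarrow> (\<forall>x\<in>S. \<forall>q X. superjet v x q X \<longrightarrow> - op_trace X \<le> G x)"

lemma quadratic_poly_space:
  fixes X :: "'a::euclidean_space \<Rightarrow> 'a"
  assumes X: "linear X"
  shows "(\<lambda>y. q \<bullet> (y - x) + (y - x) \<bullet> X (y - x) / 2) \<in> poly_space 3"
proof -
  have 1: "(\<lambda>y. ((y - x) \<bullet> c) * 1) \<in> poly_space 2" for c :: 'a
    using poly_space_affine_mult[OF poly_space_const[of 1 0], of x c] by (simp add: numeral_2_eq_2)
  have "(\<lambda>y. ((y - x) \<bullet> q) * 1 + (1/2) * (\<Sum>b\<in>Basis. ((y - x) \<bullet> b) * (((y - x) \<bullet> adjoint X b) * 1))) \<in> poly_space 3"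
    using 1 poly_space_mono[of 2 3] poly_space_affine_mult[of _ 2 x]
    by (intro poly_space_add poly_space_cmult poly_space_sum) (auto simp: numeral_2_eq_2 numeral_3_eq_3)
  moreover have "(\<Sum>b\<in>Basis. ((y - x) \<bullet> b) * (((y - x) \<bullet> adjoint X b) * 1)) = (y - x) \<bullet> X (y - x)" for y
    unfolding euclidean_inner[of "y - x" "X (y - x)"] by (simp add: adjoint_works[OF X])
  ultimately show ?thesis by (simp add: inner_commute)
qed

text \<open>On a small ball, \<open>v\<close> and \<open>w\<close> are compared with \<open>h\<close> and \<open>\<phi> - h\<close> respectively, where the
  polynomial \<open>h\<close> is close to \<open>v\<close> on the sphere and \<open>\<phi>\<close> is the test function of \<open>v + w\<close>.\<close>

theorem poisson_subsolution_add:
  fixes v w :: "'a::euclidean_space \<Rightarrow> real"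
  assumes S: "open S" and v: "continuous_on S v" and w: "continuous_on S w"
    and F: "continuous_on S F" and G: "continuous_on S G"
    and vs: "poisson_subsolution S F v" and ws: "poisson_subsolution S G w"
  shows "poisson_subsolution S (\<lambda>x. F x + G x) (\<lambda>x. v x + w x)"
  unfolding poisson_subsolution_def
proof (intro ballI allI impI, rule ccontr)
  fix x q X assume x: "x \<in> S" and j: "superjet (\<lambda>x. v x + w x) x q X"
    and neg: "\<not> - op_trace X \<le> F x + G x"
  have lin: "linear X" using j by (simp add: superjet_def)
  \<comment> \<open>The defect is split into five parts: one is lost when \<open>X\<close> is
    enlarged to \<open>Y\<close>, one makes \<open>h\<close> a strict supersolution although
    \<open>F\<close> varies by up to \<eta>, and the remaining three exceed the variation of
    \<open>G\<close>.\<close>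
  define \<eta> where "\<eta> = (- op_trace X - F x - G x) / 5"
  have \<eta>: "\<eta> > 0" using neg by (simp add: \<eta>_def)
  define \<delta> where "\<delta> = \<eta> / (4 * DIM('a))"
  have \<delta>: "\<delta> > 0" using \<eta> by (simp add: \<delta>_def)
  \<comment> \<open>Half of the added multiple of the identity absorbs the remainder of the
    superjet, the other half leaves the margin \<open>\<delta> * (norm (y - x))\<^sup>2\<close> in
    \<open>touch\<close>.\<close>
  define Y where "Y h = X h + (4 * \<delta>) *\<^sub>R h" for h
  have Y: "linear Y" unfolding Y_def using lin by (auto simp: linear_iff algebra_simps)
  have trY: "op_trace Y = op_trace X + \<eta>"
    unfolding Y_def[abs_def] op_trace_simps by (simp add: \<delta>_def)
  define \<phi> where "\<phi> y = q \<bullet> (y - x) + (y - x) \<bullet> Y (y - x) / 2" for y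
  have \<phi>: "\<phi> \<in> poly_space 3" "\<And>y. laplacian \<phi> y = op_trace Y"
    unfolding \<phi>_def[abs_def] by (rule quadratic_poly_space[OF Y], rule quadratic_test_function(3)[OF Y])
  have touch: "\<forall>\<^sub>F y in nhds x. v y + w y \<le> v x + w x + \<phi> y - \<delta> * (norm (y - x))\<^sup>2"
    using superjet_shift[OF j \<delta>]
  proof (rule eventually_mono)
    fix y
    have "\<phi> y = q \<bullet> (y - x) + (y - x) \<bullet> (X (y - x) + (2 * \<delta>) *\<^sub>R (y - x)) / 2 + \<delta> * (norm (y - x))\<^sup>2"
      by (simp add: \<phi>_def Y_def inner_add_right power2_norm_eq_inner add_divide_distrib)
    then show "v y + w y \<le> v x + w x + \<phi> y - \<delta> * (norm (y - x))\<^sup>2"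
      if "v y + w y \<le> v x + w x + q \<bullet> (y - x) + (y - x) \<bullet> (X (y - x) + (2 * \<delta>) *\<^sub>R (y - x)) / 2"
      using that by linarith
  qed
  have near: "\<forall>\<^sub>F y in nhds x. \<bar>K y - K x\<bar> < \<eta>" if "continuous_on S K" for K :: "'a \<Rightarrow> real"
  proof -
    have "isCont K x" using that S x by (simp add: continuous_on_eq_continuous_at)
    then have "filterlim K (nhds (K x)) (nhds x)" by (simp add: isCont_def tendsto_at_iff_tendsto_nhds)
    then show ?thesis using \<eta> by (auto simp: tendsto_iff dist_real_def)
  qed
  have "\<forall>\<^sub>F y in nhds x. y \<in> S \<and> v y + w y \<le> v x + w x + \<phi> y - \<delta> * (norm (y - x))\<^sup>2
      \<and> \<bar>F y - F x\<bar> < \<eta> \<and> \<bar>G y - G x\<bar> < \<eta>"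
    using eventually_nhds_in_open[OF S x] touch near[OF F] near[OF G] by eventually_elim auto
  then obtain d where d: "d > 0" "\<And>y. dist y x < d \<Longrightarrow> y \<in> S \<and> v y + w y \<le> v x + w x + \<phi> y - \<delta> * (norm (y - x))\<^sup>2
      \<and> \<bar>F y - F x\<bar> < \<eta> \<and> \<bar>G y - G x\<bar> < \<eta>"
    unfolding eventually_nhds_metric by blast
  define r where "r = d / 2"
  have r: "r > 0" using d by (simp add: r_def)
  have B: "y \<in> S" "v y + w y \<le> v x + w x + \<phi> y - \<delta> * (norm (y - x))\<^sup>2" "\<bar>F y - F x\<bar> < \<eta>" "\<bar>G y - G x\<bar> < \<eta>"
    if "y \<in> cball x r" for y
    using d(2)[of y] that d(1) by (auto simp: r_def dist_commute)
  have sub: "cball x r \<subseteq> S" using B by blast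
  \<comment> \<open>On the sphere the margin is \<open>\<delta> * r\<^sup>2 = 4 * e\<close>; the two
    comparisons together lose only \<open>2 * e\<close>.\<close>
  define e where "e = \<delta> * r\<^sup>2 / 4"
  have e: "e > 0" using \<delta> r by (simp add: e_def)
  obtain h k where h: "h \<in> poly_space k" "\<And>y. laplacian h y = - (F x + \<eta>)"
    "\<And>y. y \<in> sphere x r \<Longrightarrow> \<bar>v y - h y\<bar> < e"
    using poly_approx_dirichlet[OF r e continuous_on_subset[OF v]] sub sphere_cball by (metis subset_trans)
  have xb: "x \<in> cball x r" using r by simp
  have "v x \<le> h x + e"
  proof (rule laplacian_comparison[OF _ continuous_on_subset[OF v sub] h(1) _ _ _ xb, where G=F])
    show "- op_trace X \<le> F y" if "y \<in> ball x r" "superjet v y q X" for y q X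
      using vs that sub ball_subset_cball unfolding poisson_subsolution_def by blast
    show "F y < - laplacian h y" if "y \<in> ball x r" for y using B(3)[of y] that h(2)[of y] by auto
    show "v y \<le> h y + e" if "y \<in> sphere x r" for y using h(3)[OF that] by linarith
  qed (use r in simp)
  \<comment> \<open>On the sphere \<open>w\<close> lies below \<open>\<phi> - h\<close> up to a
    constant, because \<open>v\<close> is at least \<open>h - e\<close> there. The coefficients
    \<open>1\<close> and \<open>-1\<close> fit \<open>laplacian_poly_add\<close>.\<close>
  moreover have "w x \<le> 1 * \<phi> x + (-1) * h x + (v x + w x + e - \<delta> * r\<^sup>2)"
  proof (rule laplacian_comparison[OF _ continuous_on_subset[OF w sub] _ _ _ _ xb, where G=G])
    show "(\<lambda>y. 1 * \<phi> y + (-1) * h y) \<in> poly_space (max 3 k)"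
      using \<phi>(1) h(1) poly_space_mono[of 3 "max 3 k"] poly_space_mono[of k "max 3 k"]
      by (intro poly_space_add poly_space_cmult) auto
    show "- op_trace X \<le> G y" if "y \<in> ball x r" "superjet w y q X" for y q X
      using ws that sub ball_subset_cball unfolding poisson_subsolution_def by blast
    show "G y < - laplacian (\<lambda>y. 1 * \<phi> y + (-1) * h y) y" if "y \<in> ball x r" for y
    proof -
      have "- op_trace X = F x + G x + 5 * \<eta>" by (simp add: \<eta>_def field_simps)
      then show ?thesis
        unfolding laplacian_poly_add[OF \<phi>(1) h(1)] \<phi>(2) h(2) trY using B(4)[of y] that \<eta> by auto
    qed
    show "w y \<le> 1 * \<phi> y + (-1) * h y + (v x + w x + e - \<delta> * r\<^sup>2)" if "y \<in> sphere x r" for y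
    proof -
      have "norm (y - x) = r" using that by (simp add: dist_norm norm_minus_commute)
      then show ?thesis using h(3)[OF that] B(2)[of y] that by auto
    qed
  qed (use r in simp)
  moreover have "\<phi> x = 0" using linear_0[OF Y] by (simp add: \<phi>_def)
  \<comment> \<open>Both comparisons are evaluated at the centre and added: \<open>h x\<close>
    cancels and the margin remains.\<close>
  ultimately have "\<delta> * r\<^sup>2 \<le> 2 * e" by linarith
  then show False using e by (simp add: e_def)
qed

section \<open>Convex combinations of subsolutions\<close>

text \<open>The product rule for \<open>exp (k \<bullet> y)\<close> times a quadratic polynomial
  that touches \<open>v\<close> from above. Such a polynomial is obtained by enlarging
  \<open>X\<close>, hence the \<delta> in the trace.\<close>

lemma exp_mult_superjet:
  fixes X :: "'a::euclidean_space \<Rightarrow> 'a"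
  assumes j: "superjet v x q X" and \<delta>: "\<delta> > 0"
  obtains Z where "superjet (\<lambda>y. exp (k \<bullet> y) * v y) x (exp (k \<bullet> x) *\<^sub>R (q + v x *\<^sub>R k)) Z"
    "op_trace Z = exp (k \<bullet> x) * (op_trace X + 2 * (k \<bullet> q) + v x * (k \<bullet> k)) + \<delta>"
proof -
  define e where "e = exp (k \<bullet> x)"
  have e: "e > 0" by (simp add: e_def)
  \<comment> \<open>Chosen such that \<open>e * (2 * d * DIM('a))\<close> equals \<delta>.\<close>
  define d where "d = \<delta> / (2 * DIM('a) * e)"
  have d: "d > 0" using \<delta> e by (simp add: d_def)
  have lin: "linear X" using j by (simp add: superjet_def)
  define Y where "Y h = X h + (2 * d) *\<^sub>R h" for h
  have Y: "linear Y" unfolding Y_def using lin by (auto simp: linear_iff algebra_simps)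
  let ?P = "\<lambda>y. v x + (q \<bullet> (y - x) + (y - x) \<bullet> Y (y - x) / 2)"
  let ?R = "\<lambda>y. q + (1/2) *\<^sub>R (Y (y - x) + adjoint Y (y - x))"
  let ?D = "\<lambda>y. exp (k \<bullet> y) *\<^sub>R (?P y *\<^sub>R k + ?R y)"
  let ?Z = "\<lambda>h. e *\<^sub>R ((v x * (k \<bullet> h)) *\<^sub>R k + (q \<bullet> h) *\<^sub>R k + (k \<bullet> h) *\<^sub>R q + (1/2) *\<^sub>R (Y h + adjoint Y h))"
  have P: "(?P has_derivative (\<lambda>h. ?R y \<bullet> h)) (at y)" for y
    by (rule has_derivative_eq_rhs[OF has_derivative_add[OF has_derivative_const inner_operator_derivative(2)[OF Y]]]) simp
  have R: "(?R has_derivative (\<lambda>h. (1/2) *\<^sub>R (Y h + adjoint Y h))) (at y)" for y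
    by (rule inner_operator_derivative(1)[OF Y])
  have E: "((\<lambda>y. exp (k \<bullet> y)) has_derivative (\<lambda>h. exp (k \<bullet> y) * (k \<bullet> h))) (at y)" for y
    by (auto intro!: derivative_eq_intros)
  have 0: "Y 0 = 0" "adjoint Y 0 = 0" using Y by (simp_all add: linear_0 adjoint_linear)
  have D: "((\<lambda>y. exp (k \<bullet> y) * ?P y) has_derivative (\<lambda>h. ?D y \<bullet> h)) (at y)" for y
    by (rule has_derivative_eq_rhs[OF has_derivative_mult[OF E P]])
      (simp add: fun_eq_iff inner_add_left algebra_simps)
  have Z: "(?D has_derivative ?Z) (at x)"
    by (rule has_derivative_eq_rhs[OF has_derivative_scaleR[OF E has_derivative_add[OF
          has_derivative_scaleR_left[OF P] R]]])
      (simp add: fun_eq_iff 0 e_def algebra_simps)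
  have "jet (\<lambda>y. exp (k \<bullet> y) * ?P y) x (?D x) ?Z"
    by (rule jetI[OF _ Z], rule always_eventually, rule allI, rule D)
  then have "superjet (\<lambda>y. exp (k \<bullet> y) * v y) x (?D x) ?Z"
  proof (rule jet_imp_superjet)
    show "\<forall>\<^sub>F y in nhds x. exp (k \<bullet> y) * v y - exp (k \<bullet> y) * ?P y \<le> exp (k \<bullet> x) * v x - exp (k \<bullet> x) * ?P x"
      using superjet_shift[OF j d] by eventually_elim (auto simp: 0 Y_def add.assoc)
  qed
  moreover have "?D x = exp (k \<bullet> x) *\<^sub>R (q + v x *\<^sub>R k)" by (simp add: 0 add.commute)
  moreover have "op_trace ?Z = e * (v x * (k \<bullet> k) + 2 * (k \<bullet> q) + op_trace Y)"
  proof -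
    note op_trace_adjoint[OF Y]
    moreover have "op_trace (\<lambda>h. (v x * (k \<bullet> h)) *\<^sub>R k) = v x * (k \<bullet> k)"
      using op_trace_rank_one[of "v x *\<^sub>R k" k] by simp
    ultimately show ?thesis unfolding op_trace_simps op_trace_rank_one by (simp add: inner_commute)
  qed
  moreover have "op_trace Y = op_trace X + 2 * d * DIM('a)"
    unfolding Y_def[abs_def] op_trace_simps by simp
  ultimately show ?thesis
    using e that[of ?Z] by (simp add: e_def[symmetric] d_def algebra_simps)
qed

section \<open>Linear equations with constant drift\<close>

definition drift_subsolution ::
  "real \<Rightarrow> 'a::euclidean_space \<Rightarrow> 'a set \<Rightarrow> ('a \<Rightarrow> real) \<Rightarrow> ('a \<Rightarrow> real) \<Rightarrow> bool" where
  "drift_subsolution \<epsilon> Q S G u \<longleftrightarrow>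
    (\<forall>x\<in>S. \<forall>q X. superjet u x q X \<longrightarrow> Q \<bullet> q - \<epsilon> * op_trace X \<le> G x)"

lemma field_le_epsilon_mult:
  fixes a b :: real
  assumes "\<And>\<delta>. \<delta> > 0 \<Longrightarrow> a \<le> b + m * \<delta>" "m > 0"
  shows "a \<le> b"
proof (rule field_le_epsilon)
  fix e :: real assume "e > 0"
  then show "a \<le> b + e" using assms(1)[of "e / m"] assms(2) by simp
qed

text \<open>The drift is removed by writing \<open>u = exp (Q \<bullet> y / (2 \<epsilon>)) v\<close>; the resulting zero order term
  is a continuous function and is treated as part of the right-hand side.\<close>

lemma drift_iff_poisson:
  fixes u :: "'a::euclidean_space \<Rightarrow> real"
  assumes \<epsilon>: "\<epsilon> > 0" and k: "Q = (2 * \<epsilon>) *\<^sub>R k"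
  shows "drift_subsolution \<epsilon> Q S G u \<longleftrightarrow>
    poisson_subsolution S (\<lambda>x. exp (- k \<bullet> x) * (G x / \<epsilon> - (k \<bullet> k) * u x)) (\<lambda>x. exp (- k \<bullet> x) * u x)"
proof
  assume u: "drift_subsolution \<epsilon> Q S G u"
  show "poisson_subsolution S (\<lambda>x. exp (- k \<bullet> x) * (G x / \<epsilon> - (k \<bullet> k) * u x)) (\<lambda>x. exp (- k \<bullet> x) * u x)"
    unfolding poisson_subsolution_def
  proof (intro ballI allI impI)
    fix x q X assume x: "x \<in> S" and j: "superjet (\<lambda>x. exp (- k \<bullet> x) * u x) x q X"
    define e where "e = exp (k \<bullet> x)"
    have e: "e > 0" "exp (- k \<bullet> x) = 1 / e" by (simp_all add: e_def exp_minus field_simps)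
    have eq: "(\<lambda>y. exp (k \<bullet> y) * (exp (- k \<bullet> y) * u y)) = u"
      by (simp add: fun_eq_iff exp_minus field_simps)
    \<comment> \<open>Multiplication by \<open>exp (k \<bullet> x)\<close> undoes the factor; the
      term \<open>2 * (k \<bullet> q)\<close> in the new trace cancels the drift because
      \<open>Q = (2 * \<epsilon>) *\<^sub>R k\<close>.\<close>
    have "- op_trace X \<le> exp (- k \<bullet> x) * (G x / \<epsilon> - (k \<bullet> k) * u x) + (1 / e) * \<delta>" if \<delta>: "\<delta> > 0" for \<delta>
    proof -
      obtain Z where Z: "superjet u x (e *\<^sub>R (q + (u x / e) *\<^sub>R k)) Z"
        "op_trace Z = e * (op_trace X + 2 * (k \<bullet> q) + u x / e * (k \<bullet> k)) + \<delta>"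
        using exp_mult_superjet[OF j \<delta>, of k] unfolding eq e_def[symmetric] e(2) by auto
      have "Q \<bullet> (e *\<^sub>R (q + (u x / e) *\<^sub>R k)) - \<epsilon> * op_trace Z \<le> G x"
        using u x Z(1) unfolding drift_subsolution_def by blast
      then have "\<epsilon> * (u x * (k \<bullet> k)) - \<epsilon> * e * op_trace X - \<epsilon> * \<delta> \<le> G x"
        unfolding Z(2) k using e(1) by (simp add: inner_add_right algebra_simps)
      then have "(- \<epsilon> * e * op_trace X) / (\<epsilon> * e) \<le> (G x - \<epsilon> * (u x * (k \<bullet> k)) + \<epsilon> * \<delta>) / (\<epsilon> * e)"
        using e(1) \<epsilon> by (intro divide_right_mono) auto
      then show ?thesis
        unfolding e(2) using e(1) \<epsilon> by (simp add: add_divide_distrib diff_divide_distrib algebra_simps)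
    qed
    moreover have "1 / e > 0" using e(1) by (intro divide_pos_pos) simp_all
    ultimately show "- op_trace X \<le> exp (- k \<bullet> x) * (G x / \<epsilon> - (k \<bullet> k) * u x)"
      by (rule field_le_epsilon_mult)
  qed
next
  assume v: "poisson_subsolution S (\<lambda>x. exp (- k \<bullet> x) * (G x / \<epsilon> - (k \<bullet> k) * u x)) (\<lambda>x. exp (- k \<bullet> x) * u x)"
  show "drift_subsolution \<epsilon> Q S G u"
    unfolding drift_subsolution_def
  proof (intro ballI allI impI)
    fix x q X assume x: "x \<in> S" and j: "superjet u x q X"
    define e where "e = exp (- k \<bullet> x)"
    have e: "e > 0" by (simp_all add: e_def)
    have "Q \<bullet> q - \<epsilon> * op_trace X \<le> G x + (\<epsilon> / e) * \<delta>" if \<delta>: "\<delta> > 0" for \<delta>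
    proof -
      obtain Z where Z: "superjet (\<lambda>y. exp (- k \<bullet> y) * u y) x (e *\<^sub>R (q + u x *\<^sub>R (- k))) Z"
        "op_trace Z = e * (op_trace X + 2 * (- k \<bullet> q) + u x * (k \<bullet> k)) + \<delta>"
        using exp_mult_superjet[OF j \<delta>, of "- k"] unfolding e_def[symmetric] by auto
      have "- op_trace Z \<le> e * (G x / \<epsilon> - (k \<bullet> k) * u x)"
        using v x Z(1) unfolding poisson_subsolution_def e_def by blast
      then show ?thesis
        unfolding Z(2) k using e \<epsilon> by (simp add: field_simps)
    qed
    moreover have "\<epsilon> / e > 0" using e \<epsilon> by (intro divide_pos_pos) simp_all
    ultimately show "Q \<bullet> q - \<epsilon> * op_trace X \<le> G x"
      by (rule field_le_epsilon_mult)
  qed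
qed

text \<open>Both functions are multiplied by the same exponential because they share the drift
  \<open>Q\<close>. The zero order terms created by the factor are linear in the function and add up
  to that of the sum.\<close>

lemma drift_subsolution_add:
  fixes u v :: "'a::euclidean_space \<Rightarrow> real"
  assumes \<epsilon>: "\<epsilon> > 0" and S: "open S" and u: "continuous_on S u" and v: "continuous_on S v"
    and F: "continuous_on S F" and G: "continuous_on S G"
    and us: "drift_subsolution \<epsilon> Q S F u" and vs: "drift_subsolution \<epsilon> Q S G v"
  shows "drift_subsolution \<epsilon> Q S (\<lambda>x. F x + G x) (\<lambda>x. u x + v x)"
proof -
  define k where "k = (1 / (2 * \<epsilon>)) *\<^sub>R Q"
  have k: "Q = (2 * \<epsilon>) *\<^sub>R k" using \<epsilon> by (simp add: k_def)
  note iff = drift_iff_poisson[OF \<epsilon> k]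
  have c: "continuous_on S (\<lambda>x. exp (- k \<bullet> x) * (K x / \<epsilon> - (k \<bullet> k) * w x))"
    "continuous_on S (\<lambda>x. exp (- k \<bullet> x) * w x)"
    if "continuous_on S K" "continuous_on S w" for K w
    using that \<epsilon> by (auto intro!: continuous_intros)
  have "poisson_subsolution S
      (\<lambda>x. exp (- k \<bullet> x) * (F x / \<epsilon> - (k \<bullet> k) * u x) + exp (- k \<bullet> x) * (G x / \<epsilon> - (k \<bullet> k) * v x))
      (\<lambda>x. exp (- k \<bullet> x) * u x + exp (- k \<bullet> x) * v x)"
    using us vs unfolding iff
    by (intro poisson_subsolution_add[OF S c(2)[OF F u] c(2)[OF G v] c(1)[OF F u] c(1)[OF G v]])
  then show ?thesis
    unfolding iff by (simp add: add_divide_distrib algebra_simps)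
qed

text \<open>Dilation and multiplication are treated together; the case \<open>m = 1\<close> serves
  to undo the division of a combination by \<open>B\<close>.\<close>

lemma superjet_scale:
  fixes u :: "'a::euclidean_space \<Rightarrow> real"
  assumes j: "superjet (\<lambda>y. a * u (m *\<^sub>R y)) x q X" and a: "a > 0" and m: "m > 0"
  shows "superjet u (m *\<^sub>R x) ((1 / (a * m)) *\<^sub>R q) (\<lambda>h. (1 / (a * m\<^sup>2)) *\<^sub>R X h)"
  unfolding superjet_def
proof (intro conjI allI impI)
  have lin: "linear X" using j by (simp add: superjet_def)
  then show "linear (\<lambda>h. (1 / (a * m\<^sup>2)) *\<^sub>R X h)" by (auto simp: linear_iff algebra_simps)
  fix \<delta> :: real assume \<delta>: "\<delta> > 0"
  have "\<forall>\<^sub>F y in nhds x. a * u (m *\<^sub>R y) \<le> a * u (m *\<^sub>R x) + q \<bullet> (y - x) + (y - x) \<bullet> X (y - x) / 2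
      + (a * m\<^sup>2 * \<delta>) * (norm (y - x))\<^sup>2"
    using j mult_pos_pos[OF mult_pos_pos[OF a zero_less_power[OF m]] \<delta>] unfolding superjet_def by blast
  moreover have "((\<lambda>y. (1 / m) *\<^sub>R y) \<longlongrightarrow> (1 / m) *\<^sub>R (m *\<^sub>R x)) (nhds (m *\<^sub>R x))"
    by (intro tendsto_scaleR tendsto_const filterlim_ident)
  then have "filterlim (\<lambda>y. (1 / m) *\<^sub>R y) (nhds x) (nhds (m *\<^sub>R x))" using m by simp
  ultimately have "\<forall>\<^sub>F y in nhds (m *\<^sub>R x). a * u (m *\<^sub>R ((1 / m) *\<^sub>R y)) \<le> a * u (m *\<^sub>R x) + q \<bullet> ((1 / m) *\<^sub>R y - x)
      + ((1 / m) *\<^sub>R y - x) \<bullet> X ((1 / m) *\<^sub>R y - x) / 2 + (a * m\<^sup>2 * \<delta>) * (norm ((1 / m) *\<^sub>R y - x))\<^sup>2"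
    by (rule eventually_compose_filterlim)
  then show "\<forall>\<^sub>F y in nhds (m *\<^sub>R x). u y \<le> u (m *\<^sub>R x) + ((1 / (a * m)) *\<^sub>R q) \<bullet> (y - m *\<^sub>R x)
      + (y - m *\<^sub>R x) \<bullet> ((1 / (a * m\<^sup>2)) *\<^sub>R X (y - m *\<^sub>R x)) / 2 + \<delta> * (norm (y - m *\<^sub>R x))\<^sup>2"
  proof (rule eventually_mono)
    fix y
    define z where "z = y - m *\<^sub>R x"
    have z: "(1 / m) *\<^sub>R y - x = (1 / m) *\<^sub>R z" using m by (simp add: z_def scaleR_diff_right)
    have X: "X ((1 / m) *\<^sub>R z) = (1 / m) *\<^sub>R X z" by (rule linear_scale[OF lin])
    assume "a * u (m *\<^sub>R ((1 / m) *\<^sub>R y)) \<le> a * u (m *\<^sub>R x) + q \<bullet> ((1 / m) *\<^sub>R y - x)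
      + ((1 / m) *\<^sub>R y - x) \<bullet> X ((1 / m) *\<^sub>R y - x) / 2 + (a * m\<^sup>2 * \<delta>) * (norm ((1 / m) *\<^sub>R y - x))\<^sup>2"
    then have "a * u y \<le> a * u (m *\<^sub>R x) + q \<bullet> z / m + z \<bullet> X z / m\<^sup>2 / 2 + a * \<delta> * (norm z)\<^sup>2"
      unfolding z X using m by (simp add: power_divide power2_eq_square field_simps)
    also have "\<dots> = a * (u (m *\<^sub>R x) + q \<bullet> z / (a * m) + z \<bullet> X z / (a * m\<^sup>2) / 2 + \<delta> * (norm z)\<^sup>2)"
      using a m by (simp add: field_simps)
    finally show "u y \<le> u (m *\<^sub>R x) + ((1 / (a * m)) *\<^sub>R q) \<bullet> (y - m *\<^sub>R x)
      + (y - m *\<^sub>R x) \<bullet> ((1 / (a * m\<^sup>2)) *\<^sub>R X (y - m *\<^sub>R x)) / 2 + \<delta> * (norm (y - m *\<^sub>R x))\<^sup>2"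
      unfolding z_def[symmetric] using a by simp
  qed
qed

text \<open>For \<open>p > 1\<close>, the convex conjugate of \<open>|\<xi>|^p\<close>, that is, the
  supremum of \<open>Q \<bullet> \<xi> - |\<xi>|^p\<close> over all \<xi>.\<close>

definition conj_power :: "real \<Rightarrow> 'a::euclidean_space \<Rightarrow> real" where
  "conj_power p Q = (p - 1) * (norm Q / p) powr (p / (p - 1))"

lemma inner_le_conj_power:
  assumes p: "p > 1"
  shows "Q \<bullet> \<xi> \<le> norm \<xi> powr p + conj_power p Q"
proof -
  have "norm \<xi> * (norm Q / p) \<le> norm \<xi> powr p / p + (norm Q / p) powr (p / (p - 1)) / (p / (p - 1))"
    using p by (intro Youngs_inequality) (auto simp: field_simps)
  then have "p * (norm \<xi> * (norm Q / p)) \<le> p * (norm \<xi> powr p / p + (norm Q / p) powr (p / (p - 1)) / (p / (p - 1)))"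
    using p by (intro mult_left_mono) auto
  then have "norm Q * norm \<xi> \<le> norm \<xi> powr p + conj_power p Q"
    using p by (simp add: conj_power_def distrib_left mult.commute)
  then show ?thesis using norm_cauchy_schwarz[of Q \<xi>] by linarith
qed

text \<open>The optimal \<open>Q\<close> is the gradient of \<open>|\<xi>|^p\<close> at
  \<xi>.\<close>

lemma conj_power_attained:
  fixes \<xi> :: "'a::euclidean_space"
  assumes p: "p > 1"
  obtains Q where "Q \<bullet> \<xi> - conj_power p Q = norm \<xi> powr p"
proof (cases "\<xi> = 0")
  case True then show ?thesis using p by (intro that[of 0]) (simp add: conj_power_def)
next
  case False
  then have n: "norm \<xi> > 0" by simp
  define Q where "Q = (p * norm \<xi> powr (p - 2)) *\<^sub>R \<xi>"
  have "norm Q / p = norm \<xi> powr (p - 2) * norm \<xi> powr 1" using p n by (simp add: Q_def)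
  also have "\<dots> = norm \<xi> powr (p - 1)" using powr_add[of "norm \<xi>" "p - 2" 1] by simp
  finally have "(norm Q / p) powr (p / (p - 1)) = norm \<xi> powr p" using p n by (simp add: powr_powr)
  moreover have "Q \<bullet> \<xi> = p * (norm \<xi> powr (p - 2) * (norm \<xi>)\<^sup>2)"
    using n by (simp add: Q_def power2_norm_eq_inner[symmetric])
  then have "Q \<bullet> \<xi> = p * norm \<xi> powr p"
    using powr_add[of "norm \<xi>" "p - 2" 2] n by simp
  ultimately show ?thesis by (intro that[of Q]) (simp add: conj_power_def algebra_simps)
qed

text \<open>This homogeneity is the origin of the exponent \<open>p / (p - 1)\<close> in
  \<open>B\<close>.\<close>

lemma conj_power_scale:
  assumes "b > 0" "p > 0"
  shows "conj_power p (b *\<^sub>R Q) = b powr (p / (p - 1)) * conj_power p Q"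
proof -
  have "(norm (b *\<^sub>R Q) / p) powr r = b powr r * (norm Q / p) powr r" for r
    using assms powr_mult[of b "norm Q / p" r] by simp
  then show ?thesis by (simp add: conj_power_def mult.left_commute)
qed

definition admissible :: "real \<Rightarrow> real \<Rightarrow> ('a::euclidean_space \<Rightarrow> real) \<Rightarrow> 'a set \<Rightarrow> real \<Rightarrow> bool" where
  "admissible \<epsilon> p f S c \<longleftrightarrow>
    (\<exists>u. continuous_on S u \<and> viscosity_subsolution \<epsilon> (Hamiltonian p f) S c u)"

text \<open>The factor \<open>b\<^sup>2\<close> cancels the one produced by two derivatives, so that
  the trace is only divided by \<open>s\<close>. One \<open>b\<close> is left over in the gradient;
  to compensate it, Young's inequality is applied to \<open>b *\<^sub>R Q\<close> instead of
  \<open>Q\<close>.\<close>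

lemma scaled_drift_subsolution:
  fixes u :: "'a::euclidean_space \<Rightarrow> real"
  assumes \<epsilon>: "\<epsilon> > 0" and p: "p > 1" and T: "open T"
    and u: "viscosity_subsolution \<epsilon> (Hamiltonian p f) T c u"
    and s: "s > 0" and b: "b > 0" and S: "\<And>x. x \<in> S \<Longrightarrow> (1 / b) *\<^sub>R x \<in> T"
  shows "drift_subsolution \<epsilon> Q S (\<lambda>x. s * (c + f ((1 / b) *\<^sub>R x)) + s * b powr (p / (p - 1)) * conj_power p Q)
    (\<lambda>x. s * b\<^sup>2 * u ((1 / b) *\<^sub>R x))"
  unfolding drift_subsolution_def
proof (intro ballI allI impI)
  fix x q X assume x: "x \<in> S" and j: "superjet (\<lambda>x. s * b\<^sup>2 * u ((1 / b) *\<^sub>R x)) x q X"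
  have e: "1 / (s * b\<^sup>2 * (1 / b)) = 1 / (s * b)" "1 / (s * b\<^sup>2 * (1 / b)\<^sup>2) = 1 / s"
    using s b by (simp_all add: power2_eq_square power_divide)
  have "superjet u ((1 / b) *\<^sub>R x) ((1 / (s * b)) *\<^sub>R q) (\<lambda>h. (1 / s) *\<^sub>R X h)"
    using superjet_scale[OF j] s b unfolding e by simp
  then have *: "norm ((1 / (s * b)) *\<^sub>R q) powr p - f ((1 / b) *\<^sub>R x) - \<epsilon> * op_trace (\<lambda>h. (1 / s) *\<^sub>R X h) \<le> c"
    using u S[OF x] unfolding viscosity_subsolution_iff_superjet[OF T \<epsilon>] Hamiltonian_def by blast
  have "(b *\<^sub>R Q) \<bullet> ((1 / (s * b)) *\<^sub>R q) \<le> norm ((1 / (s * b)) *\<^sub>R q) powr p + b powr (p / (p - 1)) * conj_power p Q"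
    using inner_le_conj_power[OF p, of "b *\<^sub>R Q" "(1 / (s * b)) *\<^sub>R q"] conj_power_scale[OF b, of p Q] p
    by linarith
  then have "Q \<bullet> q / s \<le> norm ((1 / (s * b)) *\<^sub>R q) powr p + b powr (p / (p - 1)) * conj_power p Q"
    using b s by simp
  then have "Q \<bullet> q / s - \<epsilon> * (op_trace X / s) \<le> c + f ((1 / b) *\<^sub>R x) + b powr (p / (p - 1)) * conj_power p Q"
    using * by (simp add: op_trace_simps)
  then have "s * (Q \<bullet> q / s - \<epsilon> * (op_trace X / s)) \<le> s * (c + f ((1 / b) *\<^sub>R x) + b powr (p / (p - 1)) * conj_power p Q)"
    using s by (intro mult_left_mono) auto
  then show "Q \<bullet> q - \<epsilon> * op_trace X \<le> s * (c + f ((1 / b) *\<^sub>R x)) + s * b powr (p / (p - 1)) * conj_power p Q"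
    using s by (simp add: algebra_simps)
qed

text \<open>The functions \<open>v 1\<close> and \<open>v 2\<close> do not depend on
  \<open>Q\<close>, so their sum satisfies the linear inequality for every \<open>Q\<close>. Given a
  superjet of \<open>w\<close>, the \<open>Q\<close> that is optimal for its gradient restores the
  power. \<open>B\<close> is the total coefficient of \<open>conj_power p Q\<close>, and division by
  \<open>B\<close> brings this coefficient to one.\<close>

lemma admissible_combination:
  fixes f :: "'a::euclidean_space \<Rightarrow> real" and c s b :: "nat \<Rightarrow> real"
  assumes \<epsilon>: "\<epsilon> > 0" and p: "p > 1" and S: "open S" and T: "\<And>i. i \<in> {1, 2::nat} \<Longrightarrow> open (T i)"
    and c: "\<And>i. i \<in> {1, 2} \<Longrightarrow> admissible \<epsilon> p f (T i) (c i)"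
    and f: "\<And>i. i \<in> {1, 2} \<Longrightarrow> continuous_on (T i) f"
    and s: "\<And>i. i \<in> {1, 2} \<Longrightarrow> s i > 0" and b: "\<And>i. i \<in> {1, 2} \<Longrightarrow> b i > 0"
    and ST: "\<And>i x. i \<in> {1, 2} \<Longrightarrow> x \<in> S \<Longrightarrow> (1 / b i) *\<^sub>R x \<in> T i"
    and B: "B = s 1 * b 1 powr (p / (p - 1)) + s 2 * b 2 powr (p / (p - 1))"
    and le: "\<And>x. x \<in> S \<Longrightarrow>
      (s 1 * (c 1 + f ((1 / b 1) *\<^sub>R x)) + s 2 * (c 2 + f ((1 / b 2) *\<^sub>R x))) / B - f x \<le> C"
  shows "admissible \<epsilon> p f S C"
proof -
  have "\<forall>i. \<exists>u. i \<in> {1, 2} \<longrightarrow> continuous_on (T i) u \<and> viscosity_subsolution \<epsilon> (Hamiltonian p f) (T i) (c i) u"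
    using c unfolding admissible_def by blast
  then obtain u where u: "\<And>i. i \<in> {1, 2} \<Longrightarrow> continuous_on (T i) (u i)"
    "\<And>i. i \<in> {1, 2} \<Longrightarrow> viscosity_subsolution \<epsilon> (Hamiltonian p f) (T i) (c i) (u i)" by metis
  define v where "v i x = s i * (b i)\<^sup>2 * u i ((1 / b i) *\<^sub>R x)" for i x
  define G where "G Q i x = s i * (c i + f ((1 / b i) *\<^sub>R x)) + s i * b i powr (p / (p - 1)) * conj_power p Q" for Q :: 'a and i x
  have comp: "continuous_on S (\<lambda>x. h ((1 / b i) *\<^sub>R x))" if "i \<in> {1, 2}" "continuous_on (T i) h" for i and h :: "'a \<Rightarrow> real"
    by (rule continuous_on_compose2[OF that(2)]) (use ST that in \<open>auto intro!: continuous_intros\<close>)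
  have v: "continuous_on S (v i)" if "i \<in> {1, 2}" for i
    unfolding v_def by (intro continuous_intros comp u that)
  have G: "continuous_on S (G Q i)" if "i \<in> {1, 2}" for i Q
    unfolding G_def by (intro continuous_intros comp f that)
  have d: "drift_subsolution \<epsilon> Q S (G Q i) (v i)" if "i \<in> {1, 2}" for i Q
    unfolding G_def v_def
    by (rule scaled_drift_subsolution[OF \<epsilon> p T[OF that] u(2)[OF that] s[OF that] b[OF that] ST[OF that]])
  have sum: "drift_subsolution \<epsilon> Q S (\<lambda>x. G Q 1 x + G Q 2 x) (\<lambda>x. v 1 x + v 2 x)" for Q
    by (intro drift_subsolution_add[OF \<epsilon> S] v G d) auto
  have B0: "B > 0" 
    using s[of 1] s[of 2] b[of 1] b[of 2] unfolding B by (intro add_pos_pos mult_pos_pos) auto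
  \<comment> \<open>The factor \<open>1\<close> brings \<open>w\<close> into the form required by
    \<open>superjet_scale\<close>.\<close>
  define w where "w x = (1 / B) * (v 1 (1 *\<^sub>R x) + v 2 (1 *\<^sub>R x))" for x
  have "continuous_on S w" using v B0 unfolding w_def by (auto intro!: continuous_intros)
  moreover have "viscosity_subsolution \<epsilon> (Hamiltonian p f) S C w"
    unfolding viscosity_subsolution_iff_superjet[OF S \<epsilon>] Hamiltonian_def
  proof (intro ballI allI impI)
    fix x q X assume x: "x \<in> S" and j: "superjet w x q X"
    have "superjet (\<lambda>x. v 1 x + v 2 x) x (B *\<^sub>R q) (\<lambda>h. B *\<^sub>R X h)"
      using superjet_scale[where m=1 and a="1/B" and u="\<lambda>x. v 1 x + v 2 x", OF j[unfolded w_def]] B0 by simp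
    then have *: "Q \<bullet> (B *\<^sub>R q) - \<epsilon> * op_trace (\<lambda>h. B *\<^sub>R X h) \<le> G Q 1 x + G Q 2 x" for Q
      using sum x unfolding drift_subsolution_def by blast
    obtain Q where Q: "Q \<bullet> q - conj_power p Q = norm q powr p" using conj_power_attained[OF p] .
    have "G Q 1 x + G Q 2 x = s 1 * (c 1 + f ((1 / b 1) *\<^sub>R x)) + s 2 * (c 2 + f ((1 / b 2) *\<^sub>R x)) + B * conj_power p Q"
      unfolding G_def B by (simp add: algebra_simps)
    also have "s 1 * (c 1 + f ((1 / b 1) *\<^sub>R x)) + s 2 * (c 2 + f ((1 / b 2) *\<^sub>R x)) \<le> B * (C + f x)"
      using le[OF x] B0 by (simp add: field_simps)
    finally have "B * (Q \<bullet> q - \<epsilon> * op_trace X) \<le> B * (C + f x + conj_power p Q)"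
      using *[of Q] by (simp add: op_trace_simps algebra_simps)
    then show "norm q powr p - f x - \<epsilon> * op_trace X \<le> C"
      using B0 Q by simp
  qed
  ultimately show ?thesis unfolding admissible_def by blast
qed

section \<open>Interior estimates\<close>

text \<open>Used at \<open>t = |x - y|^2\<close>. With the \<beta> chosen below, the power is a cusp
  in \<open>|x - y|\<close> of exponent between zero and one, steep enough near the centre for the
  gradient term to win. The logarithm blows up at \<open>t = T\<close>, which keeps maxima away from
  the boundary whatever the size of the subsolution.\<close>

definition barrier :: "real \<Rightarrow> real \<Rightarrow> real \<Rightarrow> real \<Rightarrow> real" where
  "barrier \<beta> T K t = K * (t powr \<beta> / \<beta> - ln (1 - t / T))"

lemma barrier_derivative:
  assumes "\<beta> \<noteq> 0" "T > 0" "0 < t" "t < T"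
  shows "(barrier \<beta> T K has_real_derivative K * (t powr (\<beta> - 1) + 1 / (T - t))) (at t)"
    and "((\<lambda>t. K * (t powr (\<beta> - 1) + 1 / (T - t))) has_real_derivative
      K * ((\<beta> - 1) * t powr (\<beta> - 2) + 1 / (T - t)\<^sup>2)) (at t)"
proof -
  have pos: "1 - t / T > 0" using assms by simp
  have e: "(1 - t / T) * T = T - t" using assms by (simp add: left_diff_distrib)
  have 1: "((\<lambda>t. t powr \<beta> / \<beta>) has_real_derivative t powr (\<beta> - 1)) (at t)"
    using DERIV_cdivide[OF has_real_derivative_powr[OF assms(3), of \<beta>], of \<beta>] assms by simp
  have "((\<lambda>t. ln (1 - t / T)) has_real_derivative inverse (1 - t / T) * (0 - 1 / T)) (at t)"
    by (rule DERIV_chain2[where f=ln and g="\<lambda>t. 1 - t / T", OF DERIV_ln[OF pos]])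
      (use assms in \<open>auto intro!: derivative_eq_intros\<close>)
  then have 2: "((\<lambda>t. ln (1 - t / T)) has_real_derivative - (1 / (T - t))) (at t)"
    by (simp add: e[symmetric] divide_inverse del: right_diff_distrib)
  show "(barrier \<beta> T K has_real_derivative K * (t powr (\<beta> - 1) + 1 / (T - t))) (at t)"
    unfolding barrier_def[abs_def] using DERIV_cmult[OF DERIV_diff[OF 1 2], of K] by simp
  have 3: "((\<lambda>t. 1 / (T - t)) has_real_derivative 1 / (T - t)\<^sup>2) (at t)"
  proof -
    have d: "((\<lambda>t. T - t) has_real_derivative (0 - 1)) (at t)"
      by (rule DERIV_diff[OF DERIV_const DERIV_ident])
    have "((\<lambda>t. inverse (T - t)) has_real_derivative - (inverse (T - t) * (0 - 1) * inverse (T - t))) (at t)"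
      by (rule DERIV_inverse'[OF d]) (use assms in simp)
    then show ?thesis by (simp add: divide_inverse power_inverse power2_eq_square)
  qed
  show "((\<lambda>t. K * (t powr (\<beta> - 1) + 1 / (T - t))) has_real_derivative
      K * ((\<beta> - 1) * t powr (\<beta> - 2) + 1 / (T - t)\<^sup>2)) (at t)"
    using DERIV_cmult[OF DERIV_add[OF has_real_derivative_powr[OF assms(3), of "\<beta> - 1"] 3], of K]
    unfolding diff_diff_eq one_add_one .
qed

text \<open>With \<open>\<rho> = sqrt t\<close>, \<open>A = \<rho> t powr (\<beta> - 1)\<close> and \<open>D = \<rho> / (T - t)\<close>, the exponent \<open>\<beta>\<close> is chosen
  such that \<open>1 / \<rho> = A powr (p - 1)\<close>. Since \<open>A \<ge> 1\<close>, every term is then bounded by a multiple of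
  \<open>(A + D) powr p\<close>.\<close>

lemma barrier_inequality:
  fixes n :: nat and \<epsilon> p C T t \<beta> K G1 G2 :: real
  assumes p: "p > 2" and \<epsilon>: "\<epsilon> > 0" and C: "C \<ge> 0" and T: "T \<le> 1" and t: "0 < t" "t < T"
    and \<beta>: "\<beta> = (p - 2) / (2 * (p - 1))" and K: "K = 1 + (2 * n + 4) * \<epsilon> + C"
    and G1: "G1 = K * (t powr (\<beta> - 1) + 1 / (T - t))"
    and G2: "G2 = K * ((\<beta> - 1) * t powr (\<beta> - 2) + 1 / (T - t)\<^sup>2)"
  shows "C < (2 * sqrt t * G1) powr p - \<epsilon> * (2 * n * G1 + 4 * t * G2)"
proof -
  define \<rho> where "\<rho> = sqrt t"
  define A where "A = \<rho> * t powr (\<beta> - 1)"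
  define D where "D = \<rho> / (T - t)"
  define H where "H = A + D"
  have \<rho>: "0 < \<rho>" "\<rho> \<le> 1" "\<rho>\<^sup>2 = t" using t T by (auto simp: \<rho>_def)
  have K1: "K \<ge> 1" using C \<epsilon> by (simp add: K)
  have A_eq: "A = \<rho> powr (- 1 / (p - 1))"
  proof -
    have "t = \<rho> powr 2" using \<rho> by simp
    then have "t powr (\<beta> - 1) = \<rho> powr (2 * (\<beta> - 1))" by (simp only: powr_powr)
    then have "A = \<rho> powr 1 * \<rho> powr (2 * (\<beta> - 1))"
      by (simp only: A_def powr_one[OF less_imp_le[OF \<rho>(1)]])
    also have "\<dots> = \<rho> powr (1 + 2 * (\<beta> - 1))" by (rule powr_add[symmetric])
    also have "1 + 2 * (\<beta> - 1) = - 1 / (p - 1)"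
    proof -
      have "2 * \<beta> = (p - 2) / (p - 1)"
        unfolding \<beta> times_divide_eq_right by (rule mult_divide_mult_cancel_left) simp
      also have "\<dots> = 1 - 1 / (p - 1)" using p by (simp add: divide_simps)
      finally show ?thesis by simp
    qed
    finally show ?thesis .
  qed
  have A1: "A \<ge> 1"
  proof -
    have "\<rho> powr 0 \<le> \<rho> powr (- 1 / (p - 1))" using \<rho> p by (intro powr_mono') auto
    then show ?thesis using A_eq \<rho> by simp
  qed
  have D0: "D > 0" using \<rho> t by (simp add: D_def)
  have H: "H \<ge> A" "H \<ge> D" "H \<ge> 1" using A1 D0 by (auto simp: H_def)
  have Hp: "H powr p \<ge> 1" using H p by (simp add: ge_one_powr_ge_zero)
  have rG: "\<rho> * G1 = K * H" by (simp add: G1 H_def A_def D_def algebra_simps)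
  have "A powr (p - 1) = \<rho> powr (- 1)" unfolding A_eq powr_powr using p by simp
  then have "1 / \<rho> = A powr (p - 1)" using \<rho>(1) by (simp add: powr_minus_divide)
  also have "\<dots> \<le> H powr (p - 1)" using H p A1 by (intro powr_mono2) auto
  finally have "H * (1 / \<rho>) \<le> H * H powr (p - 1)" using H by (intro mult_left_mono) auto
  also have "\<dots> = H powr p" using H powr_add[of H 1 "p - 1"] by simp
  finally have b1: "H * (1 / \<rho>) \<le> H powr p" .
  have G1_eq: "G1 = K * (H * (1 / \<rho>))" using rG \<rho> by (simp add: field_simps)
  have G1b: "G1 \<le> K * H powr p" unfolding G1_eq by (rule mult_left_mono[OF b1]) (use K1 in simp)
  \<comment> \<open>The power contributes negatively to the second derivative and is dropped; only
    the logarithm has to be paid for.\<close>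
  have "\<beta> < 1" using p by (simp add: \<beta> field_simps)
  then have "(\<beta> - 1) * t powr (\<beta> - 2) \<le> 0" by (intro mult_nonpos_nonneg) auto
  then have "t * G2 \<le> t * (K * (1 / (T - t)\<^sup>2))"
    unfolding G2 using t K1 by (intro mult_left_mono) auto
  also have "\<dots> = K * D\<^sup>2" using \<rho>(3) by (simp add: D_def power_divide)
  also have "\<dots> \<le> K * H\<^sup>2" using H D0 K1 by (intro mult_left_mono power_mono) auto
  also have "H\<^sup>2 = H powr 2" using H by (simp add: powr_realpow)
  also have "K * \<dots> \<le> K * H powr p" using H p K1 by (intro mult_left_mono powr_mono) auto
  finally have G2b: "t * G2 \<le> K * H powr p" .
  have "\<epsilon> * (2 * n * G1 + 4 * t * G2) \<le> \<epsilon> * (2 * n * (K * H powr p) + 4 * (K * H powr p))"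
  proof (rule mult_left_mono)
    have "2 * n * G1 \<le> 2 * n * (K * H powr p)" by (rule mult_left_mono[OF G1b]) simp
    moreover have "4 * t * G2 = 4 * (t * G2)" by simp
    ultimately show "2 * n * G1 + 4 * t * G2 \<le> 2 * n * (K * H powr p) + 4 * (K * H powr p)"
      using G2b by linarith
  qed (use \<epsilon> in simp)
  also have "\<dots> = ((2 * n + 4) * \<epsilon> * K) * H powr p" by (simp add: algebra_simps)
  finally have 1: "\<epsilon> * (2 * n * G1 + 4 * t * G2) \<le> ((2 * n + 4) * \<epsilon> * K) * H powr p" .
  have 2: "C \<le> C * H powr p" using C Hp by (simp add: mult_le_cancel_left1)
  \<comment> \<open>The gradient term is at least of order \<open>K\<^sup>2\<close> because
    \<open>p > 2\<close>, while the diffusion is linear in \<open>K\<close>. The constant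
    \<open>K\<close> is chosen for this comparison.\<close>
  have "(2 * n + 4) * \<epsilon> * K + C < K\<^sup>2"
  proof -
    have "C \<le> C * K" using C K1 by (simp add: mult_le_cancel_left1)
    moreover have "((2 * n + 4) * \<epsilon> + C + 1) * K = (2 * n + 4) * \<epsilon> * K + C * K + K"
      by (simp add: algebra_simps)
    ultimately have "(2 * n + 4) * \<epsilon> * K + C < ((2 * n + 4) * \<epsilon> + C + 1) * K"
      using K1 by linarith
    also have "(2 * n + 4) * \<epsilon> + C + 1 = K" by (simp add: K)
    also have "K * K = K\<^sup>2" by (simp add: power2_eq_square)
    finally show ?thesis .
  qed
  also have "\<dots> = K powr 2" using K1 by (simp add: powr_realpow)
  also have "\<dots> \<le> K powr p" using K1 p by (intro powr_mono) auto
  also have "\<dots> \<le> (2 * K) powr p" using K1 p by (intro powr_mono2) auto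
  finally have "((2 * n + 4) * \<epsilon> * K + C) * H powr p < (2 * K) powr p * H powr p"
    using Hp by (intro mult_strict_right_mono) auto
  also have "\<dots> = (2 * sqrt t * G1) powr p"
    using rG H K1 powr_mult[of "2 * K" H p] by (simp add: \<rho>_def mult.assoc)
  finally show ?thesis using 1 2 by (simp add: distrib_right)
qed

text \<open>The equation with \<open>f\<close> and \<open>c\<close> absorbed into one constant, so
  that the estimates are uniform over a family of subsolutions.\<close>

definition gradient_bounded :: "real \<Rightarrow> real \<Rightarrow> 'a::euclidean_space set \<Rightarrow> real \<Rightarrow> ('a \<Rightarrow> real) \<Rightarrow> bool" where
  "gradient_bounded \<epsilon> p S C u \<longleftrightarrow> continuous_on S u \<and>
    (\<forall>x\<in>S. \<forall>q X. superjet u x q X \<longrightarrow> norm q powr p - \<epsilon> * op_trace X \<le> C)"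

lemma barrier_continuous:
  assumes "\<beta> > 0" "T > 0"
  shows "continuous_on {0..<T} (barrier \<beta> T K)"
  unfolding barrier_def[abs_def] using assms
  by (intro continuous_intros continuous_on_powr') auto

text \<open>The maximum of \<open>u\<close> minus the barrier centred at \<open>y\<close> is taken
  over a closed ball slightly smaller than \<open>cball y R\<close>. The logarithm excludes the
  boundary, and \<open>barrier_inequality\<close> excludes every interior point except
  \<open>y\<close>, where the barrier vanishes but is not smooth. So the maximum is at
  \<open>y\<close>.\<close>

lemma barrier_estimate:
  fixes u :: "'a::euclidean_space \<Rightarrow> real" and \<epsilon> C :: real
  assumes p: "p > 2" and \<epsilon>: "\<epsilon> > 0" and C: "C \<ge> 0" and R: "0 < R" "R \<le> 1"
    and sub: "cball y R \<subseteq> S" and u: "gradient_bounded \<epsilon> p S C u" and x: "x \<in> ball y R"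
  shows "u x \<le> u y + barrier ((p - 2) / (2 * (p - 1))) (R\<^sup>2) (1 + (2 * DIM('a) + 4) * \<epsilon> + C) ((norm (x - y))\<^sup>2)"
proof -
  define \<beta> where "\<beta> = (p - 2) / (2 * (p - 1))"
  define K where "K = 1 + (2 * DIM('a) + 4) * \<epsilon> + C"
  define T where "T = R\<^sup>2"
  define G where "G = barrier \<beta> T K"
  define G1 where "G1 t = K * (t powr (\<beta> - 1) + 1 / (T - t))" for t
  define G2 where "G2 t = K * ((\<beta> - 1) * t powr (\<beta> - 2) + 1 / (T - t)\<^sup>2)" for t
  have \<beta>: "\<beta> > 0" using p by (simp add: \<beta>_def)
  have K: "K \<ge> 1" using C \<epsilon> by (simp add: K_def)
  have T: "T > 0" "T \<le> 1" using R by (auto simp: T_def power_le_one)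
  have cu: "continuous_on S u" using u by (simp add: gradient_bounded_def)
  obtain M where M: "\<And>w. w \<in> cball y R \<Longrightarrow> u w \<le> M"
    using continuous_attains_sup[OF compact_cball _ continuous_on_subset[OF cu sub]] R by fastforce
  \<comment> \<open>At \<open>t1\<close> the term \<open>- ln (1 - t / T)\<close> equals
    \<open>\<bar>M - u y\<bar> + 1\<close>, more than \<open>u\<close> can rise above
    \<open>u y\<close>.\<close>
  define t1 where "t1 = T * (1 - exp (- (\<bar>M - u y\<bar> + 1)))"
  have t1: "t1 < T" using T by (simp add: t1_def)
  define t2 where "t2 = max t1 ((norm (x - y))\<^sup>2)"
  have xn: "norm (x - y) < R" using x by (simp add: dist_norm norm_minus_commute)
  then have "(norm (x - y))\<^sup>2 < T" unfolding T_def by (intro power_strict_mono) auto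
  then have t2: "t2 < T" using t1 by (simp add: t2_def)
  \<comment> \<open>Beyond \<open>t1\<close> and beyond the squared distance of \<open>x\<close>,
    but still below \<open>T\<close>, where the barrier is finite.\<close>
  define t3 where "t3 = (t2 + T) / 2"
  have t3: "t2 < t3" "t3 < T" "t3 > 0"
    using t2 by (auto simp: t3_def t2_def) (meson T(1) add_nonneg_pos less_eq_real_def max.coboundedI2 zero_le_power2)
  define r where "r = sqrt t3"
  have r2: "r\<^sup>2 = t3" "r > 0" using t3 by (auto simp: r_def)
  have rR: "r < R" using t3(2) r2 R unfolding T_def by (metis power_less_imp_less_base less_eq_real_def)
  have xr: "norm (x - y) < r"
  proof -
    have "(norm (x - y))\<^sup>2 < r\<^sup>2" using t3(1) by (simp add: r2 t2_def)
    then show ?thesis using r2(2) by (simp add: power_less_imp_less_base)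
  qed
  have Gr: "G t3 > M - u y"
  proof -
    have "t1 < t3" using t3(1) by (simp add: t2_def)
    then have "1 - t3 / T < 1 - t1 / T" using T by (simp add: divide_strict_right_mono)
    also have "\<dots> = exp (- (\<bar>M - u y\<bar> + 1))" using T by (simp add: t1_def)
    finally have "ln (1 - t3 / T) < - (\<bar>M - u y\<bar> + 1)"
      using t3 T by (metis diff_gt_0_iff_gt divide_less_eq_1_pos ln_exp ln_less_cancel_iff exp_gt_zero)
    moreover have "t3 powr \<beta> / \<beta> \<ge> 0" using \<beta> by simp
    ultimately have "\<bar>M - u y\<bar> + 1 < t3 powr \<beta> / \<beta> - ln (1 - t3 / T)" by linarith
    also have "\<dots> \<le> G t3" unfolding G_def barrier_def
      using K calculation by (simp add: mult_le_cancel_right1)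
    finally show ?thesis by linarith
  qed
  define \<phi> where "\<phi> w = G ((norm (w - y))\<^sup>2)" for w
  have "continuous_on (cball y r) \<phi>"
    unfolding \<phi>_def[abs_def] G_def
  proof (rule continuous_on_compose2[OF barrier_continuous[OF \<beta> T(1)]])
    show "(\<lambda>w. (norm (w - y))\<^sup>2) ` cball y r \<subseteq> {0..<T}"
      using rR by (auto simp: T_def dist_norm norm_minus_commute intro!: power_strict_mono)
  qed (intro continuous_intros)
  moreover have "cball y r \<subseteq> S" using sub rR by (meson cball_subset_cball_iff less_eq_real_def order_trans subset_cball)
  ultimately have "continuous_on (cball y r) (\<lambda>w. u w - \<phi> w)"
    using cu by (intro continuous_intros) (auto intro: continuous_on_subset)
  then obtain z where z: "z \<in> cball y r" "\<And>w. w \<in> cball y r \<Longrightarrow> u w - \<phi> w \<le> u z - \<phi> z"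
    using continuous_attains_sup[of "cball y r" "\<lambda>w. u w - \<phi> w"] r2 by auto
  have \<phi>y: "\<phi> y = 0" by (simp add: \<phi>_def G_def barrier_def)
  have "norm (z - y) \<noteq> r"
  proof
    assume "norm (z - y) = r"
    then have "\<phi> z = G t3" by (simp add: \<phi>_def r2)
    moreover have "u z \<le> M" using z(1) rR by (intro M) auto
    ultimately show False using z(2)[of y] Gr \<phi>y r2 by auto
  qed
  then have zr: "norm (z - y) < r" using z(1) by (simp add: dist_norm norm_minus_commute)
  have "z = y"
  proof (rule ccontr)
    assume "z \<noteq> y"
    define t where "t = (norm (z - y))\<^sup>2"
    have "t < t3" unfolding t_def r2(1)[symmetric] using zr by (intro power_strict_mono) auto
    then have t: "0 < t" "t < T" using \<open>z \<noteq> y\<close> t3 by (auto simp: t_def)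
    have N: "((\<lambda>w. (norm (w - y))\<^sup>2) has_derivative (\<lambda>h. 2 * ((w - y) \<bullet> h))) (at w)" for w
      unfolding power2_norm_eq_inner by (auto intro!: derivative_eq_intros simp: inner_commute)
    let ?D = "\<lambda>w. (2 * G1 ((norm (w - y))\<^sup>2)) *\<^sub>R (w - y)"
    let ?X = "\<lambda>h. (2 * G1 t) *\<^sub>R h + (4 * G2 t) *\<^sub>R (((z - y) \<bullet> h) *\<^sub>R (z - y))"
    have D: "(\<phi> has_derivative (\<lambda>h. ?D w \<bullet> h)) (at w)" if "0 < (norm (w - y))\<^sup>2" "(norm (w - y))\<^sup>2 < T" for w
      unfolding \<phi>_def[abs_def]
    proof (rule has_derivative_eq_rhs[OF has_derivative_compose[OF N]])
      show "(G has_derivative (\<lambda>h. G1 ((norm (w - y))\<^sup>2) * h)) (at ((norm (w - y))\<^sup>2))"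
        unfolding G_def G1_def using barrier_derivative(1)[OF _ T(1) that, of \<beta> K] \<beta>
        by (simp add: has_field_derivative_def)
    qed (simp add: fun_eq_iff)
    have "((\<lambda>w. G1 ((norm (w - y))\<^sup>2)) has_derivative (\<lambda>h. G2 t * (2 * ((z - y) \<bullet> h)))) (at z)"
    proof (rule has_derivative_compose[OF N])
      show "(G1 has_derivative (\<lambda>h. G2 t * h)) (at ((norm (z - y))\<^sup>2))"
        unfolding G1_def[abs_def] G2_def t_def[symmetric]
        using barrier_derivative(2)[OF _ T(1) t, of \<beta> K] \<beta> by (simp add: has_field_derivative_def)
    qed
    then have X: "(?D has_derivative ?X) (at z)"
      by (auto intro!: derivative_eq_intros simp: t_def algebra_simps)
    have lim: "((\<lambda>w. (norm (w - y))\<^sup>2) \<longlongrightarrow> (norm (z - y))\<^sup>2) (nhds z)"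
      by (intro tendsto_intros filterlim_ident)
    have ev: "\<forall>\<^sub>F w in nhds z. 0 < (norm (w - y))\<^sup>2 \<and> (norm (w - y))\<^sup>2 < T"
      by (rule eventually_conj[OF order_tendstoD(1)[OF lim] order_tendstoD(2)[OF lim]])
        (use t in \<open>simp_all add: t_def\<close>)
    have "jet \<phi> z (?D z) ?X"
      by (rule jetI[OF _ X], rule eventually_mono[OF ev], rule D) auto
    moreover have "\<forall>\<^sub>F w in nhds z. u w - \<phi> w \<le> u z - \<phi> z"
    proof -
      have "z \<in> ball y r" using zr by (simp add: dist_norm norm_minus_commute)
      from eventually_nhds_in_open[OF open_ball this] show ?thesis
        by eventually_elim (use z(2) in auto)
    qed
    ultimately have "superjet u z (?D z) ?X" by (rule jet_imp_superjet)
    moreover have "z \<in> S" using z(1) \<open>cball y r \<subseteq> S\<close> by blast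
    ultimately have "norm (?D z) powr p - \<epsilon> * op_trace ?X \<le> C"
      using u unfolding gradient_bounded_def by blast
    moreover have "op_trace ?X = 2 * DIM('a) * G1 t + 4 * t * G2 t"
      unfolding op_trace_simps op_trace_rank_one by (simp add: t_def power2_norm_eq_inner)
    moreover have "G1 t \<ge> 0" using t K by (simp add: G1_def)
    then have "norm (?D z) = 2 * sqrt t * G1 t" by (simp add: t_def)
    moreover have "C < (2 * sqrt t * G1 t) powr p - \<epsilon> * (2 * DIM('a) * G1 t + 4 * t * G2 t)"
      by (rule barrier_inequality[OF p \<epsilon> C T(2) t \<beta>_def K_def G1_def G2_def])
    ultimately show False by simp
  qed
  then have "u x - \<phi> x \<le> u y - \<phi> y" using z(2)[of x] xr by (simp add: dist_norm norm_minus_commute)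
  then show ?thesis using \<phi>y by (simp add: \<phi>_def G_def \<beta>_def T_def K_def)
qed

text \<open>The barrier depends on \<open>u\<close> only through \<open>C\<close>, so one \<delta>
  serves all subsolutions. The estimate is one-sided and is used twice, centred at \<open>x\<close>
  and at \<open>y\<close>.\<close>

lemma gradient_bounded_equicontinuous:
  fixes x :: "'a::euclidean_space"
  assumes p: "p > 2" and \<epsilon>: "\<epsilon> > 0" and C: "C \<ge> 0" and S: "open S" and x: "x \<in> S" and \<eta>: "\<eta> > 0"
  obtains \<delta> where "\<delta> > 0" "ball x \<delta> \<subseteq> S"
    "\<And>u y. gradient_bounded \<epsilon> p S C u \<Longrightarrow> y \<in> ball x \<delta> \<Longrightarrow> \<bar>u y - u x\<bar> < \<eta>"
proof -
  obtain r where r: "r > 0" "cball x r \<subseteq> S" using S x open_contains_cball by blast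
  \<comment> \<open>Half of the radius, so that the balls of radius \<open>R\<close> about
    \<open>x\<close> and about a nearby \<open>y\<close> both lie in \<open>S\<close>.\<close>
  define R where "R = min 1 (r / 2)"
  have R: "0 < R" "R \<le> 1" "2 * R \<le> r" using r by (auto simp: R_def)
  let ?G = "barrier ((p - 2) / (2 * (p - 1))) (R\<^sup>2) (1 + (2 * DIM('a) + 4) * \<epsilon> + C)"
  have "continuous_on {0..<R\<^sup>2} ?G" using p R by (intro barrier_continuous) auto
  moreover have "(0::real) \<in> {0..<R\<^sup>2}" using R by simp
  moreover have "?G 0 = 0" by (simp add: barrier_def)
  ultimately obtain d where d: "d > 0" "\<And>t. t \<in> {0..<R\<^sup>2} \<Longrightarrow> \<bar>t\<bar> < d \<Longrightarrow> \<bar>?G t\<bar> < \<eta>"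
    using \<eta> unfolding continuous_on_iff by (metis dist_0_norm dist_commute real_norm_def)
  define \<delta> where "\<delta> = min R (sqrt d)"
  show ?thesis
  proof (rule that)
    show "\<delta> > 0" using R d by (simp add: \<delta>_def)
    have "\<delta> \<le> r" using R by (simp add: \<delta>_def)
    then show "ball x \<delta> \<subseteq> S" using r by (meson ball_subset_cball order_trans subset_cball)
    fix u y assume u: "gradient_bounded \<epsilon> p S C u" and y: "y \<in> ball x \<delta>"
    have n: "norm (y - x) < R" "norm (y - x) < sqrt d" using y by (auto simp: \<delta>_def dist_norm norm_minus_commute)
    have "(norm (y - x))\<^sup>2 < R\<^sup>2" using n by (intro power_strict_mono) auto
    moreover have "(norm (y - x))\<^sup>2 < (sqrt d)\<^sup>2" using n by (intro power_strict_mono) auto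
    ultimately have G: "\<bar>?G ((norm (y - x))\<^sup>2)\<bar> < \<eta>" using d by (intro d(2)) auto
    have "R \<le> r" using R by linarith
    then have xR: "cball x R \<subseteq> S" using r subset_cball by blast
    have yR: "cball y R \<subseteq> S"
    proof
      fix w assume "w \<in> cball y R"
      then have "dist x w \<le> r" using dist_triangle[of x w y] n R by (auto simp: dist_norm norm_minus_commute)
      then show "w \<in> S" using r by auto
    qed
    have "y \<in> ball x R" "x \<in> ball y R" using n by (auto simp: dist_norm norm_minus_commute)
    from barrier_estimate[OF p \<epsilon> C R(1,2) xR u this(1)] barrier_estimate[OF p \<epsilon> C R(1,2) yR u this(2)]
    show "\<bar>u y - u x\<bar> < \<eta>" using G unfolding norm_minus_commute[of x y] by linarith
  qed
qed

section \<open>Admissible constants\<close>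

lemma superjet_diff_const: "superjet (\<lambda>x. u x - k) x q X \<longleftrightarrow> superjet u x q X"
proof -
  have "(u y - k \<le> u x - k + a + b + c) \<longleftrightarrow> (u y \<le> u x + a + b + c)" for y a b c by linarith
  then show ?thesis by (simp only: superjet_def)
qed

text \<open>Adding a constant changes no superjet, so solutions may be normalized; a sequence of
  solutions is then bounded at one point.\<close>

lemma admissible_iff:
  assumes S: "open S" and \<epsilon>: "\<epsilon> > 0"
  shows "admissible \<epsilon> p f S c \<longleftrightarrow> (\<exists>u. continuous_on S u \<and> u a = 0 \<and>
    (\<forall>x\<in>S. \<forall>q X. superjet u x q X \<longrightarrow> norm q powr p - f x - \<epsilon> * op_trace X \<le> c))"
proof
  assume "admissible \<epsilon> p f S c"
  then obtain u where "continuous_on S u"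
    "\<forall>x\<in>S. \<forall>q X. superjet u x q X \<longrightarrow> norm q powr p - f x - \<epsilon> * op_trace X \<le> c"
    unfolding admissible_def viscosity_subsolution_iff_superjet[OF S \<epsilon>] Hamiltonian_def by blast
  then show "\<exists>u. continuous_on S u \<and> u a = 0 \<and>
    (\<forall>x\<in>S. \<forall>q X. superjet u x q X \<longrightarrow> norm q powr p - f x - \<epsilon> * op_trace X \<le> c)"
    by (intro exI[of _ "\<lambda>x. u x - u a"]) (auto simp: superjet_diff_const intro!: continuous_intros)
qed (auto simp: admissible_def viscosity_subsolution_iff_superjet[OF S \<epsilon>] Hamiltonian_def)

lemma admissible_const:
  assumes S: "open S" and \<epsilon>: "\<epsilon> > 0" and c: "\<And>x. x \<in> S \<Longrightarrow> - f x \<le> c"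
  shows "admissible \<epsilon> p f S c"
  unfolding admissible_iff[OF S \<epsilon>, of _ _ _ 0]
proof (intro exI[of _ "\<lambda>_. 0"] conjI ballI allI impI)
  fix x q X assume "x \<in> S" and j: "superjet (\<lambda>_. 0) x q X"
  then have "\<epsilon> * op_trace X \<ge> 0" using superjet_const(2)[OF j] \<epsilon> by simp
  then show "norm q powr p - f x - \<epsilon> * op_trace X \<le> c"
    using superjet_const(1)[OF j] c[OF \<open>x \<in> S\<close>] by simp
qed auto

text \<open>If \<open>c + F\<close> is not positive, \<open>u\<close> is gradient bounded with
  constant zero, so it rises by at most \<open>m\<close> on a fixed sphere. A paraboloid steeper
  than that touches \<open>u\<close> from above inside the sphere, where the equation bounds
  \<open>c\<close> from below. The bound is fixed before \<open>S\<close>, hence uniform over the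
  dilates of \<Omega>.\<close>

lemma admissible_lower_bound:
  fixes f :: "'a::euclidean_space \<Rightarrow> real"
  assumes p: "p > 2" and \<epsilon>: "\<epsilon> > 0" and r: "r > 0"
  obtains N where "N \<ge> 0" "\<And>S c F. open S \<Longrightarrow> cball 0 r \<subseteq> S \<Longrightarrow> (\<And>x. x \<in> S \<Longrightarrow> f x \<le> F) \<Longrightarrow>
    admissible \<epsilon> p f S c \<Longrightarrow> - F - N \<le> c"
proof -
  define R where "R = min 1 r"
  have R: "0 < R" "R \<le> 1" "R \<le> r" using r by (auto simp: R_def)
  define m where "m = barrier ((p - 2) / (2 * (p - 1))) (R\<^sup>2) (1 + (2 * DIM('a) + 4) * \<epsilon> + 0) ((R / 2)\<^sup>2)"
  \<comment> \<open>At radius \<open>R / 2\<close> the paraboloid equals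
    \<open>\<bar>m\<bar> + 1\<close>, more than \<open>u\<close> can rise.\<close>
  define N where "N = (\<bar>m\<bar> + 1) / (R / 2)\<^sup>2"
  have N: "N \<ge> 0" by (simp add: N_def)
  show ?thesis
  proof (rule that)
    show "0 \<le> \<epsilon> * (2 * N * DIM('a))" using N \<epsilon> by simp
    fix S c F assume S: "open S" and sub: "cball (0::'a) r \<subseteq> S" and F: "\<And>x. x \<in> S \<Longrightarrow> f x \<le> F"
      and "admissible \<epsilon> p f S c"
    then obtain u where u: "continuous_on S u"
      "\<And>x q X. x \<in> S \<Longrightarrow> superjet u x q X \<Longrightarrow> norm q powr p - f x - \<epsilon> * op_trace X \<le> c"
      unfolding admissible_iff[OF S \<epsilon>, of _ _ _ 0] by blast
    show "- F - \<epsilon> * (2 * N * DIM('a)) \<le> c"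
    proof (cases "c + F \<le> 0")
      case False then show ?thesis using \<open>0 \<le> \<epsilon> * (2 * N * DIM('a))\<close> by linarith
    next
      case True
      have "norm q powr p - \<epsilon> * op_trace X \<le> 0" if "x \<in> S" "superjet u x q X" for x q X
        using u(2)[OF that] F[OF that(1)] True by linarith
      then have gb: "gradient_bounded \<epsilon> p S 0 u" using u(1) unfolding gradient_bounded_def by blast
      have sR: "cball 0 R \<subseteq> S" using sub R(3) subset_cball by blast
      have sR2: "cball 0 (R / 2) \<subseteq> S" using sR R(1) subset_cball[of "R / 2" R 0] by auto
      have bd: "u x \<le> u 0 + m" if "norm x = R / 2" for x
        using barrier_estimate[OF p \<epsilon> _ R(1,2) sR gb, of x] that R(1) by (simp add: m_def)
      have "continuous_on (cball 0 (R / 2)) (\<lambda>x. u x - N * (norm x)\<^sup>2)"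
        by (intro continuous_intros continuous_on_subset[OF u(1) sR2])
      then obtain z where z: "z \<in> cball 0 (R / 2)"
        "\<And>w. w \<in> cball 0 (R / 2) \<Longrightarrow> u w - N * (norm w)\<^sup>2 \<le> u z - N * (norm z)\<^sup>2"
        using continuous_attains_sup[of "cball 0 (R / 2)" "\<lambda>x. u x - N * (norm x)\<^sup>2"] R(1) by auto
      have "norm z \<noteq> R / 2"
      proof
        assume nz: "norm z = R / 2"
        have "u 0 \<le> u z - N * (R / 2)\<^sup>2" using z(2)[of 0] R(1) nz by simp
        also have "N * (R / 2)\<^sup>2 = \<bar>m\<bar> + 1" using R(1) by (simp add: N_def)
        finally show False using bd[OF nz] by linarith
      qed
      then have zb: "z \<in> ball 0 (R / 2)" using z(1) by simp
      have "jet (\<lambda>w. N * (norm w)\<^sup>2) z ((2 * N) *\<^sub>R z) (\<lambda>h. (2 * N) *\<^sub>R h)"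
        by (rule jetI) (auto intro!: derivative_eq_intros always_eventually
            simp: power2_norm_eq_inner inner_commute)
      moreover have "\<forall>\<^sub>F w in nhds z. u w - N * (norm w)\<^sup>2 \<le> u z - N * (norm z)\<^sup>2"
        using eventually_nhds_in_open[OF open_ball zb] by eventually_elim (use z(2) in auto)
      ultimately have "superjet u z ((2 * N) *\<^sub>R z) (\<lambda>h. (2 * N) *\<^sub>R h)" by (rule jet_imp_superjet)
      moreover have zS: "z \<in> S" using z(1) sR2 by blast
      ultimately have "norm ((2 * N) *\<^sub>R z) powr p - f z - \<epsilon> * op_trace (\<lambda>h::'a. (2 * N) *\<^sub>R h) \<le> c"
        by (intro u(2))
      then have "norm ((2 * N) *\<^sub>R z) powr p - f z - \<epsilon> * (2 * N * DIM('a)) \<le> c"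
        unfolding op_trace_simps .
      moreover have "norm ((2 * N) *\<^sub>R z) powr p \<ge> 0" by (rule powr_ge_zero)
      ultimately show ?thesis using F[OF zS] by linarith
    qed
  qed
qed

text \<open>The upper limit as a real number, characterized by the two properties that the limit
  argument uses.\<close>

lemma bounded_sequence_limsup:
  fixes a :: "nat \<Rightarrow> real"
  assumes "\<And>n. \<bar>a n\<bar> \<le> M"
  obtains L where "\<And>\<eta>. \<eta> > 0 \<Longrightarrow> \<forall>\<^sub>F n in sequentially. a n < L + \<eta>"
    "\<And>\<eta>. \<eta> > 0 \<Longrightarrow> \<exists>\<^sub>F n in sequentially. a n > L - \<eta>"
proof -
  let ?E = "{b. \<forall>\<^sub>F n in sequentially. a n < b}"
  have a: "- M \<le> a n" "a n \<le> M" for n using assms[of n] by (auto simp: abs_le_iff)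
  have ne: "M + 1 \<in> ?E" using a(2) by (auto intro!: always_eventually order.strict_trans1[OF a(2)])
  have bb: "bdd_below ?E"
  proof (rule bdd_belowI)
    fix b assume "b \<in> ?E"
    then obtain n where "a n < b" by (auto simp: eventually_sequentially)
    then show "- M \<le> b" using a(1)[of n] by linarith
  qed
  show ?thesis
  proof (rule that[of "Inf ?E"])
    fix \<eta> :: real assume \<eta>: "\<eta> > 0"
    then obtain b where "b \<in> ?E" "b < Inf ?E + \<eta>"
      using cInf_lessD[of ?E "Inf ?E + \<eta>"] ne by auto
    then show "\<forall>\<^sub>F n in sequentially. a n < Inf ?E + \<eta>" by (auto elim: eventually_mono)
    show "\<exists>\<^sub>F n in sequentially. a n > Inf ?E - \<eta>"
    proof (rule ccontr)
      assume "\<not> ?thesis"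
      then have "\<forall>\<^sub>F n in sequentially. a n \<le> Inf ?E - \<eta>" by (simp add: not_frequently not_less)
      then have "Inf ?E - \<eta> / 2 \<in> ?E" using \<eta> by (auto elim!: eventually_mono)
      then have "Inf ?E \<le> Inf ?E - \<eta> / 2" by (rule cInf_lower[OF _ bb])
      then show False using \<eta> by simp
    qed
  qed
qed

section \<open>The additive eigenvalue is attained\<close>

text \<open>The points where the sequence is bounded form a set that is open and closed in
  \<open>S\<close>, because near each point the sequence varies by less than one, uniformly in
  \<open>n\<close>.\<close>

lemma equicontinuous_pointwise_bounded:
  fixes u :: "nat \<Rightarrow> 'a::euclidean_space \<Rightarrow> real"
  assumes S: "open S" "connected S" and a: "a \<in> S" "\<And>n. u n a = 0" and x: "x \<in> S"
    and eq: "\<And>x \<eta>. x \<in> S \<Longrightarrow> \<eta> > 0 \<Longrightarrow> \<exists>\<delta>>0. ball x \<delta> \<subseteq> S \<and> (\<forall>n. \<forall>y\<in>ball x \<delta>. \<bar>u n y - u n x\<bar> < \<eta>)"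
  shows "\<exists>M. \<forall>n. \<bar>u n x\<bar> \<le> M"
proof -
  define bd where "bd x \<longleftrightarrow> (\<exists>M. \<forall>n. \<bar>u n x\<bar> \<le> M)" for x
  have near: "\<exists>\<delta>>0. ball x \<delta> \<subseteq> S \<and> (\<forall>y\<in>ball x \<delta>. bd y \<longleftrightarrow> bd x)" if x: "x \<in> S" for x
  proof -
    obtain \<delta> where \<delta>: "\<delta> > 0" "ball x \<delta> \<subseteq> S" "\<And>n y. y \<in> ball x \<delta> \<Longrightarrow> \<bar>u n y - u n x\<bar> < 1"
      using eq[OF x, of 1] by auto
    have "bd y \<longleftrightarrow> bd x" if y: "y \<in> ball x \<delta>" for y
    proof
      assume "bd y"
      then obtain M where M: "\<And>n. \<bar>u n y\<bar> \<le> M" unfolding bd_def by blast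
      have "\<bar>u n x\<bar> \<le> M + 1" for n using M[of n] \<delta>(3)[OF y, of n] by linarith
      then show "bd x" unfolding bd_def by blast
    next
      assume "bd x"
      then obtain M where M: "\<And>n. \<bar>u n x\<bar> \<le> M" unfolding bd_def by blast
      have "\<bar>u n y\<bar> \<le> M + 1" for n using M[of n] \<delta>(3)[OF y, of n] by linarith
      then show "bd y" unfolding bd_def by blast
    qed
    then show ?thesis using \<delta>(1,2) by blast
  qed
  have op: "open {x \<in> S. bd x = b}" for b
    unfolding open_contains_ball
  proof
    fix x assume x: "x \<in> {x \<in> S. bd x = b}"
    then have "x \<in> S" by simp
    from near[OF this] obtain \<delta> where \<delta>: "\<delta> > 0" "ball x \<delta> \<subseteq> S" "\<And>y. y \<in> ball x \<delta> \<Longrightarrow> bd y \<longleftrightarrow> bd x" by blast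
    have "ball x \<delta> \<subseteq> {x \<in> S. bd x = b}" using \<delta>(2,3) x by blast
    then show "\<exists>e>0. ball x e \<subseteq> {x \<in> S. bd x = b}" using \<delta>(1) by blast
  qed
  from op[of True] op[of False] have "open {x \<in> S. bd x}" "open {x \<in> S. \<not> bd x}" by simp_all
  moreover have "{x \<in> S. bd x} \<inter> {x \<in> S. \<not> bd x} \<inter> S = {}" "S \<subseteq> {x \<in> S. bd x} \<union> {x \<in> S. \<not> bd x}" by auto
  ultimately have "{x \<in> S. bd x} \<inter> S = {} \<or> {x \<in> S. \<not> bd x} \<inter> S = {}"
    using S(2) unfolding connected_def by blast
  moreover have "bd a" using a(2) unfolding bd_def by (auto intro!: exI[of _ 0])
  ultimately have "bd x" using a(1) x by blast
  then show ?thesis unfolding bd_def .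
qed

lemma quadratic_jet:
  fixes X :: "'a::euclidean_space \<Rightarrow> 'a"
  assumes X: "linear X"
  obtains Y where "jet (\<lambda>y. q \<bullet> (y - x) + (y - x) \<bullet> X (y - x) / 2) z
      (q + (1/2) *\<^sub>R (X (z - x) + adjoint X (z - x))) Y" "op_trace Y = op_trace X"
proof
  let ?Y = "\<lambda>h. (1/2) *\<^sub>R (X h + adjoint X h)"
  show "jet (\<lambda>y. q \<bullet> (y - x) + (y - x) \<bullet> X (y - x) / 2) z
      (q + (1/2) *\<^sub>R (X (z - x) + adjoint X (z - x))) ?Y"
    by (rule jetI[OF _ inner_operator_derivative(1)[OF X]], rule always_eventually, rule allI,
        rule inner_operator_derivative(2)[OF X])
  show "op_trace ?Y = op_trace X" unfolding op_trace_simps op_trace_adjoint[OF X] by simp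
qed

text \<open>The limit of the subsolutions is the pointwise upper limit, which spares the extraction of a
  convergent subsequence: by equicontinuity, the upper limit is continuous and the upper bounds hold
  uniformly on compact sets.\<close>

lemma admissible_limit:
  fixes f :: "'a::euclidean_space \<Rightarrow> real"
  assumes p: "p > 2" and \<epsilon>: "\<epsilon> > 0" and S: "open S" "connected S" and a: "a \<in> S"
    and f: "continuous_on S f" "\<And>x. x \<in> S \<Longrightarrow> f x \<le> F"
    and c: "\<And>n. admissible \<epsilon> p f S (c n)" "c \<longlonglongrightarrow> c0"
  shows "admissible \<epsilon> p f S c0"
proof -
  have "\<forall>n. \<exists>u. continuous_on S u \<and> u a = 0 \<and>
    (\<forall>x\<in>S. \<forall>q X. superjet u x q X \<longrightarrow> norm q powr p - f x - \<epsilon> * op_trace X \<le> c n)"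
    using c(1) unfolding admissible_iff[OF S(1) \<epsilon>, of _ _ _ a] by blast
  from choice[OF this] obtain u where u': "\<forall>n. continuous_on S (u n) \<and> u n a = 0 \<and>
    (\<forall>x\<in>S. \<forall>q X. superjet (u n) x q X \<longrightarrow> norm q powr p - f x - \<epsilon> * op_trace X \<le> c n)" by (rule exE)
  then have u: "\<And>n. continuous_on S (u n)" "\<And>n. u n a = 0"
    "\<And>n x q X. x \<in> S \<Longrightarrow> superjet (u n) x q X \<Longrightarrow> norm q powr p - f x - \<epsilon> * op_trace X \<le> c n" by simp_all
  obtain M where M: "\<And>n. \<bar>c n\<bar> \<le> M"
    using convergent_imp_Bseq[of c] c(2) unfolding convergent_def Bseq_def by (auto simp: real_norm_def)
  define C where "C = max 0 (M + F)"
  have gb: "gradient_bounded \<epsilon> p S C (u n)" for n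
  proof -
    have "norm q powr p - \<epsilon> * op_trace X \<le> C" if "x \<in> S" "superjet (u n) x q X" for x q X
      using u(3)[OF that] f(2)[OF that(1)] M[of n] by (simp add: C_def)
    then show ?thesis using u(1) by (auto simp: gradient_bounded_def)
  qed
  have eq: "\<exists>\<delta>>0. ball x \<delta> \<subseteq> S \<and> (\<forall>n. \<forall>y\<in>ball x \<delta>. \<bar>u n y - u n x\<bar> < \<eta>)" if "x \<in> S" "\<eta> > 0" for x \<eta>
  proof -
    have "C \<ge> 0" by (simp add: C_def)
    from gradient_bounded_equicontinuous[OF p \<epsilon> this S(1) that] obtain \<delta> where
      "\<delta> > 0" "ball x \<delta> \<subseteq> S" "\<And>u y. gradient_bounded \<epsilon> p S C u \<Longrightarrow> y \<in> ball x \<delta> \<Longrightarrow> \<bar>u y - u x\<bar> < \<eta>"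
      by blast
    then show ?thesis using gb by (intro exI[of _ \<delta>]) simp
  qed
  have "\<forall>x. \<exists>L. x \<in> S \<longrightarrow> (\<forall>\<eta>>0. (\<forall>\<^sub>F n in sequentially. u n x < L + \<eta>) \<and> (\<exists>\<^sub>F n in sequentially. u n x > L - \<eta>))"
  proof
    fix x show "\<exists>L. x \<in> S \<longrightarrow> (\<forall>\<eta>>0. (\<forall>\<^sub>F n in sequentially. u n x < L + \<eta>) \<and> (\<exists>\<^sub>F n in sequentially. u n x > L - \<eta>))"
    proof (cases "x \<in> S")
      case True
      from equicontinuous_pointwise_bounded[of S a u x, OF S a u(2) True eq]
      obtain M where M: "\<forall>n. \<bar>u n x\<bar> \<le> M" by (rule exE)
      obtain L where "\<And>\<eta>. \<eta> > 0 \<Longrightarrow> \<forall>\<^sub>F n in sequentially. u n x < L + \<eta>"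
        "\<And>\<eta>. \<eta> > 0 \<Longrightarrow> \<exists>\<^sub>F n in sequentially. u n x > L - \<eta>"
        using bounded_sequence_limsup[of "\<lambda>n. u n x" M] M by metis
      then show ?thesis by (intro exI[of _ L]) simp
    qed simp
  qed
  from choice[OF this] obtain L where L': "\<forall>x. x \<in> S \<longrightarrow> (\<forall>\<eta>>0. (\<forall>\<^sub>F n in sequentially. u n x < L x + \<eta>)
      \<and> (\<exists>\<^sub>F n in sequentially. u n x > L x - \<eta>))" by (rule exE)
  then have Lup: "\<And>x \<eta>. x \<in> S \<Longrightarrow> \<eta> > 0 \<Longrightarrow> \<forall>\<^sub>F n in sequentially. u n x < L x + \<eta>"
    and Llow: "\<And>x \<eta>. x \<in> S \<Longrightarrow> \<eta> > 0 \<Longrightarrow> \<exists>\<^sub>F n in sequentially. u n x > L x - \<eta>" by simp_all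
  \<comment> \<open>A frequent and an eventual property hold together for some \<open>n\<close>; one
    such \<open>n\<close>, nearly attaining the upper limit at \<open>y\<close>, suffices.\<close>
  have Lle: "L y \<le> L x + \<eta>" if "x \<in> S" "y \<in> S" "\<And>n. \<bar>u n y - u n x\<bar> < \<eta>" for x y \<eta>
  proof (rule field_le_epsilon)
    fix e :: real assume e: "e > 0"
    have "\<exists>\<^sub>F n in sequentially. u n y > L y - e / 2 \<and> u n x < L x + e / 2"
      using frequently_eventually_frequently[OF Llow[OF that(2)] Lup[OF that(1)], of "e/2" "e/2"] e by simp
    then obtain n where "u n y > L y - e / 2" "u n x < L x + e / 2" using frequently_ex by blast
    then show "L y \<le> L x + \<eta> + e" using that(3)[of n] by linarith
  qed
  have Lnear: "\<exists>\<delta>>0. ball x \<delta> \<subseteq> S \<and> (\<forall>y\<in>ball x \<delta>. \<bar>L y - L x\<bar> \<le> \<eta> \<and> (\<forall>n. \<bar>u n y - u n x\<bar> < \<eta>))"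
    if x: "x \<in> S" and \<eta>: "\<eta> > 0" for x \<eta>
  proof -
    obtain \<delta> where \<delta>: "\<delta> > 0" "ball x \<delta> \<subseteq> S" "\<And>n y. y \<in> ball x \<delta> \<Longrightarrow> \<bar>u n y - u n x\<bar> < \<eta>"
      using eq[OF x \<eta>] by blast
    have "\<bar>L y - L x\<bar> \<le> \<eta>" if y: "y \<in> ball x \<delta>" for y
      using Lle[OF \<open>x \<in> S\<close> _ \<delta>(3)[OF y]] Lle[of y x \<eta>] \<delta>(2) \<delta>(3)[OF y] y \<open>x \<in> S\<close>
      by (auto simp: abs_minus_commute abs_le_iff)
    then show ?thesis using \<delta> by blast
  qed
  have Lcont: "continuous_on S L"
    unfolding continuous_on_iff
  proof (intro ballI allI impI)
    fix x and e :: real assume "x \<in> S" "e > 0"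
    then obtain \<delta> where "\<delta> > 0" "\<And>y. y \<in> ball x \<delta> \<Longrightarrow> \<bar>L y - L x\<bar> \<le> e / 2"
      using Lnear[of x "e / 2"] by auto
    then show "\<exists>d>0. \<forall>x'\<in>S. dist x' x < d \<longrightarrow> dist (L x') (L x) < e"
      using \<open>e > 0\<close> by (intro exI[of _ \<delta>]) (force simp: dist_real_def dist_commute)
  qed
  have unif: "\<forall>\<^sub>F n in sequentially. \<forall>y\<in>K. u n y < L y + \<eta>" if K: "compact K" "K \<subseteq> S" and \<eta>: "\<eta> > 0" for K \<eta>
  proof -
    have "\<forall>x\<in>K. \<exists>\<delta>. \<delta> > 0 \<and> (\<forall>y\<in>ball x \<delta>. \<bar>L y - L x\<bar> \<le> \<eta> / 3 \<and> (\<forall>n. \<bar>u n y - u n x\<bar> < \<eta> / 3))"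
      using Lnear[of _ "\<eta> / 3"] K(2) \<eta> by (meson divide_pos_pos subsetD zero_less_numeral)
    from bchoice[OF this] obtain \<delta> where \<delta>: "\<forall>x\<in>K. \<delta> x > 0 \<and>
      (\<forall>y\<in>ball x (\<delta> x). \<bar>L y - L x\<bar> \<le> \<eta> / 3 \<and> (\<forall>n. \<bar>u n y - u n x\<bar> < \<eta> / 3))" by (rule exE)
    have "K \<subseteq> (\<Union>x\<in>K. ball x (\<delta> x))" using \<delta> by force
    then obtain D where D: "D \<subseteq> K" "finite D" "K \<subseteq> (\<Union>x\<in>D. ball x (\<delta> x))"
      using compactE_image[OF K(1), of K "\<lambda>x. ball x (\<delta> x)"] by auto
    have "\<forall>\<^sub>F n in sequentially. \<forall>x\<in>D. u n x < L x + \<eta> / 3"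
      using D K(2) \<eta> by (intro eventually_ball_finite ballI Lup) auto
    then show ?thesis
    proof eventually_elim
      case (elim n)
      show ?case
      proof
        fix y assume "y \<in> K"
        then obtain x where x: "x \<in> D" "y \<in> ball x (\<delta> x)" using D(3) by blast
        then have "\<bar>L y - L x\<bar> \<le> \<eta> / 3" "\<bar>u n y - u n x\<bar> < \<eta> / 3" using \<delta> D(1) by blast+
        moreover have "u n x < L x + \<eta> / 3" using elim x(1) by blast
        ultimately show "u n y < L y + \<eta>" by linarith
      qed
    qed
  qed
  have "norm q powr p - f x - \<epsilon> * op_trace X \<le> c0" if x: "x \<in> S" and j: "superjet L x q X" for x q X
  proof (rule field_le_epsilon_mult)
    show "\<epsilon> * (4 * DIM('a)) > 0" using \<epsilon> by simp
    fix \<delta> :: real assume \<delta>: "\<delta> > 0"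
    have lin: "linear X" using j by (simp add: superjet_def)
    \<comment> \<open>As for the Poisson equation, half of the enlargement absorbs the remainder,
      the other half makes \<open>P\<close> touch \<open>L\<close> strictly.\<close>
    define Y where "Y h = X h + (4 * \<delta>) *\<^sub>R h" for h
    have Y: "linear Y" unfolding Y_def using lin by (auto simp: linear_iff algebra_simps)
    have trY: "op_trace Y = op_trace X + (4 * \<delta>) * DIM('a)"
      unfolding Y_def[abs_def] op_trace_simps ..
    define P where "P y = q \<bullet> (y - x) + (y - x) \<bullet> Y (y - x) / 2" for y
    define g where "g z = q + (1/2) *\<^sub>R (Y (z - x) + adjoint Y (z - x))" for z
    have P0: "P x = 0" using linear_0[OF Y] by (simp add: P_def)
    have "\<forall>\<^sub>F y in nhds x. y \<in> S \<and> L y \<le> L x + P y - \<delta> * (norm (y - x))\<^sup>2"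
      using eventually_nhds_in_open[OF S(1) x] superjet_shift[OF j \<delta>]
      by eventually_elim (auto simp: P_def Y_def inner_add_right power2_norm_eq_inner add_divide_distrib)
    then obtain d where d: "d > 0" "\<And>y. dist y x < d \<Longrightarrow> y \<in> S \<and> L y \<le> L x + P y - \<delta> * (norm (y - x))\<^sup>2"
      unfolding eventually_nhds_metric by blast
    define r where "r = d / 2"
    have r: "r > 0" using d by (simp add: r_def)
    have B: "y \<in> S" "L y \<le> L x + P y - \<delta> * (norm (y - x))\<^sup>2" if "y \<in> cball x r" for y
      using d(2)[of y] that d(1) by (auto simp: r_def dist_commute)
    have sub: "cball x r \<subseteq> S" using B(1) by blast
    \<comment> \<open>Stability of subsolutions: for a suitable \<open>n\<close>, the maximum of
      \<open>u n - P\<close> lies within \<open>1 / Suc m\<close> of \<open>x\<close>, and there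
      \<open>P\<close> gives a superjet of \<open>u n\<close>. Its trace is the same at every point,
      its gradient is \<open>g z\<close>.\<close>
    have "\<exists>z\<in>S. norm (z - x) < 1 / Suc m \<and> norm (g z) powr p - f z - \<epsilon> * op_trace Y \<le> c0 + 1 / Suc m" for m :: nat
    proof -
      define \<rho> where "\<rho> = min r (1 / Suc m)"
      have \<rho>: "\<rho> > 0" "\<rho> \<le> r" "\<rho> \<le> 1 / Suc m" using r by (auto simp: \<rho>_def)
      \<comment> \<open>The upper error on the ball and the lower error at \<open>x\<close> sum to
        \<open>2 * \<eta>\<close>, which is below \<open>\<delta> * \<rho>\<^sup>2\<close> and so
        forces the maximum point into the ball of radius \<rho>.\<close>
      define \<eta> where "\<eta> = \<delta> * \<rho>\<^sup>2 / 4"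
      have \<eta>: "\<eta> > 0" using \<delta> \<rho> by (simp add: \<eta>_def)
      have "\<forall>\<^sub>F n in sequentially. c n < c0 + 1 / Suc m" by (rule order_tendstoD(2)[OF c(2)]) simp
      then have "\<forall>\<^sub>F n in sequentially. (\<forall>y\<in>cball x r. u n y < L y + \<eta>) \<and> c n < c0 + 1 / Suc m"
        using unif[OF compact_cball sub \<eta>] by eventually_elim auto
      then have "\<exists>\<^sub>F n in sequentially. u n x > L x - \<eta> \<and> (\<forall>y\<in>cball x r. u n y < L y + \<eta>) \<and> c n < c0 + 1 / Suc m"
        using frequently_eventually_frequently[OF Llow[OF x \<eta>]] by blast
      then obtain n where n: "u n x > L x - \<eta>" "\<And>y. y \<in> cball x r \<Longrightarrow> u n y < L y + \<eta>" "c n < c0 + 1 / Suc m"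
        using frequently_ex by blast
      have "continuous_on (cball x r) P"
        unfolding P_def[abs_def] using poly_space_Ck[OF quadratic_poly_space[OF Y, of q x], of 0]
        by (auto intro: continuous_on_subset)
      then have "continuous_on (cball x r) (\<lambda>y. u n y - P y)"
        by (intro continuous_intros continuous_on_subset[OF u(1) sub])
      then obtain z where z: "z \<in> cball x r" "\<And>y. y \<in> cball x r \<Longrightarrow> u n y - P y \<le> u n z - P z"
        using continuous_attains_sup[of "cball x r" "\<lambda>y. u n y - P y"] r by auto
      have "u n x \<le> u n z - P z" using z(2)[of x] r P0 by simp
      then have "\<delta> * (norm (z - x))\<^sup>2 < 2 * \<eta>"
        using n(1) n(2)[OF z(1)] B(2)[OF z(1)] by linarith
      also have "\<dots> \<le> \<delta> * \<rho>\<^sup>2" using \<delta> by (simp add: \<eta>_def)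
      finally have "(norm (z - x))\<^sup>2 < \<rho>\<^sup>2" using \<delta> by simp
      then have zx: "norm (z - x) < \<rho>" using \<rho>(1) by (simp add: power_less_imp_less_base)
      then have "z \<in> ball x r" using \<rho> by (simp add: dist_norm norm_minus_commute)
      from eventually_nhds_in_open[OF open_ball this]
      have ev: "\<forall>\<^sub>F y in nhds z. u n y - P y \<le> u n z - P z"
        by eventually_elim (use z(2) in auto)
      obtain Z where Z: "jet P z (g z) Z" "op_trace Z = op_trace Y"
        using quadratic_jet[OF Y, of q x z] unfolding P_def[abs_def] g_def by blast
      have "norm (g z) powr p - f z - \<epsilon> * op_trace Y \<le> c n"
        using u(3)[OF _ jet_imp_superjet[OF Z(1) ev]] B(1)[OF z(1)] Z(2) by simp
      then show ?thesis using n(3) zx \<rho>(3) B(1)[OF z(1)] by (intro bexI[of _ z]) auto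
    qed
    then have "\<forall>m. \<exists>z. z \<in> S \<and> norm (z - x) < 1 / Suc m \<and>
      norm (g z) powr p - f z - \<epsilon> * op_trace Y \<le> c0 + 1 / Suc m" by blast
    from choice[OF this] obtain z where z': "\<forall>m. z m \<in> S \<and> norm (z m - x) < 1 / Suc m \<and>
      norm (g (z m)) powr p - f (z m) - \<epsilon> * op_trace Y \<le> c0 + 1 / Suc m" by (rule exE)
    have inv: "(\<lambda>m. 1 / real (Suc m)) \<longlonglongrightarrow> 0" using LIMSEQ_inverse_real_of_nat by (simp add: inverse_eq_divide)
    have "(\<lambda>m. z m - x) \<longlonglongrightarrow> 0"
      by (rule Lim_null_comparison[OF _ inv]) (use z' in \<open>auto intro!: always_eventually less_imp_le\<close>)
    then have zlim: "z \<longlonglongrightarrow> x" by (simp add: LIM_zero_iff)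
    have "isCont g x"
    proof -
      have "isCont Y w" "isCont (adjoint Y) w" for w
        using Y adjoint_linear[OF Y] by (auto intro: linear_continuous_at simp: linear_conv_bounded_linear)
      then have "isCont (\<lambda>z. Y (z - x)) x" "isCont (\<lambda>z. adjoint Y (z - x)) x"
        by (auto intro!: isCont_o2[where f="\<lambda>z. z - x"] continuous_intros)
      then show ?thesis unfolding g_def[abs_def] by (intro continuous_intros)
    qed
    then have "(\<lambda>m. g (z m)) \<longlonglongrightarrow> g x" using zlim by (rule isCont_tendsto_compose)
    moreover have "g x = q" using linear_0[OF Y] linear_0[OF adjoint_linear[OF Y]] by (simp add: g_def)
    ultimately have lim_g: "(\<lambda>m. norm (g (z m)) powr p) \<longlonglongrightarrow> norm q powr p"
      using p by (intro tendsto_powr' tendsto_norm tendsto_const) (auto intro!: always_eventually)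
    have "isCont f x" using f(1) S(1) x continuous_on_eq_continuous_at by blast
    then have lim_f: "(\<lambda>m. f (z m)) \<longlonglongrightarrow> f x" using zlim by (rule isCont_tendsto_compose)
    have lim1: "(\<lambda>m. norm (g (z m)) powr p - f (z m) - \<epsilon> * op_trace Y) \<longlonglongrightarrow>
        norm q powr p - f x - \<epsilon> * op_trace Y"
      by (rule tendsto_diff[OF tendsto_diff[OF lim_g lim_f] tendsto_const])
    have lim2: "(\<lambda>m. c0 + 1 / real (Suc m)) \<longlonglongrightarrow> c0 + 0" by (intro tendsto_intros inv)
    have "norm q powr p - f x - \<epsilon> * op_trace Y \<le> c0 + 0"
      by (rule LIMSEQ_le[OF lim1 lim2]) (use z' in blast)
    then show "norm q powr p - f x - \<epsilon> * op_trace X \<le> c0 + \<epsilon> * (4 * DIM('a)) * \<delta>"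
      unfolding trY by (simp add: algebra_simps)
  qed
  moreover have "L a = 0"
  proof (rule antisym)
    show "L a \<le> 0"
    proof (rule field_le_epsilon)
      fix e :: real assume "e > 0"
      from frequently_ex[OF Llow[OF a this]] show "L a \<le> 0 + e" by (simp add: u(2))
    qed
    show "0 \<le> L a"
    proof (rule field_le_epsilon)
      fix e :: real assume "e > 0"
      from eventually_happens'[OF sequentially_bot Lup[OF a this]] show "0 \<le> L a + e" by (simp add: u(2))
    qed
  qed
  ultimately show ?thesis unfolding admissible_iff[OF S(1) \<epsilon>, of _ _ _ a] using Lcont by blast
qed

text \<open>\<open>Least\<close> is meaningful only once the infimum is attained: the admissible
  constants are bounded below by \<open>admissible_lower_bound\<close>, constant functions show that
  \<open>F\<close> is one of them, and \<open>admissible_limit\<close> passes along a minimizing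
  sequence.\<close>

lemma additive_eigenvalue_is_minimum:
  fixes f :: "'a::euclidean_space \<Rightarrow> real"
  assumes p: "p > 2" and \<epsilon>: "\<epsilon> > 0" and S: "open S" "connected S" and r: "r > 0" "cball 0 r \<subseteq> S"
    and f: "continuous_on S f" "\<And>x. x \<in> S \<Longrightarrow> \<bar>f x\<bar> \<le> F"
  shows "admissible \<epsilon> p f S (additive_eigenvalue \<epsilon> (Hamiltonian p f) S)"
    and "admissible \<epsilon> p f S c \<Longrightarrow> additive_eigenvalue \<epsilon> (Hamiltonian p f) S \<le> c"
proof -
  let ?A = "{c. admissible \<epsilon> p f S c}"
  have fF: "f x \<le> F" "- f x \<le> F" if "x \<in> S" for x using f(2)[OF that] by (auto simp: abs_le_iff)
  obtain N where N: "\<And>S c F. open S \<Longrightarrow> cball 0 r \<subseteq> S \<Longrightarrow> (\<And>x. x \<in> S \<Longrightarrow> f x \<le> F) \<Longrightarrow>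
    admissible \<epsilon> p f S c \<Longrightarrow> - F - N \<le> c"
    using admissible_lower_bound[OF p \<epsilon> r(1), of f] by metis
  have bb: "bdd_below ?A" by (rule bdd_belowI[of _ "- F - N"]) (use N[OF S(1) r(2) fF(1)] in simp)
  have ne: "F \<in> ?A" using admissible_const[OF S(1) \<epsilon>, of f F p] fF(2) by simp
  have "\<forall>n. \<exists>c. admissible \<epsilon> p f S c \<and> c < Inf ?A + 1 / Suc n"
    using cInf_lessD[of ?A "Inf ?A + 1 / Suc n" for n] ne by fastforce
  from choice[OF this] obtain b where b: "\<forall>n. admissible \<epsilon> p f S (b n) \<and> b n < Inf ?A + 1 / Suc n" by (rule exE)
  have lim: "b \<longlonglongrightarrow> Inf ?A"
  proof (rule tendsto_sandwich[of "\<lambda>_. Inf ?A" _ _ "\<lambda>n. Inf ?A + 1 / real (Suc n)"])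
    have "Inf ?A \<le> b n" for n using b by (intro cInf_lower[OF _ bb]) simp
    then show "\<forall>\<^sub>F n in sequentially. Inf ?A \<le> b n" by simp
    show "\<forall>\<^sub>F n in sequentially. b n \<le> Inf ?A + 1 / real (Suc n)" using b by (auto intro!: always_eventually less_imp_le)
    have "(\<lambda>n. Inf ?A + 1 / real (Suc n)) \<longlonglongrightarrow> Inf ?A + 0"
      using LIMSEQ_inverse_real_of_nat by (intro tendsto_intros) (simp add: inverse_eq_divide)
    then show "(\<lambda>n. Inf ?A + 1 / real (Suc n)) \<longlonglongrightarrow> Inf ?A" by simp
  qed simp
  have min: "admissible \<epsilon> p f S (Inf ?A)"
  proof (rule admissible_limit[OF p \<epsilon> S _ f(1) _ _ lim])
    show "0 \<in> S" using r by auto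
    show "admissible \<epsilon> p f S (b n)" for n using b by blast
    show "f x \<le> F" if "x \<in> S" for x by (rule fF(1)[OF that])
  qed
  have "additive_eigenvalue \<epsilon> (Hamiltonian p f) S = Inf ?A"
    unfolding additive_eigenvalue_def admissible_def[symmetric]
    by (rule Least_equality[where P="admissible \<epsilon> p f S", OF min], rule cInf_lower[OF _ bb], simp)
  then show "admissible \<epsilon> p f S (additive_eigenvalue \<epsilon> (Hamiltonian p f) S)"
    and "admissible \<epsilon> p f S c \<Longrightarrow> additive_eigenvalue \<epsilon> (Hamiltonian p f) S \<le> c"
    using min cInf_lower[OF _ bb] by auto
qed

section \<open>Differentiability of monotone and convex functions\<close>

text \<open>\<open>x\<close> is an endpoint of the interval, not an interior point, so that the
  negation bounds the difference quotients at \<open>x\<close> itself.\<close>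

definition steep :: "(real \<Rightarrow> real) \<Rightarrow> real \<Rightarrow> real \<Rightarrow> bool" where
  "steep g q x \<longleftrightarrow> (\<forall>d>0. \<exists>u v. u < v \<and> x \<in> {u, v} \<and> v - u < d \<and> q * (v - u) < g v - g u)"

definition flat :: "(real \<Rightarrow> real) \<Rightarrow> real \<Rightarrow> real \<Rightarrow> bool" where
  "flat g q x \<longleftrightarrow> (\<forall>d>0. \<exists>u v. u < v \<and> x \<in> {u, v} \<and> v - u < d \<and> g v - g u < q * (v - u))"

text \<open>Vitali's theorem for balls, read in dimension one: \<open>{u..v}\<close> is a ball whose
  radius is half its length.\<close>

lemma Vitali_intervals:
  fixes P :: "real \<Rightarrow> real \<Rightarrow> bool"
  assumes "\<And>x d. x \<in> E \<Longrightarrow> d > 0 \<Longrightarrow> \<exists>u v. u < v \<and> x \<in> {u..v} \<and> v - u < d \<and> P u v"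
  obtains C where "countable C" "\<And>u v. (u, v) \<in> C \<Longrightarrow> u < v \<and> P u v"
    "disjoint_family_on (\<lambda>(u, v). {u..v}) C" "negligible (E - (\<Union>(u, v)\<in>C. {u..v}))"
proof -
  have cb: "cball ((u + v) / 2) ((v - u) / 2) = {u..v}" for u v :: real
    by (simp add: cball_eq_atLeastAtMost field_simps)
  let ?K = "{(u, v). u < v \<and> P u v}"
  let ?a = "\<lambda>(u, v). (u + v) / 2 :: real" and ?r = "\<lambda>(u, v). (v - u) / 2 :: real"
  have r: "0 < ?r i" if "i \<in> ?K" for i using that by auto
  have E: "\<exists>i. i \<in> ?K \<and> x \<in> cball (?a i) (?r i) \<and> ?r i < d" if xd: "x \<in> E" "0 < d" for x d
  proof -
    obtain u v where "u < v" "x \<in> {u..v}" "v - u < 2 * d" "P u v"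
      using assms[OF xd(1), of "2 * d"] xd(2) by auto
    then show ?thesis by (intro exI[of _ "(u, v)"]) (simp add: cb)
  qed
  obtain C where C: "countable C" "C \<subseteq> ?K"
    "pairwise (\<lambda>i j. disjnt (cball (?a i) (?r i)) (cball (?a j) (?r j))) C"
    "negligible (E - (\<Union>i\<in>C. cball (?a i) (?r i)))"
    by (rule Vitali_covering_theorem_cballs[of ?K ?r E ?a, OF r E]) blast+
  have eq: "cball (?a i) (?r i) = (\<lambda>(u, v). {u..v}) i" for i by (cases i) (simp add: cb)
  show ?thesis
    using C unfolding eq
    by (intro that[of C]) (auto simp: disjoint_family_on_def pairwise_def disjnt_def)
qed

lemma interval_family_measure:
  fixes C :: "(real \<times> real) set"
  assumes "finite C" and "\<And>u v. (u, v) \<in> C \<Longrightarrow> u < v" and "disjoint_family_on (\<lambda>(u, v). {u..v}) C"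
  shows "measure lebesgue (\<Union>(u, v)\<in>C. {u..v}) = (\<Sum>(u, v)\<in>C. v - u)"
proof -
  have "measure lebesgue (\<Union>i\<in>C. (\<lambda>(u, v). {u..v}) i) = (\<Sum>i\<in>C. measure lebesgue ((\<lambda>(u, v). {u..v}) i))"
    using assms by (intro measure_finite_Union) (auto simp: emeasure_lborel_Icc_eq)
  also have "\<dots> = (\<Sum>(u, v)\<in>C. v - u)"
    using assms(2) by (intro sum.cong) (auto simp: less_imp_le)
  finally show ?thesis .
qed

text \<open>The intervals \<open>{g u<..<g v}\<close> are disjoint and contained in
  \<open>{g a..g b}\<close>. Summing their lengths as measures spares putting the intervals of
  \<open>C\<close> in order.\<close>

lemma mono_sum_increments:
  fixes g :: "real \<Rightarrow> real"
  assumes g: "mono g" and C: "finite C" "\<And>u v. (u, v) \<in> C \<Longrightarrow> u < v \<and> a \<le> u \<and> v \<le> b"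
    and disj: "disjoint_family_on (\<lambda>(u, v). {u..v}) C" and ab: "a \<le> b"
  shows "(\<Sum>(u, v)\<in>C. g v - g u) \<le> g b - g a"
proof -
  have gm: "g u \<le> g v" if "u \<le> v" for u v using g that by (simp add: monoD)
  have "disjoint_family_on (\<lambda>(u, v). {g u<..<g v}) C"
    unfolding disjoint_family_on_def
  proof (intro ballI impI)
    fix i j assume ij: "i \<in> C" "j \<in> C" "i \<noteq> j"
    obtain u v u' v' where [simp]: "i = (u, v)" "j = (u', v')" by (cases i, cases j)
    have "{u..v} \<inter> {u'..v'} = {}" using disj ij by (fastforce simp: disjoint_family_on_def)
    moreover have "u < v" "u' < v'" using C(2) ij by auto
    ultimately have "v < u' \<or> v' < u" by (cases "u \<le> u'") auto
    then have "g v \<le> g u' \<or> g v' \<le> g u" using gm by (meson less_imp_le)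
    then show "(case i of (u, v) \<Rightarrow> {g u<..<g v}) \<inter> (case j of (u, v) \<Rightarrow> {g u<..<g v}) = {}" by auto
  qed
  then have "(\<Sum>i\<in>C. measure lebesgue ((\<lambda>(u, v). {g u<..<g v}) i)) = measure lebesgue (\<Union>i\<in>C. (\<lambda>(u, v). {g u<..<g v}) i)"
  proof (intro measure_finite_Union[symmetric])
    show "emeasure lebesgue ((\<lambda>(u, v). {g u<..<g v}) i) \<noteq> \<infinity>" for i
      using fmeasurableD2[of "{g (fst i)<..<g (snd i)}" lebesgue] by (cases i) simp
  qed (use C(1) in auto)
  also have "\<dots> \<le> measure lebesgue {g a..g b}"
  proof (rule measure_mono_fmeasurable)
    show "(\<Union>i\<in>C. (\<lambda>(u, v). {g u<..<g v}) i) \<subseteq> {g a..g b}"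
    proof
      fix y assume "y \<in> (\<Union>i\<in>C. (\<lambda>(u, v). {g u<..<g v}) i)"
      then obtain u v where uv: "(u, v) \<in> C" "g u < y" "y < g v" by auto
      have "g a \<le> g u" "g v \<le> g b" using C(2)[OF uv(1)] gm by auto
      then show "y \<in> {g a..g b}" using uv by simp
    qed
  qed (use C(1) in auto)
  also have "\<dots> = g b - g a" using gm[OF ab] by simp
  also have "(\<Sum>i\<in>C. measure lebesgue ((\<lambda>(u, v). {g u<..<g v}) i)) = (\<Sum>(u, v)\<in>C. g v - g u)"
    using C(2) gm by (intro sum.cong) (auto simp: less_imp_le)
  finally show ?thesis .
qed

text \<open>On each interval of a Vitali cover the increase of \<open>g\<close> exceeds
  \<open>q\<close> times the length, and all increases together are at most
  \<open>g b - g a\<close>.\<close>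

lemma steep_cover:
  assumes g: "mono g" and q: "q > 0" and ab: "a < b" and E: "E \<subseteq> {a<..<b}" "\<And>x. x \<in> E \<Longrightarrow> steep g q x"
  obtains K where "K \<in> lmeasurable" "negligible (E - K)" "K \<subseteq> {a..b}" "measure lebesgue K \<le> (g b - g a) / q"
proof -
  let ?P = "\<lambda>u v. a \<le> u \<and> v \<le> b \<and> q * (v - u) < g v - g u"
  have "\<exists>u v. u < v \<and> x \<in> {u..v} \<and> v - u < d \<and> ?P u v" if xd: "x \<in> E" "d > 0" for x d
  proof -
    have "min d (min (x - a) (b - x)) > 0" using xd E(1) by auto
    then obtain u v where "u < v" "x \<in> {u, v}" "v - u < min d (min (x - a) (b - x))" "q * (v - u) < g v - g u"
      using E(2)[OF xd(1)] unfolding steep_def by blast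
    then show ?thesis by (intro exI[of _ u] exI[of _ v]) auto
  qed
  then obtain C where C: "countable C" "\<And>u v. (u, v) \<in> C \<Longrightarrow> u < v \<and> ?P u v"
    "disjoint_family_on (\<lambda>(u, v). {u..v}) C" "negligible (E - (\<Union>(u, v)\<in>C. {u..v}))"
    using Vitali_intervals[of E ?P] by metis
  have meas: "(\<lambda>(u, v). {u..v}) i \<in> lmeasurable" for i :: "real \<times> real" by (cases i) simp
  have bound: "measure lebesgue (\<Union>i\<in>I'. (\<lambda>(u, v). {u..v}) i) \<le> (g b - g a) / q" if I: "I' \<subseteq> C" "finite I'" for I'
  proof -
    have d: "disjoint_family_on (\<lambda>(u, v). {u..v}) I'" using C(3) I(1) by (rule disjoint_family_on_mono[rotated])
    have "measure lebesgue (\<Union>i\<in>I'. (\<lambda>(u, v). {u..v}) i) = (\<Sum>(u, v)\<in>I'. v - u)"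
      using interval_family_measure[OF I(2) _ d] C(2) I(1) by blast
    also have "\<dots> \<le> (\<Sum>(u, v)\<in>I'. (g v - g u) / q)"
    proof (intro sum_mono)
      fix i assume "i \<in> I'"
      then obtain u v where i: "i = (u, v)" "(u, v) \<in> C" using I(1) by (cases i) auto
      then show "(case i of (u, v) \<Rightarrow> v - u) \<le> (case i of (u, v) \<Rightarrow> (g v - g u) / q)"
        using C(2)[OF i(2)] q by (simp add: field_simps)
    qed
    also have "\<dots> = (\<Sum>(u, v)\<in>I'. g v - g u) / q" by (simp add: sum_divide_distrib case_prod_unfold)
    also have "\<dots> \<le> (g b - g a) / q"
      using q ab C(2) I by (intro divide_right_mono mono_sum_increments[OF g _ _ d]) auto
    finally show ?thesis .
  qed
  have K: "(\<Union>i\<in>C. (\<lambda>(u, v). {u..v}) i) \<in> lmeasurable"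
    "measure lebesgue (\<Union>i\<in>C. (\<lambda>(u, v). {u..v}) i) \<le> (g b - g a) / q"
    using fmeasurable_UN_bound[OF C(1) meas bound] measure_UN_bound[OF C(1) meas bound] by blast+
  show ?thesis
    by (rule that[OF K(1) C(4) _ K(2)]) (use C(2) in fastforce)
qed

text \<open>An outer measure argument, as \<open>E\<close> is not known to be measurable. If the
  infimum of the measures of open supersets were positive, a nearly optimal \<open>T\<close> could
  be improved: \<open>step\<close> gives a cover smaller by the factor \<open>r\<close>, which is
  then enlarged slightly to an open set.\<close>

lemma negligible_outer_open:
  fixes E :: "'a::euclidean_space set"
  assumes T0: "open T0" "E \<subseteq> T0" "T0 \<in> lmeasurable" and r: "0 \<le> r" "r < 1"
    and step: "\<And>T. open T \<Longrightarrow> E \<subseteq> T \<Longrightarrow> T \<in> lmeasurable \<Longrightarrow>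
      \<exists>K\<in>lmeasurable. negligible (E - K) \<and> measure lebesgue K \<le> r * measure lebesgue T"
  shows "negligible E"
proof -
  let ?M = "{measure lebesgue T |T. open T \<and> E \<subseteq> T \<and> T \<in> lmeasurable}"
  have ne: "?M \<noteq> {}" using T0 by blast
  have bb: "bdd_below ?M" by (rule bdd_belowI[of _ 0]) auto
  have "Inf ?M \<ge> 0" by (rule cInf_greatest[OF ne]) auto
  have "Inf ?M = 0"
  proof (rule ccontr)
    assume "Inf ?M \<noteq> 0"
    then have m: "Inf ?M > 0" using \<open>Inf ?M \<ge> 0\<close> by simp
    \<comment> \<open>Strictly between \<open>r\<close> and \<open>1\<close>: the gap above
      \<open>r\<close> pays for the passage to an open set, the gap below \<open>1\<close> for the
      choice of \<open>T\<close>.\<close>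
    define s where "s = (1 + r) / 2"
    have s: "0 < s" "s < 1" "r < s" using r by (auto simp: s_def)
    have "Inf ?M < Inf ?M / s" using m s by (simp add: field_simps)
    then obtain T where T: "open T" "E \<subseteq> T" "T \<in> lmeasurable" "measure lebesgue T < Inf ?M / s"
      using cInf_lessD[OF ne] by blast
    obtain K where K: "K \<in> lmeasurable" "negligible (E - K)" "measure lebesgue K \<le> r * measure lebesgue T"
      using step[OF T(1-3)] by blast
    have "Inf ?M \<le> measure lebesgue T" using T(1-3) by (intro cInf_lower[OF _ bb]) blast
    then have mT: "measure lebesgue T > 0" using m by linarith
    let ?S = "K \<union> (E - K)"
    have S: "?S \<in> lmeasurable" by (rule fmeasurable.Un[OF K(1) negligible_imp_measurable[OF K(2)]])
    have Sm: "measure lebesgue ?S \<le> r * measure lebesgue T"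
      using K(3) measure_Un_le[OF fmeasurableD[OF K(1)] fmeasurableD[OF negligible_imp_measurable[OF K(2)]]]
        negligible_imp_measure0[OF K(2)] by linarith
    define e where "e = (s - r) * measure lebesgue T"
    have e: "e > 0" using s mT by (simp add: e_def)
    obtain T' where T': "open T'" "?S \<subseteq> T'" "T' - ?S \<in> lmeasurable" "emeasure lebesgue (T' - ?S) < ennreal e"
      using sets_lebesgue_outer_open[OF fmeasurableD[OF S] e] by blast
    have d: "measure lebesgue (T' - ?S) < e"
      using T'(3,4) e by (simp add: emeasure_eq_measure2 ennreal_less_iff)
    have eq: "T' = ?S \<union> (T' - ?S)" using T'(2) by blast
    have "T' \<in> lmeasurable" by (subst eq) (intro fmeasurable.Un S T'(3))
    moreover have "E \<subseteq> T'" using T'(2) by blast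
    ultimately have "Inf ?M \<le> measure lebesgue T'" using T'(1) by (intro cInf_lower[OF _ bb]) blast
    also have "measure lebesgue T' \<le> measure lebesgue ?S + measure lebesgue (T' - ?S)"
      by (subst eq) (rule measure_Un_le, use S T'(3) in \<open>auto dest: fmeasurableD\<close>)
    also have "\<dots> < s * measure lebesgue T" using Sm d by (simp add: e_def left_diff_distrib)
    also have "\<dots> < Inf ?M" using T(4) s by (simp add: field_simps)
    finally show False .
  qed
  show ?thesis
    unfolding negligible_outer_le
  proof (intro allI impI)
    fix e :: real assume "e > 0"
    then obtain T where "E \<subseteq> T" "T \<in> lmeasurable" "measure lebesgue T < e"
      using cInf_lessD[OF ne, of e] \<open>Inf ?M = 0\<close> by auto
    then show "\<exists>T. E \<subseteq> T \<and> T \<in> lmeasurable \<and> measure lebesgue T \<le> e" by (auto intro: less_imp_le)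
  qed
qed

text \<open>Two Vitali covers: flat intervals inside \<open>T\<close> have total increase at most
  \<open>p\<close> times the measure of \<open>T\<close>, and steep intervals inside them have total
  length at most that increase over \<open>q\<close>. So the cover shrinks by the factor
  \<open>p / q\<close>.\<close>

lemma negligible_flat_steep:
  assumes g: "mono g" and pq: "0 \<le> p" "p < q" and E: "E \<subseteq> {a<..<b}"
    "\<And>x. x \<in> E \<Longrightarrow> flat g p x" "\<And>x. x \<in> E \<Longrightarrow> steep g q x"
  shows "negligible E"
proof (rule negligible_outer_open)
  show "open {a<..<b}" "E \<subseteq> {a<..<b}" "{a<..<b} \<in> lmeasurable" using E by auto
  show "0 \<le> p / q" "p / q < 1" using pq by auto
  have q: "q > 0" using pq by simp
  fix T assume T: "open T" "E \<subseteq> T" "T \<in> lmeasurable"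
  let ?P = "\<lambda>u v. {u..v} \<subseteq> T \<and> g v - g u < p * (v - u)"
  have "\<exists>u v. u < v \<and> x \<in> {u..v} \<and> v - u < d \<and> ?P u v" if xd: "x \<in> E" "d > 0" for x d
  proof -
    obtain e where e: "e > 0" "ball x e \<subseteq> T" using T xd(1) open_contains_ball by blast
    have "min d e > 0" using xd e by auto
    then obtain u v where uv: "u < v" "x \<in> {u, v}" "v - u < min d e" "g v - g u < p * (v - u)"
      using E(2)[OF xd(1)] unfolding flat_def by blast
    then have "{u..v} \<subseteq> ball x e" by (auto simp: dist_real_def)
    then show ?thesis using uv e(2) by (intro exI[of _ u] exI[of _ v]) auto
  qed
  then obtain C where C: "countable C" "\<And>u v. (u, v) \<in> C \<Longrightarrow> u < v \<and> ?P u v"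
    "disjoint_family_on (\<lambda>(u, v). {u..v}) C" "negligible (E - (\<Union>(u, v)\<in>C. {u..v}))"
    using Vitali_intervals[of E ?P] by metis
  have "\<forall>i\<in>C. \<exists>K. K \<in> lmeasurable \<and> negligible (E \<inter> {fst i<..<snd i} - K) \<and> K \<subseteq> {fst i..snd i}
      \<and> measure lebesgue K \<le> (p / q) * (snd i - fst i)"
  proof
    fix i assume i: "i \<in> C"
    obtain u v where [simp]: "i = (u, v)" by (cases i)
    have uv: "u < v" "g v - g u < p * (v - u)" using C(2) i by auto
    obtain K where K: "K \<in> lmeasurable" "negligible (E \<inter> {u<..<v} - K)" "K \<subseteq> {u..v}" "measure lebesgue K \<le> (g v - g u) / q"
      using steep_cover[OF g q uv(1), of "E \<inter> {u<..<v}"] E(3) by (metis Int_iff inf_le2)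
    have "(g v - g u) / q \<le> (p * (v - u)) / q" using uv(2) q by (intro divide_right_mono) auto
    then show "\<exists>K. K \<in> lmeasurable \<and> negligible (E \<inter> {fst i<..<snd i} - K) \<and> K \<subseteq> {fst i..snd i}
      \<and> measure lebesgue K \<le> (p / q) * (snd i - fst i)"
      using K by (intro exI[of _ K]) auto
  qed
  from bchoice[OF this] obtain K where K: "\<forall>i\<in>C. K i \<in> lmeasurable \<and> negligible (E \<inter> {fst i<..<snd i} - K i)
      \<and> K i \<subseteq> {fst i..snd i} \<and> measure lebesgue (K i) \<le> (p / q) * (snd i - fst i)" by (rule exE)
  have meas: "K i \<in> lmeasurable" if "i \<in> C" for i using K that by blast
  have bound: "measure lebesgue (\<Union>i\<in>I'. K i) \<le> (p / q) * measure lebesgue T" if I: "I' \<subseteq> C" "finite I'" for I'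
  proof -
    have d: "disjoint_family_on (\<lambda>(u, v). {u..v}) I'" using C(3) I(1) by (rule disjoint_family_on_mono[rotated])
    have "measure lebesgue (\<Union>i\<in>I'. K i) \<le> (\<Sum>i\<in>I'. measure lebesgue (K i))"
      using I meas by (intro measure_UNION_le) (auto dest!: subsetD fmeasurableD)
    also have "\<dots> \<le> (\<Sum>i\<in>I'. (p / q) * (snd i - fst i))" using K I(1) by (intro sum_mono) blast
    also have "\<dots> = (p / q) * (\<Sum>(u, v)\<in>I'. v - u)" by (simp add: sum_distrib_left case_prod_unfold)
    also have "(\<Sum>(u, v)\<in>I'. v - u) = measure lebesgue (\<Union>(u, v)\<in>I'. {u..v})"
      using interval_family_measure[OF I(2) _ d] C(2) I(1) by (metis subsetD)
    also have "(p / q) * \<dots> \<le> (p / q) * measure lebesgue T"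
    proof (intro mult_left_mono measure_mono_fmeasurable T)
      show "(\<Union>(u, v)\<in>I'. {u..v}) \<subseteq> T" using C(2) I(1) by fastforce
      show "(\<Union>(u, v)\<in>I'. {u..v}) \<in> sets lebesgue" using I(2) by (intro sets.finite_UN) auto
    qed (use pq in simp)
    finally show ?thesis .
  qed
  show "\<exists>K\<in>lmeasurable. negligible (E - K) \<and> measure lebesgue K \<le> (p / q) * measure lebesgue T"
  proof (intro bexI conjI)
    show "(\<Union>i\<in>C. K i) \<in> lmeasurable" by (rule fmeasurable_UN_bound[OF C(1) meas bound])
    show "measure lebesgue (\<Union>i\<in>C. K i) \<le> (p / q) * measure lebesgue T" by (rule measure_UN_bound[OF C(1) meas bound])
    have 1: "negligible (\<Union>((\<lambda>i. E \<inter> {fst i<..<snd i} - K i) ` C))"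
      using C(1) K by (intro negligible_countable_Union) auto
    \<comment> \<open>\<open>steep_cover\<close> was applied in open intervals, which leaves the
      countably many endpoints.\<close>
    have 2: "negligible (\<Union>((\<lambda>x. {x}) ` (fst ` C \<union> snd ` C)))"
      using C(1) by (intro negligible_countable_Union) auto
    show "negligible (E - (\<Union>i\<in>C. K i))"
    proof (rule negligible_subset[OF negligible_Un[OF negligible_Un[OF 1 2] C(4)]], rule subsetI)
      fix x assume x: "x \<in> E - (\<Union>i\<in>C. K i)"
      show "x \<in> \<Union>((\<lambda>i. E \<inter> {fst i<..<snd i} - K i) ` C) \<union> \<Union>((\<lambda>x. {x}) ` (fst ` C \<union> snd ` C))
        \<union> (E - (\<Union>(u, v)\<in>C. {u..v}))"
      proof (cases "\<exists>i\<in>C. x \<in> {fst i..snd i}")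
        case True
        then obtain i where i: "i \<in> C" "x \<in> {fst i..snd i}" by blast
        then have "x = fst i \<or> x = snd i \<or> x \<in> {fst i<..<snd i}" by auto
        then show ?thesis using i(1) x by auto
      next
        case False
        then have "x \<notin> (\<Union>(u, v)\<in>C. {u..v})" by auto
        then show ?thesis using x by blast
      qed
    qed
  qed
qed

text \<open>Covers of measure at most \<open>(g b - g a) / q\<close> exist for every
  \<open>q\<close>. The \<open>+ 1\<close> in the choice of \<open>q\<close> keeps it positive when
  \<open>g\<close> is constant.\<close>

lemma negligible_infinitely_steep:
  assumes g: "mono g" and ab: "a < b" and E: "E \<subseteq> {a<..<b}"
    "\<And>x q. x \<in> E \<Longrightarrow> q > 0 \<Longrightarrow> steep g q x"
  shows "negligible E"
  unfolding negligible_outer_le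
proof (intro allI impI)
  fix e :: real assume e: "e > 0"
  have m: "g b - g a \<ge> 0" using monoD[OF g, of a b] ab by simp
  define q where "q = (g b - g a + 1) / e"
  have q: "q > 0" using m e by (simp add: q_def)
  obtain K where K: "K \<in> lmeasurable" "negligible (E - K)" "measure lebesgue K \<le> (g b - g a) / q"
    using steep_cover[OF g q ab E(1)] E(2) q by metis
  have N: "E - K \<in> lmeasurable" by (rule negligible_imp_measurable[OF K(2)])
  have "measure lebesgue (K \<union> (E - K)) \<le> measure lebesgue K + measure lebesgue (E - K)"
    by (rule measure_Un_le[OF fmeasurableD[OF K(1)] fmeasurableD[OF N]])
  also have "measure lebesgue (E - K) = 0" by (rule negligible_imp_measure0[OF K(2)])
  also have "measure lebesgue K + 0 \<le> (g b - g a) / q" using K(3) by simp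
  also have "\<dots> \<le> e" using m e by (simp add: q_def field_simps)
  finally have "measure lebesgue (K \<union> (E - K)) \<le> e" .
  then show "\<exists>T. E \<subseteq> T \<and> T \<in> lmeasurable \<and> measure lebesgue T \<le> e"
    by (intro exI[of _ "K \<union> (E - K)"] conjI fmeasurable.Un[OF K(1) N]) auto
qed

text \<open>\<open>L\<close>, the infimum of the slopes that are not steep, bounds the difference
  quotients from above up to a small error. Every \<open>q\<close> below \<open>L\<close> is steep,
  hence a smaller \<open>p\<close> is not flat, which bounds them from below. Restricting
  \<open>p\<close> and \<open>q\<close> to the rationals keeps the family of exceptional sets
  countable.\<close>

lemma differentiable_if_not_flat_steep:
  fixes g :: "real \<Rightarrow> real"
  assumes g: "mono g" and q0: "\<not> steep g q0 x"
    and fs: "\<And>p q. p \<in> \<rat> \<Longrightarrow> q \<in> \<rat> \<Longrightarrow> 0 \<le> p \<Longrightarrow> p < q \<Longrightarrow> \<not> (flat g p x \<and> steep g q x)"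
  shows "\<exists>L. (g has_real_derivative L) (at x)"
proof -
  let ?A = "{q. \<not> steep g q x}"
  have inc: "g u \<le> g v" if "u \<le> v" for u v using g that by (rule monoD)
  have neg: "steep g q x" if "q < 0" for q
    unfolding steep_def
  proof (intro allI impI)
    fix d :: real assume "d > 0"
    have "q * (d / 2) < 0" using that \<open>d > 0\<close> by (simp add: mult_neg_pos)
    also have "0 \<le> g (x + d / 2) - g x" using inc[of x "x + d / 2"] \<open>d > 0\<close> by simp
    finally show "\<exists>u v. u < v \<and> x \<in> {u, v} \<and> v - u < d \<and> q * (v - u) < g v - g u"
      using \<open>d > 0\<close> by (intro exI[of _ x] exI[of _ "x + d / 2"]) simp
  qed
  have bb: "bdd_below ?A" using neg by (intro bdd_belowI[of _ 0]) (auto simp: not_less[symmetric])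
  define L where "L = Inf ?A"
  have L0: "L \<ge> 0" unfolding L_def using q0 neg by (intro cInf_greatest) (auto simp: not_less[symmetric])
  have ub: "\<exists>d>0. \<forall>u v. u < v \<and> x \<in> {u, v} \<and> v - u < d \<longrightarrow> g v - g u \<le> (L + e) * (v - u)" if e: "e > 0" for e
  proof -
    obtain q where q: "\<not> steep g q x" "q < L + e"
      using cInf_lessD[of ?A "L + e"] q0 e by (auto simp: L_def)
    then obtain d where d: "d > 0" "\<And>u v. u < v \<Longrightarrow> x \<in> {u, v} \<Longrightarrow> v - u < d \<Longrightarrow> g v - g u \<le> q * (v - u)"
      unfolding steep_def by (meson not_less)
    have "g v - g u \<le> (L + e) * (v - u)" if "u < v" "x \<in> {u, v}" "v - u < d" for u v
      using d(2)[OF that] mult_right_mono[of q "L + e" "v - u"] q(2) that(1) by linarith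
    then show ?thesis using d(1) by blast
  qed
  \<comment> \<open>For \<open>L - e < 0\<close> monotonicity is enough; otherwise \<open>p\<close>
    is nonnegative, as \<open>fs\<close> requires.\<close>
  have lb: "\<exists>d>0. \<forall>u v. u < v \<and> x \<in> {u, v} \<and> v - u < d \<longrightarrow> g v - g u \<ge> (L - e) * (v - u)" if e: "e > 0" for e
  proof (cases "L - e < 0")
    case True
    have "g v - g u \<ge> (L - e) * (v - u)" if "u < v" for u v
      using inc[of u v] mult_nonpos_nonneg[of "L - e" "v - u"] True that by linarith
    then show ?thesis by (intro exI[of _ 1]) auto
  next
    case False
    obtain p where p: "p \<in> \<rat>" "L - e < p" "p < L" using Rats_dense_in_real[of "L - e" L] e by auto
    obtain q where q: "q \<in> \<rat>" "p < q" "q < L" using Rats_dense_in_real[OF p(3)] by auto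
    have "q \<notin> ?A" using q(3) cInf_lower[OF _ bb] by (force simp: L_def)
    then have "\<not> flat g p x" using fs[OF p(1) q(1) _ q(2)] p(2) False by auto
    then obtain d where d: "d > 0" "\<And>u v. u < v \<Longrightarrow> x \<in> {u, v} \<Longrightarrow> v - u < d \<Longrightarrow> g v - g u \<ge> p * (v - u)"
      unfolding flat_def by (meson not_less)
    have "g v - g u \<ge> (L - e) * (v - u)" if "u < v" "x \<in> {u, v}" "v - u < d" for u v
      using d(2)[OF that] mult_right_mono[of "L - e" p "v - u"] p(2) that(1) by linarith
    then show ?thesis using d(1) by blast
  qed
  have "(g has_derivative (\<lambda>h. L * h)) (at x)"
    unfolding has_derivative_at_alt
  proof (intro conjI allI impI)
    show "bounded_linear ((*) L)" by (rule bounded_linear_mult_right)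
    fix e :: real assume e: "e > 0"
    obtain d1 where d1: "d1 > 0" "\<And>u v. u < v \<Longrightarrow> x \<in> {u, v} \<Longrightarrow> v - u < d1 \<Longrightarrow> g v - g u \<le> (L + e) * (v - u)"
      using ub[OF e] by blast
    obtain d2 where d2: "d2 > 0" "\<And>u v. u < v \<Longrightarrow> x \<in> {u, v} \<Longrightarrow> v - u < d2 \<Longrightarrow> g v - g u \<ge> (L - e) * (v - u)"
      using lb[OF e] by blast
    have "norm (g y - g x - L * (y - x)) \<le> e * norm (y - x)" if y: "norm (y - x) < min d1 d2" for y
    proof (cases x y rule: linorder_cases)
      case less
      then show ?thesis using d1(2)[of x y] d2(2)[of x y] y by (simp add: abs_le_iff algebra_simps)
    next
      case greater
      then show ?thesis using d1(2)[of y x] d2(2)[of y x] y by (simp add: abs_le_iff algebra_simps)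
    qed simp
    then show "\<exists>d>0. \<forall>y. norm (y - x) < d \<longrightarrow> norm (g y - g x - L * (y - x)) \<le> e * norm (y - x)"
      using d1(1) d2(1) by (intro exI[of _ "min d1 d2"]) auto
  qed
  then show ?thesis by (auto simp: has_field_derivative_def)
qed

theorem Lebesgue_monotone_differentiable:
  fixes g :: "real \<Rightarrow> real"
  assumes g: "mono g"
  shows "negligible {x. \<not> (\<exists>L. (g has_real_derivative L) (at x))}"
proof -
  let ?I = "\<lambda>n::nat. {- real n<..<real n}"
  let ?A = "\<lambda>n. {x \<in> ?I n. \<forall>q>0. steep g q x}"
  let ?B = "\<lambda>(n, p, q). {x \<in> ?I n. flat g p x \<and> steep g q x}"
  let ?J = "{(n::nat, p, q). p \<in> \<rat> \<and> q \<in> \<rat> \<and> 0 \<le> p \<and> p < q}"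
  have A: "negligible (?A n)" for n
  proof (cases "n = 0")
    case False
    then show ?thesis by (intro negligible_infinitely_steep[OF g, of "- real n" "real n"]) auto
  qed simp
  have B: "negligible (?B i)" if "i \<in> ?J" for i
    using that by (cases i) (auto intro!: negligible_flat_steep[OF g])
  have "countable ?J"
    by (rule countable_subset[of _ "UNIV \<times> \<rat> \<times> \<rat>"]) (auto intro!: countable_SIGMA countable_rat)
  then have "negligible (\<Union>(?B ` ?J))" using B by (intro negligible_countable_Union) auto
  moreover have "negligible (\<Union>(range ?A))" using A by (intro negligible_countable_Union) auto
  ultimately show ?thesis
  proof (rule negligible_subset[OF negligible_Un])
    show "{x. \<not> (\<exists>L. (g has_real_derivative L) (at x))} \<subseteq> \<Union>(?B ` ?J) \<union> \<Union>(range ?A)"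
    proof
      fix x assume x: "x \<in> {x. \<not> (\<exists>L. (g has_real_derivative L) (at x))}"
      obtain n :: nat where "\<bar>x\<bar> < n" using reals_Archimedean2 by blast
      then have n: "x \<in> ?I n" by auto
      show "x \<in> \<Union>(?B ` ?J) \<union> \<Union>(range ?A)"
      proof (cases "\<forall>q>0. steep g q x")
        case True
        then have "x \<in> ?A n" using n by blast
        then show ?thesis by blast
      next
        case False
        then obtain q0 where "\<not> steep g q0 x" by blast
        from differentiable_if_not_flat_steep[OF g this] x
        obtain p q where pq: "p \<in> \<rat>" "q \<in> \<rat>" "0 \<le> p" "p < q" "flat g p x" "steep g q x" by blast
        then have "x \<in> ?B (n, p, q)" "(n, p, q) \<in> ?J" using n by auto
        then show ?thesis by blast
      qed
    qed
  qed
qed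

text \<open>Over \<open>n\<close> equal steps the quadratic errors add up to
  \<open>K h^2 / n\<close>, which tends to zero. This replaces the integration of a derivative that
  may be missing at many points.\<close>

lemma quadratic_increment_bound:
  fixes \<psi> :: "real \<Rightarrow> real"
  assumes le: "\<And>s t. s \<in> closed_segment 0 h \<Longrightarrow> t \<in> closed_segment 0 h \<Longrightarrow>
      \<bar>\<psi> t - \<psi> s\<bar> \<le> M * \<bar>t - s\<bar> + K * (t - s)\<^sup>2"
  shows "\<bar>\<psi> h - \<psi> 0\<bar> \<le> M * \<bar>h\<bar>"
proof -
  have N: "\<bar>\<psi> h - \<psi> 0\<bar> \<le> M * \<bar>h\<bar> + K * h\<^sup>2 * inverse (real (Suc n))" for n
  proof -
    define N where "N = Suc n"
    let ?t = "\<lambda>i. (real i / N) * h"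
    have seg: "?t i \<in> closed_segment 0 h" if "i \<le> N" for i
      unfolding closed_segment_def using that by (auto simp: N_def intro!: exI[of _ "real i / N"])
    have "\<bar>\<psi> h - \<psi> 0\<bar> = \<bar>\<Sum>i<N. \<psi> (?t (Suc i)) - \<psi> (?t i)\<bar>"
      using sum_lessThan_telescope[of "\<lambda>i. \<psi> (?t i)" N] by (simp add: N_def)
    also have "\<dots> \<le> (\<Sum>i<N. \<bar>\<psi> (?t (Suc i)) - \<psi> (?t i)\<bar>)" by (rule sum_abs)
    also have "\<dots> \<le> (\<Sum>i<N. M * (\<bar>h\<bar> / N) + K * (h / N)\<^sup>2)"
    proof (rule sum_mono)
      fix i assume "i \<in> {..<N}"
      then have "i \<le> N" "Suc i \<le> N" by auto
      have e: "?t (Suc i) - ?t i = h / N" by (simp add: add_divide_distrib algebra_simps)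
      show "\<bar>\<psi> (?t (Suc i)) - \<psi> (?t i)\<bar> \<le> M * (\<bar>h\<bar> / N) + K * (h / N)\<^sup>2"
        using le[OF seg[OF \<open>i \<le> N\<close>] seg[OF \<open>Suc i \<le> N\<close>]] unfolding e by (simp add: abs_divide)
    qed
    also have "\<dots> = M * \<bar>h\<bar> + K * h\<^sup>2 * inverse (real N)"
    proof -
      have "real N \<noteq> 0" by (simp add: N_def)
      then show ?thesis by (simp add: field_simps power2_eq_square)
    qed
    finally show ?thesis by (simp add: N_def)
  qed
  have "(\<lambda>n. M * \<bar>h\<bar> + K * h\<^sup>2 * inverse (real (Suc n))) \<longlonglongrightarrow> M * \<bar>h\<bar> + K * h\<^sup>2 * 0"
    by (intro tendsto_intros LIMSEQ_inverse_real_of_nat)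
  then have "\<bar>\<psi> h - \<psi> 0\<bar> \<le> M * \<bar>h\<bar> + K * h\<^sup>2 * 0"
    by (rule LIMSEQ_le_const) (use N in blast)
  then show ?thesis by simp
qed

text \<open>\<gamma> selects a subgradient of \<open>c\<close> up to a quadratic error; where
  \<open>c\<close> is differentiable it is the derivative, by first order optimality. Increments of
  the Taylor remainder \<psi> are governed by \<open>\<gamma> (x + s) - \<gamma> x - A * s\<close>,
  which is small compared with \<open>h\<close>, up to quadratic errors that
  \<open>quadratic_increment_bound\<close> removes.\<close>

lemma twice_differentiable_subgradient:
  fixes c \<gamma> :: "real \<Rightarrow> real"
  assumes I: "open I" "x \<in> I" and k: "k \<ge> 0"
    and sub: "\<And>y z. y \<in> I \<Longrightarrow> z \<in> I \<Longrightarrow> c z \<ge> c y + \<gamma> y * (z - y) - k * (z - y)\<^sup>2"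
    and A: "(\<gamma> has_real_derivative A) (at x)"
  shows "twice_differentiable_at c x"
proof -
  have upper: "c z \<le> c y + \<gamma> z * (z - y) + k * (z - y)\<^sup>2" if "y \<in> I" "z \<in> I" for y z
    using sub[OF that(2,1)] by (simp add: power2_eq_square algebra_simps)
  have deriv_eq: "d = \<gamma> y" if y: "y \<in> I" and d: "(c has_real_derivative d) (at y)" for y d
  proof -
    obtain e where e: "e > 0" "ball y e \<subseteq> I" using I(1) y open_contains_ball by blast
    have "((\<lambda>z. c z - \<gamma> y * (z - y) + k * (z - y)\<^sup>2) has_real_derivative (d - \<gamma> y)) (at y)"
      by (auto intro!: derivative_eq_intros d)
    moreover have "\<forall>z. \<bar>y - z\<bar> < e \<longrightarrow> c y - \<gamma> y * (y - y) + k * (y - y)\<^sup>2 \<le> c z - \<gamma> y * (z - y) + k * (z - y)\<^sup>2"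
    proof (intro allI impI)
      fix z assume "\<bar>y - z\<bar> < e"
      then have "z \<in> I" using e(2) by (auto simp: dist_real_def subset_iff)
      from sub[OF y this] show "c y - \<gamma> y * (y - y) + k * (y - y)\<^sup>2 \<le> c z - \<gamma> y * (z - y) + k * (z - y)\<^sup>2"
        by simp
    qed
    ultimately have "d - \<gamma> y = 0" using DERIV_local_min[OF _ e(1)] by blast
    then show ?thesis by simp
  qed
  have expand: "\<exists>d>0. \<forall>h. \<bar>h\<bar> < d \<longrightarrow> x + h \<in> I \<and> \<bar>\<gamma> (x + h) - \<gamma> x - A * h\<bar> \<le> \<eta> * \<bar>h\<bar>" if \<eta>: "\<eta> > 0" for \<eta>
  proof -
    obtain d1 where d1: "d1 > 0" "\<And>y. norm (y - x) < d1 \<Longrightarrow> norm (\<gamma> y - \<gamma> x - A * (y - x)) \<le> \<eta> * norm (y - x)"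
      using A[unfolded has_field_derivative_def has_derivative_at_alt] \<eta> by blast
    obtain e where e: "e > 0" "ball x e \<subseteq> I" using I open_contains_ball by blast
    show ?thesis
    proof (intro exI[of _ "min d1 e"] conjI allI impI)
      show "min d1 e > 0" using d1 e by simp
      fix h assume h: "\<bar>h\<bar> < min d1 e"
      then show "\<bar>\<gamma> (x + h) - \<gamma> x - A * h\<bar> \<le> \<eta> * \<bar>h\<bar>" using d1(2)[of "x + h"] by simp
      have "x + h \<in> ball x e" using h by (simp add: dist_real_def)
      then show "x + h \<in> I" using e(2) by blast
    qed
  qed
  define \<psi> where "\<psi> h = c (x + h) - c x - \<gamma> x * h - A * h\<^sup>2 / 2" for h
  have taylor: "\<exists>d>0. \<forall>h. \<bar>h\<bar> < d \<longrightarrow> \<bar>\<psi> h\<bar> \<le> \<eta> * h\<^sup>2" if \<eta>: "\<eta> > 0" for \<eta>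
  proof -
    obtain d where d: "d > 0" "\<And>h. \<bar>h\<bar> < d \<Longrightarrow> x + h \<in> I"
      "\<And>h. \<bar>h\<bar> < d \<Longrightarrow> \<bar>\<gamma> (x + h) - \<gamma> x - A * h\<bar> \<le> \<eta> * \<bar>h\<bar>" using expand[OF \<eta>] by blast
    have "\<bar>\<psi> h\<bar> \<le> \<eta> * h\<^sup>2" if h: "\<bar>h\<bar> < d" for h
    proof -
      \<comment> \<open>Exchanging \<open>s\<close> and \<open>t\<close> turns this lower bound into
        a two-sided one.\<close>
      have low: "\<psi> t - \<psi> s \<ge> - (\<eta> * \<bar>h\<bar> * \<bar>t - s\<bar> + (\<bar>A\<bar> / 2 + k) * (t - s)\<^sup>2)" if "\<bar>s\<bar> \<le> \<bar>h\<bar>" "\<bar>t\<bar> \<le> \<bar>h\<bar>" for s t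
      proof -
        have sI: "x + s \<in> I" "x + t \<in> I" using d(2) that h by auto
        have "\<bar>\<gamma> (x + s) - \<gamma> x - A * s\<bar> \<le> \<eta> * \<bar>s\<bar>" using d(3) that h by auto
        also have "\<dots> \<le> \<eta> * \<bar>h\<bar>" using that \<eta> by simp
        finally have "\<bar>\<gamma> (x + s) - \<gamma> x - A * s\<bar> * \<bar>t - s\<bar> \<le> \<eta> * \<bar>h\<bar> * \<bar>t - s\<bar>" by (rule mult_right_mono) simp
        then have 1: "(\<gamma> (x + s) - \<gamma> x - A * s) * (t - s) \<ge> - (\<eta> * \<bar>h\<bar> * \<bar>t - s\<bar>)"
          by (simp add: abs_mult[symmetric] abs_le_iff)
        have 2: "A / 2 * (t - s)\<^sup>2 \<le> \<bar>A\<bar> / 2 * (t - s)\<^sup>2" by (intro mult_right_mono) auto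
        have "c (x + t) \<ge> c (x + s) + \<gamma> (x + s) * (t - s) - k * (t - s)\<^sup>2" using sub[OF sI] by simp
        then have "\<psi> t - \<psi> s \<ge> \<gamma> (x + s) * (t - s) - k * (t - s)\<^sup>2 - \<gamma> x * (t - s) - A * (t\<^sup>2 - s\<^sup>2) / 2"
          by (simp add: \<psi>_def algebra_simps diff_divide_distrib)
        also have "\<gamma> (x + s) * (t - s) - k * (t - s)\<^sup>2 - \<gamma> x * (t - s) - A * (t\<^sup>2 - s\<^sup>2) / 2 =
          (\<gamma> (x + s) - \<gamma> x - A * s) * (t - s) - A / 2 * (t - s)\<^sup>2 - k * (t - s)\<^sup>2"
          by (simp add: power2_eq_square field_simps)
        finally show ?thesis using 1 2 by (simp add: distrib_right)
      qed
      have "\<bar>\<psi> h - \<psi> 0\<bar> \<le> (\<eta> * \<bar>h\<bar>) * \<bar>h\<bar>"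
      proof (rule quadratic_increment_bound)
        fix s t assume st: "s \<in> closed_segment 0 h" "t \<in> closed_segment 0 h"
        have "\<bar>r\<bar> \<le> \<bar>h\<bar>" if r: "r \<in> closed_segment 0 h" for r
          using r by (auto simp: closed_segment_eq_real_ivl split: if_splits)
        then show "\<bar>\<psi> t - \<psi> s\<bar> \<le> \<eta> * \<bar>h\<bar> * \<bar>t - s\<bar> + (\<bar>A\<bar> / 2 + k) * (t - s)\<^sup>2"
          using low[of s t] low[of t s] st by (simp add: abs_le_iff abs_minus_commute power2_commute)
      qed
      moreover have "\<psi> 0 = 0" by (simp add: \<psi>_def)
      moreover have "\<eta> * \<bar>h\<bar> * \<bar>h\<bar> = \<eta> * h\<^sup>2" by (simp add: power2_eq_square)
      ultimately show ?thesis by simp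
    qed
    then show ?thesis using d(1) by blast
  qed
  have lim: "((\<lambda>h. \<psi> h / h\<^sup>2) \<longlongrightarrow> 0) (at 0)"
    unfolding tendsto_iff
  proof (intro allI impI)
    fix e :: real assume e: "e > 0"
    obtain d where d: "d > 0" "\<And>h. \<bar>h\<bar> < d \<Longrightarrow> \<bar>\<psi> h\<bar> \<le> e / 2 * h\<^sup>2"
      using taylor[of "e / 2"] e by auto
    show "\<forall>\<^sub>F h in at 0. dist (\<psi> h / h\<^sup>2) 0 < e"
      unfolding eventually_at
    proof (intro exI[of _ d] conjI ballI impI)
      fix h :: real assume h: "h \<noteq> 0 \<and> dist h 0 < d"
      then have "\<bar>\<psi> h\<bar> / h\<^sup>2 \<le> e / 2" using d(2)[of h] by (simp add: pos_divide_le_eq)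
      also have "e / 2 < e" using e by simp
      finally show "dist (\<psi> h / h\<^sup>2) 0 < e" by (simp add: dist_real_def)
    qed (rule d(1))
  qed
  have D1: "(c has_real_derivative \<gamma> x) (at x)"
    unfolding DERIV_def
  proof -
    have "((\<lambda>h. \<gamma> x + A / 2 * h + \<psi> h / h\<^sup>2 * h) \<longlongrightarrow> \<gamma> x + A / 2 * 0 + 0 * 0) (at 0)"
      by (intro tendsto_intros lim)
    moreover have "\<forall>\<^sub>F h in at 0. \<gamma> x + A / 2 * h + \<psi> h / h\<^sup>2 * h = (c (x + h) - c x) / h"
      by (auto simp: eventually_at \<psi>_def power2_eq_square field_simps intro!: exI[of _ 1])
    ultimately show "((\<lambda>h. (c (x + h) - c x) / h) \<longlongrightarrow> \<gamma> x) (at 0)"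
      by (simp add: tendsto_cong)
  qed
  let ?S = "{y. c differentiable (at y)}"
  have dc: "deriv c y = \<gamma> y" if "y \<in> I" "c differentiable (at y)" for y
  proof -
    obtain d where "(c has_real_derivative d) (at y)" using \<open>c differentiable (at y)\<close> by (auto simp: real_differentiable_def)
    then show ?thesis using deriv_eq[OF that(1)] DERIV_imp_deriv by metis
  qed
  have "(\<gamma> has_real_derivative A) (at x within ?S)"
    using A by (rule has_field_derivative_at_within)
  then have D2: "(deriv c has_real_derivative A) (at x within ?S)"
  proof -
    obtain e where e: "e > 0" "ball x e \<subseteq> I" using I open_contains_ball by blast
    have xS: "x \<in> ?S" using D1 by (auto simp: real_differentiable_def)
    show ?thesis
      by (rule has_field_derivative_transform_within[OF \<open>(\<gamma> has_real_derivative A) (at x within ?S)\<close> e(1) xS])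
        (use dc e(2) in \<open>auto simp: subset_iff dist_commute\<close>)
  qed
  show ?thesis
    unfolding twice_differentiable_at_def using D1 D2 lim unfolding \<psi>_def by blast
qed

text \<open>The infimum of the forward slopes of the convex function is its right derivative: a
  subgradient everywhere, monotone, and therefore differentiable almost everywhere.\<close>

theorem semiconvex_twice_differentiable_AE:
  assumes sc: "semiconvex_on {a<..<b} c"
  shows "AE x in lebesgue_on {a<..<b}. twice_differentiable_at c x"
proof -
  let ?I = "{a<..<b}"
  obtain \<tau> where \<tau>: "\<tau> > 0" "convex_on ?I (\<lambda>x. c x + \<bar>x\<bar>\<^sup>2 / (2 * \<tau>))"
    using sc by (auto simp: semiconvex_on_def)
  define u where "u x = c x + \<bar>x\<bar>\<^sup>2 / (2 * \<tau>)" for x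
  define g where "g x = Inf ((\<lambda>t. (u x - u t) / (x - t)) ` ({x<..} \<inter> ?I))" for x
  have sub: "u z \<ge> u y + g y * (z - y)" if "y \<in> ?I" "z \<in> ?I" for y z
    using convex_le_Inf_differential[of ?I u y z] \<tau>(2) that unfolding u_def[symmetric] g_def by simp
  have g: "g y \<le> g z" if "y \<in> ?I" "z \<in> ?I" "y \<le> z" for y z
  proof (cases "y = z")
    case False
    have "0 \<le> (g z - g y) * (z - y)"
      using sub[OF that(1,2)] sub[OF that(2,1)] by (simp add: algebra_simps)
    then show ?thesis using False that(3) by (simp add: zero_le_mult_iff)
  qed simp
  \<comment> \<open>\<open>g\<close> is monotone only on \<open>?I\<close>; freezing it outside
    \<open>[p, q]\<close> makes it monotone on the whole line, and rational endpoints keep the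
    family countable.\<close>
  define G where "G i x = g (max (fst i) (min (snd i) x))" for i x
  let ?J = "{(p, q). p \<in> \<rat> \<and> q \<in> \<rat> \<and> p \<in> ?I \<and> q \<in> ?I \<and> p < q}"
  have G: "mono (G i)" if "i \<in> ?J" for i
    unfolding G_def using that by (intro monoI g) (auto simp: min_def max_def)
  let ?N = "\<lambda>i. {x. \<not> (\<exists>L. (G i has_real_derivative L) (at x))}"
  have "countable ?J"
    by (rule countable_subset[of _ "\<rat> \<times> \<rat>"]) (auto intro!: countable_SIGMA countable_rat)
  then have N: "negligible (\<Union>(?N ` ?J))"
    using Lebesgue_monotone_differentiable[OF G] by (intro negligible_countable_Union) auto
  have tw: "twice_differentiable_at c x" if x: "x \<in> ?I" "x \<notin> \<Union>(?N ` ?J)" for x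
  proof -
    obtain p where p: "p \<in> \<rat>" "a < p" "p < x" using Rats_dense_in_real[of a x] x by auto
    obtain q where q: "q \<in> \<rat>" "x < q" "q < b" using Rats_dense_in_real[of x b] x by auto
    have "(p, q) \<in> ?J" using p q x by auto
    then obtain L where L: "(G (p, q) has_real_derivative L) (at x)" using x(2) by blast
    have gL: "(g has_real_derivative L) (at x)"
      by (rule has_field_derivative_transform_within_open[OF L, of "{p<..<q}"])
        (use p q in \<open>auto simp: G_def\<close>)
    show ?thesis
    proof (rule twice_differentiable_subgradient[where \<gamma>="\<lambda>y. g y - y / \<tau>" and k="1 / (2 * \<tau>)" and A="L - 1 / \<tau>" and I="?I"])
      show "((\<lambda>y. g y - y / \<tau>) has_real_derivative L - 1 / \<tau>) (at x)"
        using \<tau>(1) by (auto intro!: derivative_eq_intros gL)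
      fix y z assume yz: "y \<in> ?I" "z \<in> ?I"
      have "z\<^sup>2 / (2 * \<tau>) = y\<^sup>2 / (2 * \<tau>) + y / \<tau> * (z - y) + 1 / (2 * \<tau>) * (z - y)\<^sup>2"
        using \<tau>(1) by (simp add: field_simps power2_eq_square)
      then show "c z \<ge> c y + (g y - y / \<tau>) * (z - y) - 1 / (2 * \<tau>) * (z - y)\<^sup>2"
        using sub[OF yz] by (simp add: u_def left_diff_distrib)
    qed (use x \<tau> in auto)
  qed
  have "AE x in lebesgue. x \<notin> \<Union>(?N ` ?J)"
    using N by (intro AE_not_in) (simp add: negligible_iff_null_sets)
  then have "AE x in lebesgue. x \<in> ?I \<longrightarrow> twice_differentiable_at c x"
    by eventually_elim (use tw in blast)
  then show ?thesis by (subst AE_restrict_space_iff) auto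
qed

section \<open>Semiconvexity of the eigenvalue\<close>

lemma powr_minus_ge_tangent:
  fixes z a :: real
  assumes "z > 0" "a \<ge> 0"
  shows "1 - a * (z - 1) \<le> z powr (- a)"
proof -
  have "1 - a * (z - 1) \<le> 1 + (- a * ln z)"
    using mult_left_mono[OF ln_le_minus_one[OF assms(1)] assms(2)] by simp
  also have "\<dots> \<le> exp (- a * ln z)" by (rule exp_ge_add_one_self)
  also have "\<dots> = z powr (- a)" using assms(1) by (simp add: powr_def)
  finally show ?thesis .
qed

text \<open>The constant is the maximum of the second derivative on \<open>{m..}\<close>, twice what
  Taylor's formula gives. The mean value theorem and the tangent bound for the exponent
  \<open>r + 1\<close> avoid a second derivative; for \<open>z < 1\<close> the tangent bound is
  applied at \<open>1 / \<xi>\<close> and multiplied by \<open>\<xi> powr (- r - 1)\<close>.\<close>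

lemma powr_minus_le_parabola:
  fixes z r m :: real
  assumes r: "r \<ge> 0" and m: "0 < m" "m \<le> 1" and z: "m \<le> z"
  shows "z powr (- r) \<le> 1 - r * (z - 1) + r * (r + 1) * m powr (- r - 1) / m * (z - 1)\<^sup>2"
proof -
  define K where "K = r * (r + 1) * m powr (- r - 1) / m"
  define h where "h z = z powr (- r) - 1 + r * (z - 1)" for z
  have h1: "h 1 = 0" by (simp add: h_def)
  have der: "(h has_real_derivative r * (1 - x powr (- r - 1))) (at x)" if "x > 0" for x
    unfolding h_def[abs_def] using that by (auto intro!: derivative_eq_intros simp: algebra_simps)
  have "1 powr (- r - 1) \<le> m powr (- r - 1)" using m r by (intro powr_mono2') auto
  then have mp: "1 \<le> m powr (- r - 1)" by simp
  have mp2: "1 \<le> m powr (- r - 1) / m" using m mp by (simp add: pos_le_divide_eq)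
  consider "z = 1" | "1 < z" | "z < 1" by linarith
  then have "h z \<le> K * (z - 1)\<^sup>2"
  proof cases
    case 1 then show ?thesis using h1 by simp
  next
    case 2
    obtain \<xi> where \<xi>: "1 < \<xi>" "\<xi> < z" "h z - h 1 = (z - 1) * (r * (1 - \<xi> powr (- r - 1)))"
      using MVT2[OF 2, of h "\<lambda>x. r * (1 - x powr (- r - 1))"] der by fastforce
    have "1 - \<xi> powr (- r - 1) \<le> (r + 1) * (\<xi> - 1)"
      using powr_minus_ge_tangent[of \<xi> "r + 1"] \<xi> r by simp
    also have "\<dots> \<le> (r + 1) * (z - 1)" using \<xi> r by (intro mult_left_mono) auto
    finally have "(z - 1) * (r * (1 - \<xi> powr (- r - 1))) \<le> (z - 1) * (r * ((r + 1) * (z - 1)))"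
      using 2 r by (intro mult_left_mono) auto
    also have "\<dots> = (r * (r + 1) * (z - 1)\<^sup>2) * 1" by (simp add: power2_eq_square algebra_simps)
    also have "\<dots> \<le> (r * (r + 1) * (z - 1)\<^sup>2) * (m powr (- r - 1) / m)"
      using mp2 r by (intro mult_left_mono) auto
    also have "\<dots> = K * (z - 1)\<^sup>2" by (simp add: K_def)
    finally show ?thesis using \<xi>(3) h1 by simp
  next
    case 3
    have z0: "z > 0" using z m by linarith
    obtain \<xi> where \<xi>: "z < \<xi>" "\<xi> < 1" "h 1 - h z = (1 - z) * (r * (1 - \<xi> powr (- r - 1)))"
      using MVT2[OF 3, of h "\<lambda>x. r * (1 - x powr (- r - 1))"] der z0 by fastforce
    have \<xi>0: "\<xi> > 0" "m \<le> \<xi>" using \<xi> z0 z by auto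
    define P where "P = \<xi> powr (- r - 1)"
    have P: "0 < P" "P \<le> m powr (- r - 1)" using \<xi>0 m r by (auto simp: P_def intro!: powr_mono2')
    have inv: "(1 / \<xi>) powr (- (r + 1)) * P = 1"
      using \<xi>0 by (simp add: P_def powr_divide flip: powr_add)
    have "1 - (1 / \<xi>) powr (- (r + 1)) \<le> (r + 1) * (1 / \<xi> - 1)"
      using powr_minus_ge_tangent[of "1 / \<xi>" "r + 1"] \<xi>0 r by simp
    also have "1 / \<xi> - 1 = (1 - \<xi>) / \<xi>" using \<xi>0 by (simp add: field_simps)
    also have "(r + 1) * ((1 - \<xi>) / \<xi>) \<le> (r + 1) * ((1 - z) / m)"
      using \<xi> \<xi>0 m r z by (intro mult_left_mono frac_le) auto
    finally have "(1 - (1 / \<xi>) powr (- (r + 1))) * P \<le> (r + 1) * ((1 - z) / m) * P"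
      using P by (intro mult_right_mono) auto
    also have "\<dots> \<le> (r + 1) * ((1 - z) / m) * m powr (- r - 1)"
      using P r 3 m by (intro mult_left_mono) auto
    finally have "P - 1 \<le> (r + 1) * ((1 - z) / m) * m powr (- r - 1)"
      using inv by (simp add: left_diff_distrib)
    then have "(1 - z) * r * (P - 1) \<le> (1 - z) * r * ((r + 1) * ((1 - z) / m) * m powr (- r - 1))"
      using 3 r by (intro mult_left_mono) auto
    also have "\<dots> = K * (1 - z)\<^sup>2" by (simp add: K_def power2_eq_square)
    also have "(1 - z)\<^sup>2 = (z - 1)\<^sup>2" by (rule power2_commute)
    finally show ?thesis using \<xi>(3) h1 by (simp add: P_def algebra_simps)
  qed
  then show ?thesis by (simp add: h_def K_def)
qed

text \<open>\<open>B\<close> is a weighted mean of \<open>z powr (- r)\<close> over two ratios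
  \<open>z1\<close>, \<open>z2\<close> whose weighted mean is one. The tangent at one gives
  \<open>1 \<le> B\<close>; the parabola gives the upper bound, through the variance
  \<open>s * t * (\<mu>1 - \<mu>2)\<^sup>2 / \<mu>\<^sup>2\<close>. The lower bound
  \<open>m / 2\<close> for the ratios comes from \<open>\<mu> \<le> 2\<close>, the division by
  \<open>m\<^sup>2\<close> from \<open>m \<le> \<mu>\<close>.\<close>

lemma harmonic_weight_bounds:
  fixes r m s t \<mu>1 \<mu>2 \<mu> :: real
  assumes r: "r \<ge> 0" and m: "0 < m" "m \<le> 1" and st: "s > 0" "t > 0" "s + t = 1"
    and \<mu>i: "m \<le> \<mu>1" "m \<le> \<mu>2" "\<mu>1 \<le> 2" "\<mu>2 \<le> 2" and \<mu>: "\<mu> = s * \<mu>1 + t * \<mu>2"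
  defines "B \<equiv> s * (\<mu> / \<mu>1) powr r + t * (\<mu> / \<mu>2) powr r"
    and "K \<equiv> r * (r + 1) * (m / 2) powr (- r - 1) / (m / 2) / m\<^sup>2"
  shows "1 \<le> B" "B \<le> 1 + K * (s * t * (\<mu>1 - \<mu>2)\<^sup>2)"
proof -
  have "m = s * m + t * m" "2 = s * 2 + t * (2::real)" using st(3) by (simp_all flip: distrib_right)
  then have \<mu>b: "m \<le> \<mu>" "\<mu> \<le> 2"
    using \<mu> mult_left_mono[OF \<mu>i(1), of s] mult_left_mono[OF \<mu>i(2), of t]
      mult_left_mono[OF \<mu>i(3), of s] mult_left_mono[OF \<mu>i(4), of t] st by linarith+
  have pos: "\<mu>1 > 0" "\<mu>2 > 0" "\<mu> > 0" using m \<mu>i \<mu>b by linarith+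
  define z1 where "z1 = \<mu>1 / \<mu>"
  define z2 where "z2 = \<mu>2 / \<mu>"
  have b: "(\<mu> / \<mu>1) powr r = z1 powr (- r)" "(\<mu> / \<mu>2) powr r = z2 powr (- r)"
    using pos by (simp_all add: z1_def z2_def powr_divide powr_minus field_simps)
  have zb: "m / 2 \<le> z1" "m / 2 \<le> z2"
    unfolding z1_def z2_def by (rule frac_le; use pos \<mu>i \<mu>b in simp)+
  have e1: "z1 - 1 = t * (\<mu>1 - \<mu>2) / \<mu>" and e2: "z2 - 1 = - s * (\<mu>1 - \<mu>2) / \<mu>"
  proof -
    have "\<mu>1 - \<mu> = (s + t) * \<mu>1 - (s * \<mu>1 + t * \<mu>2)" "\<mu>2 - \<mu> = (s + t) * \<mu>2 - (s * \<mu>1 + t * \<mu>2)"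
      using \<mu> st(3) by simp_all
    then have "\<mu>1 - \<mu> = t * (\<mu>1 - \<mu>2)" "\<mu>2 - \<mu> = - s * (\<mu>1 - \<mu>2)" by (simp_all add: algebra_simps)
    moreover have "z1 - 1 = (\<mu>1 - \<mu>) / \<mu>" "z2 - 1 = (\<mu>2 - \<mu>) / \<mu>"
      using pos by (simp_all add: z1_def z2_def diff_divide_distrib)
    ultimately show "z1 - 1 = t * (\<mu>1 - \<mu>2) / \<mu>" "z2 - 1 = - s * (\<mu>1 - \<mu>2) / \<mu>" by simp_all
  qed
  have lin: "s * (z1 - 1) + t * (z2 - 1) = 0" unfolding e1 e2 by simp
  define e where "e = (\<mu>1 - \<mu>2) / \<mu>"
  have ez: "z1 - 1 = t * e" "z2 - 1 = - s * e" using e1 e2 by (simp_all add: e_def)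
  have "s * (z1 - 1)\<^sup>2 + t * (z2 - 1)\<^sup>2 = s * t * (s + t) * e\<^sup>2"
    unfolding ez by (simp add: power2_eq_square algebra_simps)
  then have "s * (z1 - 1)\<^sup>2 + t * (z2 - 1)\<^sup>2 = s * t * (s + t) * (\<mu>1 - \<mu>2)\<^sup>2 / \<mu>\<^sup>2"
    by (simp add: e_def power_divide)
  then have quad: "s * (z1 - 1)\<^sup>2 + t * (z2 - 1)\<^sup>2 = s * t * (\<mu>1 - \<mu>2)\<^sup>2 / \<mu>\<^sup>2" using st(3) by simp
  have z0: "z1 > 0" "z2 > 0" using pos by (simp_all add: z1_def z2_def)
  have "s * (1 - r * (z1 - 1)) + t * (1 - r * (z2 - 1)) \<le> B"
    unfolding B_def b using st z0 r by (intro add_mono mult_left_mono powr_minus_ge_tangent) auto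
  moreover have split: "s * (1 - r * (z1 - 1)) + t * (1 - r * (z2 - 1)) = (s + t) - r * (s * (z1 - 1) + t * (z2 - 1))"
    by (simp add: algebra_simps)
  ultimately show "1 \<le> B" using lin st(3) by simp
  define L where "L = r * (r + 1) * (m / 2) powr (- r - 1) / (m / 2)"
  have L: "L \<ge> 0" using r m by (simp add: L_def)
  have "B \<le> s * (1 - r * (z1 - 1) + L * (z1 - 1)\<^sup>2) + t * (1 - r * (z2 - 1) + L * (z2 - 1)\<^sup>2)"
    unfolding B_def b L_def using st z0 r m zb by (intro add_mono mult_left_mono powr_minus_le_parabola) auto
  also have "\<dots> = (s * (1 - r * (z1 - 1)) + t * (1 - r * (z2 - 1))) + L * (s * (z1 - 1)\<^sup>2 + t * (z2 - 1)\<^sup>2)"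
    by (simp add: algebra_simps)
  also have "\<dots> = 1 + L * (s * t * (\<mu>1 - \<mu>2)\<^sup>2 / \<mu>\<^sup>2)" unfolding split lin quad using st(3) by simp
  also have "\<dots> \<le> 1 + L * (s * t * (\<mu>1 - \<mu>2)\<^sup>2 / m\<^sup>2)"
  proof -
    have "m\<^sup>2 \<le> \<mu>\<^sup>2" using m \<mu>b by (intro power_mono) auto
    moreover have "0 \<le> s * t * (\<mu>1 - \<mu>2)\<^sup>2" using st by simp
    ultimately show ?thesis
      using L m pos by (intro add_left_mono mult_left_mono divide_left_mono) auto
  qed
  also have "\<dots> = 1 + K * (s * t * (\<mu>1 - \<mu>2)\<^sup>2)" by (simp add: K_def L_def)
  finally show "B \<le> 1 + K * (s * t * (\<mu>1 - \<mu>2)\<^sup>2)" .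
qed

text \<open>For \<open>s + t = 1\<close>, the identity
  \<open>s x^2 + t y^2 - (s x + t y)^2 = s t (x - y)^2\<close> shows that adding
  \<open>M x^2\<close> compensates the error exactly.\<close>

lemma semiconvex_onI:
  fixes u :: "real \<Rightarrow> real"
  assumes I: "convex I" and M: "M > 0"
    and le: "\<And>x y s. x \<in> I \<Longrightarrow> y \<in> I \<Longrightarrow> 0 < s \<Longrightarrow> s < 1 \<Longrightarrow>
      u (s * x + (1 - s) * y) \<le> s * u x + (1 - s) * u y + M * (s * (1 - s) * (x - y)\<^sup>2)"
  shows "semiconvex_on I u"
  unfolding semiconvex_on_def
proof (intro exI[of _ "1 / (2 * M)"] conjI)
  show "0 < 1 / (2 * M)" using M by simp
  have eq: "\<bar>x\<bar>\<^sup>2 / (2 * (1 / (2 * M))) = M * x\<^sup>2" for x using M by simp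
  show "convex_on I (\<lambda>x. u x + \<bar>x\<bar>\<^sup>2 / (2 * (1 / (2 * M))))"
    unfolding eq
  proof (rule convex_onI[OF _ I])
    fix t x y :: real assume t: "0 < t" "t < 1" and xy: "x \<in> I" "y \<in> I"
    have "u (t * y + (1 - t) * x) \<le> t * u y + (1 - t) * u x + M * (t * (1 - t) * (y - x)\<^sup>2)"
      by (rule le[OF xy(2,1) t])
    moreover have "M * (t * y + (1 - t) * x)\<^sup>2 + M * (t * (1 - t) * (y - x)\<^sup>2) = t * (M * y\<^sup>2) + (1 - t) * (M * x\<^sup>2)"
      by (simp add: power2_eq_square algebra_simps)
    moreover have e: "(1 - t) *\<^sub>R x + t *\<^sub>R y = t * y + (1 - t) * x" by simp
    moreover have "(1 - t) * (u x + M * x\<^sup>2) + t * (u y + M * y\<^sup>2)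
      = (1 - t) * u x + (1 - t) * (M * x\<^sup>2) + t * u y + t * (M * y\<^sup>2)" by (simp add: algebra_simps)
    ultimately show "u ((1 - t) *\<^sub>R x + t *\<^sub>R y) + M * ((1 - t) *\<^sub>R x + t *\<^sub>R y)\<^sup>2
      \<le> (1 - t) * (u x + M * x\<^sup>2) + t * (u y + M * y\<^sup>2)" unfolding e by linarith
  qed
qed

text \<open>The constants have to be uniform in \<open>l\<close>: the factors \<open>1 + l\<close>
  lie between \<open>m\<close> and \<open>2\<close>, and every dilate contains
  \<open>cball 0 (m * \<kappa>)\<close> and lies in \<open>U\<close>.\<close>

theorem additive_eigenvalue_semiconvex:
  fixes \<epsilon> p \<kappa> \<epsilon>\<^sub>0 :: real
    and U \<Omega> :: "'a::euclidean_space set"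
    and f :: "'a \<Rightarrow> real"
    and c :: "real \<Rightarrow> real"
  assumes eps: "\<epsilon> > 0" and p: "p > 2" and U: "bounded U"
    and f: "continuous_on (closure U) f"
    and Omega: "open \<Omega>" "bounded \<Omega>" "connected \<Omega>"
    and kappa: "\<kappa> > 0" "cball 0 \<kappa> \<subseteq> \<Omega>"
    and eps0: "\<epsilon>\<^sub>0 \<in> {0<..<1}" "\<And>l. \<bar>l\<bar> < \<epsilon>\<^sub>0 \<Longrightarrow> (\<lambda>y. (1 + l) *\<^sub>R y) ` \<Omega> \<subseteq> U"
    and f_semiconcave: "semiconcave_on (closure U) f"
    and c: "\<And>l. l \<in> {-\<epsilon>\<^sub>0<..<\<epsilon>\<^sub>0} \<Longrightarrow>
      c l = additive_eigenvalue \<epsilon> (Hamiltonian p f) ((\<lambda>y. (1 + l) *\<^sub>R y) ` \<Omega>)"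
  shows "semiconvex_on {-\<epsilon>\<^sub>0<..<\<epsilon>\<^sub>0} c"
proof -
  define S where "S l = (\<lambda>y. (1 + l) *\<^sub>R y) ` \<Omega>" for l :: real
  let ?I = "{-\<epsilon>\<^sub>0<..<\<epsilon>\<^sub>0}"
  define m where "m = 1 - \<epsilon>\<^sub>0"
  have m: "0 < m" "m \<le> 1" using eps0(1) by (auto simp: m_def)
  have \<mu>: "m \<le> 1 + l" "1 + l \<le> 2" "1 + l > 0" if "l \<in> ?I" for l
    using that eps0(1) by (auto simp: m_def)
  have S_open: "open (S l)" if "l \<in> ?I" for l
    unfolding S_def using \<mu>[OF that] Omega(1) by (intro open_scaling) auto
  have S_conn: "connected (S l)" for l
    unfolding S_def by (intro connected_continuous_image continuous_intros Omega(3))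
  have S_ball: "cball 0 (m * \<kappa>) \<subseteq> S l" if l: "l \<in> ?I" for l
  proof
    fix y :: 'a assume y: "y \<in> cball 0 (m * \<kappa>)"
    have "norm y \<le> m * \<kappa>" using y by simp
    also have "\<dots> \<le> (1 + l) * \<kappa>" using \<mu>[OF l] kappa(1) by (intro mult_right_mono) auto
    finally have "(1 / (1 + l)) *\<^sub>R y \<in> cball 0 \<kappa>" using \<mu>[OF l] by (simp add: field_simps)
    then have "(1 / (1 + l)) *\<^sub>R y \<in> \<Omega>" using kappa(2) by blast
    moreover have "y = (1 + l) *\<^sub>R ((1 / (1 + l)) *\<^sub>R y)" using \<mu>[OF l] by simp
    ultimately show "y \<in> S l" unfolding S_def by blast
  qed
  have S_U: "S l \<subseteq> closure U" if "l \<in> ?I" for l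
    using eps0(2)[of l] that closure_subset unfolding S_def by fastforce
  have S_f: "continuous_on (S l) f" if "l \<in> ?I" for l
    by (rule continuous_on_subset[OF f S_U[OF that]])
  have "bounded (f ` closure U)"
    using f U by (intro compact_imp_bounded compact_continuous_image) (auto simp: compact_eq_bounded_closed)
  then obtain F where F: "\<And>x. x \<in> closure U \<Longrightarrow> \<bar>f x\<bar> \<le> F" by (auto simp: bounded_iff)
  have SF: "\<bar>f x\<bar> \<le> F" if "l \<in> ?I" "x \<in> S l" for l x using F S_U that by blast
  have mk: "m * \<kappa> > 0" using m kappa(1) by simp
  have c_eq: "c l = additive_eigenvalue \<epsilon> (Hamiltonian p f) (S l)" if "l \<in> ?I" for l
    using c[OF that] by (simp add: S_def)
  have adm: "admissible \<epsilon> p f (S l) (c l)" if l: "l \<in> ?I" for l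
    unfolding c_eq[OF l]
    by (rule additive_eigenvalue_is_minimum(1)[OF p eps S_open[OF l] S_conn mk S_ball[OF l] S_f[OF l]])
      (rule SF[OF l])
  have least: "c l \<le> a" if l: "l \<in> ?I" and a: "admissible \<epsilon> p f (S l) a" for l a
    unfolding c_eq[OF l]
    by (rule additive_eigenvalue_is_minimum(2)[OF p eps S_open[OF l] S_conn mk S_ball[OF l] S_f[OF l] _ a])
      (rule SF[OF l])
  obtain N where N: "\<And>S c F. open S \<Longrightarrow> cball 0 (m * \<kappa>) \<subseteq> S \<Longrightarrow> (\<And>x. x \<in> S \<Longrightarrow> f x \<le> F) \<Longrightarrow>
    admissible \<epsilon> p f S c \<Longrightarrow> - F - N \<le> c" and N0: "N \<ge> 0"
    using admissible_lower_bound[OF p eps mk, of f] by metis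
  have c_bound: "\<bar>c l\<bar> \<le> F + N" if l: "l \<in> ?I" for l
  proof -
    have "c l \<le> F"
      using SF[OF l] by (intro least[OF l] admissible_const[OF S_open[OF l] eps]) (auto simp: abs_le_iff)
    moreover have "- F - N \<le> c l"
      using SF[OF l] by (intro N[OF S_open[OF l] S_ball[OF l] _ adm[OF l]]) (auto simp: abs_le_iff)
    ultimately show ?thesis using N0 by (simp add: abs_le_iff)
  qed
  obtain W where W: "\<And>x. x \<in> \<Omega> \<Longrightarrow> norm x \<le> W" using Omega(2) by (auto simp: bounded_iff)
  obtain \<tau> where \<tau>: "\<tau> > 0" "\<And>x y s. closed_segment x y \<subseteq> closure U \<Longrightarrow> s \<in> {0..1} \<Longrightarrow>
      s * f x + (1 - s) * f y - s * (1 - s) * ((norm (x - y))\<^sup>2 / (2 * \<tau>)) \<le> f (s *\<^sub>R x + (1 - s) *\<^sub>R y)"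
    using f_semiconcave unfolding semiconcave_on_def by blast
  define r where "r = p / (p - 1)"
  have r: "r \<ge> 0" using p by (simp add: r_def)
  define K where "K = r * (r + 1) * (m / 2) powr (- r - 1) / (m / 2) / m\<^sup>2"
  have K: "K \<ge> 0" using r m by (simp add: K_def)
  define Z where "Z = F + N + F"
  have Z: "Z \<ge> 0"
  proof -
    have 0: "0 \<in> ?I" using eps0(1) by simp
    have "(0::'a) \<in> cball 0 (m * \<kappa>)" using mk by simp
    then have "\<bar>f 0\<bar> \<le> F" using SF[OF 0] S_ball[OF 0] by blast
    then show ?thesis using c_bound[OF 0] unfolding Z_def by linarith
  qed
  \<comment> \<open>The three terms pay for the semiconcavity of \<open>f\<close>, for the deviation
    of \<open>B\<close> from one, and for strict positivity.\<close>
  define M where "M = W\<^sup>2 / (2 * \<tau>) + Z * K + 1"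
  have M: "M > 0" using \<tau>(1) Z K by (auto simp: M_def intro!: add_nonneg_pos add_nonneg_nonneg)
  show ?thesis
  proof (rule semiconvex_onI[OF _ M])
    show "convex ?I" by simp
    fix l1 l2 s :: real assume l: "l1 \<in> ?I" "l2 \<in> ?I" and s: "0 < s" "s < 1"
    define t where "t = 1 - s"
    have st: "s > 0" "t > 0" "s + t = 1" using s by (auto simp: t_def)
    define l0 where "l0 = s * l1 + t * l2"
    have l0: "l0 \<in> ?I"
      using convexD[of ?I l1 l2 s t] l st by (simp add: l0_def)
    have "1 + l0 = (s + t) + (s * l1 + t * l2)" using st by (simp add: l0_def)
    then have \<mu>0: "1 + l0 = s * (1 + l1) + t * (1 + l2)" by (simp add: algebra_simps)
    define b1 where "b1 = (1 + l0) / (1 + l1)"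
    define b2 where "b2 = (1 + l0) / (1 + l2)"
    define B where "B = s * b1 powr r + t * b2 powr r"
    define d where "d = s * t * (l1 - l2)\<^sup>2"
    have d: "d \<ge> 0" using st by (simp add: d_def)
    have B: "1 \<le> B" "B \<le> 1 + K * d"
      using harmonic_weight_bounds[OF r m st \<mu>(1)[OF l(1)] \<mu>(1)[OF l(2)] \<mu>(2)[OF l(1)] \<mu>(2)[OF l(2)] \<mu>0]
      by (simp_all add: B_def b1_def b2_def K_def d_def)
    have key: "(s * (c l1 + f ((1 / b1) *\<^sub>R x)) + t * (c l2 + f ((1 / b2) *\<^sub>R x))) / B - f x
        \<le> s * c l1 + t * c l2 + M * d" if x: "x \<in> S l0" for x
    proof -
      obtain w where w: "w \<in> \<Omega>" "x = (1 + l0) *\<^sub>R w" using x by (auto simp: S_def)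
      define x1 where "x1 = (1 + l1) *\<^sub>R w"
      define x2 where "x2 = (1 + l2) *\<^sub>R w"
      have xi: "(1 / b1) *\<^sub>R x = x1" "(1 / b2) *\<^sub>R x = x2"
        using \<mu>[OF l0] by (simp_all add: w(2) b1_def b2_def x1_def x2_def)
      have xS: "x1 \<in> S l1" "x2 \<in> S l2" using w(1) by (auto simp: S_def x1_def x2_def)
      \<comment> \<open>Points between two dilates of \<open>w\<close> are dilates of
        \<open>w\<close> by intermediate factors, so the segment stays in the closure of
        \<open>U\<close> even if \<Omega> is not convex.\<close>
      have seg: "closed_segment x1 x2 \<subseteq> closure U"
      proof
        fix y assume "y \<in> closed_segment x1 x2"
        then obtain \<sigma> where \<sigma>: "0 \<le> \<sigma>" "\<sigma> \<le> 1" "y = (1 - \<sigma>) *\<^sub>R x1 + \<sigma> *\<^sub>R x2"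
          by (auto simp: closed_segment_def)
        define l' where "l' = (1 - \<sigma>) * l1 + \<sigma> * l2"
        have "l' \<in> ?I" using convexD[of ?I l1 l2 "1 - \<sigma>" \<sigma>] l \<sigma> by (simp add: l'_def)
        moreover have "y = (1 + l') *\<^sub>R w"
          unfolding \<sigma>(3) x1_def x2_def l'_def by (simp add: algebra_simps)
        ultimately show "y \<in> closure U" using S_U[of l'] w(1) by (auto simp: S_def)
      qed
      have "s *\<^sub>R x1 + (1 - s) *\<^sub>R x2 = x"
        unfolding w(2) \<mu>0 x1_def x2_def t_def by (simp add: algebra_simps)
      then have fx: "s * f x1 + t * f x2 - s * t * ((norm (x1 - x2))\<^sup>2 / (2 * \<tau>)) \<le> f x"
        using \<tau>(2)[OF seg, of s] s by (simp add: t_def)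
      have "x1 - x2 = (l1 - l2) *\<^sub>R w" by (simp add: x1_def x2_def algebra_simps)
      then have "(norm (x1 - x2))\<^sup>2 = (l1 - l2)\<^sup>2 * (norm w)\<^sup>2" by (simp add: power_mult_distrib)
      also have "\<dots> \<le> (l1 - l2)\<^sup>2 * W\<^sup>2" using W[OF w(1)] by (intro mult_left_mono power_mono) auto
      finally have "s * t * ((norm (x1 - x2))\<^sup>2 / (2 * \<tau>)) \<le> s * t * ((l1 - l2)\<^sup>2 * W\<^sup>2 / (2 * \<tau>))"
        using st \<tau>(1) by (intro mult_left_mono divide_right_mono) auto
      also have "\<dots> = W\<^sup>2 / (2 * \<tau>) * d" by (simp add: d_def)
      finally have fx': "s * f x1 + t * f x2 - f x \<le> W\<^sup>2 / (2 * \<tau>) * d" using fx by linarith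
      define Y where "Y = s * (c l1 + f x1) + t * (c l2 + f x2)"
      have "\<bar>c l1 + f x1\<bar> \<le> Z" "\<bar>c l2 + f x2\<bar> \<le> Z"
        using c_bound l SF[OF l(1) xS(1)] SF[OF l(2) xS(2)] unfolding Z_def by (smt (verit))+
      then have "- Z \<le> c l1 + f x1" "- Z \<le> c l2 + f x2" by (auto simp: abs_le_iff)
      then have "s * (- Z) + t * (- Z) \<le> Y" unfolding Y_def using st by (intro add_mono mult_left_mono) auto
      moreover have "s * (- Z) + t * (- Z) = (s + t) * (- Z)" by (rule distrib_right[symmetric])
      ultimately have Y: "- Z \<le> Y" using st(3) by simp
      \<comment> \<open>\<open>Y\<close> may be negative, and then division by \<open>B\<close>
        raises it; the lower bound \<open>- Z\<close> limits this to
        \<open>Z * (B - 1)\<close>.\<close>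
      have "Y / B \<le> Y + Z * (B - 1)"
      proof -
        have "0 \<le> (Y + Z * B) * (B - 1)"
        proof (rule mult_nonneg_nonneg)
          have "Z * 1 \<le> Z * B" using Z B(1) by (intro mult_left_mono) auto
          then show "0 \<le> Y + Z * B" using Y by linarith
        qed (use B in simp)
        then have "Y \<le> (Y + Z * (B - 1)) * B" by (simp add: algebra_simps)
        then show ?thesis using B(1) by (simp add: pos_divide_le_eq)
      qed
      also have "Z * (B - 1) \<le> Z * (K * d)" using Z B(2) by (intro mult_left_mono) auto
      finally have "Y / B \<le> Y + Z * (K * d)" by simp
      moreover have "Y = s * c l1 + t * c l2 + (s * f x1 + t * f x2)" by (simp add: Y_def algebra_simps)
      moreover have "M * d = W\<^sup>2 / (2 * \<tau>) * d + Z * (K * d) + d" by (simp add: M_def algebra_simps)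
      ultimately show ?thesis using fx' d unfolding xi Y_def[symmetric] by linarith
    qed
    have "admissible \<epsilon> p f (S l0) (s * c l1 + t * c l2 + M * d)"
    proof (rule admissible_combination[where T="\<lambda>i. if i = 1 then S l1 else S l2" and c="\<lambda>i. if i = 1 then c l1 else c l2"
          and s="\<lambda>i. if i = 1 then s else t" and b="\<lambda>i. if i = 1 then b1 else b2" and B=B, OF eps _ S_open[OF l0]])
      show "p > 1" using p by simp
      have bpos: "b1 > 0" "b2 > 0" using \<mu> l l0 by (auto simp: b1_def b2_def)
      have ST: "(1 / b1) *\<^sub>R x \<in> S l1" "(1 / b2) *\<^sub>R x \<in> S l2" if "x \<in> S l0" for x
        using that \<mu>[OF l0] by (auto simp: S_def b1_def b2_def)
      fix i :: nat assume i: "i \<in> {1, 2}"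
      show "open (if i = 1 then S l1 else S l2)" using S_open l by simp
      show "admissible \<epsilon> p f (if i = 1 then S l1 else S l2) (if i = 1 then c l1 else c l2)" using adm l by simp
      show "continuous_on (if i = 1 then S l1 else S l2) f" using S_f l by simp
      show "0 < (if i = 1 then s else t)" using st by simp
      show "0 < (if i = 1 then b1 else b2)" using bpos by simp
      show "(1 / (if i = 1 then b1 else b2)) *\<^sub>R x \<in> (if i = 1 then S l1 else S l2)" if "x \<in> S l0" for x
        using ST[OF that] by simp
    qed (use key in \<open>simp_all add: B_def r_def\<close>)
    then have "c l0 \<le> s * c l1 + t * c l2 + M * d" by (rule least[OF l0])
    then show "c (s * l1 + (1 - s) * l2) \<le> s * c l1 + (1 - s) * c l2 + M * (s * (1 - s) * (l1 - l2)\<^sup>2)"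
      by (simp add: l0_def t_def d_def)
  qed
qed

theorem theorem1p6:
  fixes \<epsilon> p \<kappa> \<epsilon>\<^sub>0 :: real
    and U \<Omega> :: "(real ^ 'n) set"
    and f :: "real ^ 'n \<Rightarrow> real"
    and c :: "real \<Rightarrow> real"
  assumes eps: "\<epsilon> > 0"
    and p: "p > 2"
    and U: "open U" "bounded U" "Ck_boundary \<infinity> U"
    and f_C1: "C1_closure f U"
    and Omega: "open \<Omega>" "bounded \<Omega>" "connected \<Omega>" "Ck_boundary 2 \<Omega>" "closure \<Omega> \<subseteq> U"
    and star: "\<And>x. x \<in> \<Omega> \<Longrightarrow> closed_segment 0 x \<subseteq> \<Omega>"
    and kappa: "\<kappa> > 0" "cball 0 \<kappa> \<subseteq> \<Omega>"
      "\<And>s x. s > 0 \<Longrightarrow> x \<in> (\<lambda>y. (1 + s) *\<^sub>R y) ` frontier \<Omega> \<Longrightarrow> infdist x (closure \<Omega>) \<ge> \<kappa> * s"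
    and eps0: "\<epsilon>\<^sub>0 \<in> {0<..<1}"
      "\<And>l. \<bar>l\<bar> < \<epsilon>\<^sub>0 \<Longrightarrow> (\<lambda>y. (1 + l) *\<^sub>R y) ` \<Omega> \<subseteq> U"
    and f_semiconcave: "semiconcave_on (closure U) f"
    and c: "\<And>l. l \<in> {-\<epsilon>\<^sub>0<..<\<epsilon>\<^sub>0} \<Longrightarrow>
      c l = additive_eigenvalue \<epsilon> (Hamiltonian p f) ((\<lambda>y. (1 + l) *\<^sub>R y) ` \<Omega>)"
  shows "semiconvex_on {-\<epsilon>\<^sub>0<..<\<epsilon>\<^sub>0} c \<and>
    (AE l in lebesgue_on {-\<epsilon>\<^sub>0<..<\<epsilon>\<^sub>0}. twice_differentiable_at c l)"
proof
  have f_cont: "continuous_on (closure U) f" using f_C1 by (simp add: C1_closure_def)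
  show sc: "semiconvex_on {-\<epsilon>\<^sub>0<..<\<epsilon>\<^sub>0} c"
    by (rule additive_eigenvalue_semiconvex[OF eps p U(2) f_cont Omega(1-3) kappa(1,2) eps0 f_semiconcave c])
  show "AE l in lebesgue_on {-\<epsilon>\<^sub>0<..<\<epsilon>\<^sub>0}. twice_differentiable_at c l"
    by (rule semiconvex_twice_differentiable_AE[OF sc])
qed

end
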